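(* Let $\mathcal{S}_1\xrightarrow{\phi_1}\mathcal{S}_2\xrightarrow{\phi_2}\mathcal{S}_3\xrightarrow{\phi_3}\cdots$ be an inductive system in the category $\mathbf{OS}$ of operator systems and unital completely positive maps. For each $k\in\mathbb{N}$ let $J_k$ be a completely biproximinal kernel in $\mathcal{S}_k$ such that $\phi_k(J_k)\subseteq J_{k+1}$. Let $q_k:\mathcal{S}_k\to\mathcal{S}_k/J_k$ be the quotient maps, let $\psi_k:\mathcal{S}_k/J_k\to\mathcal{S}_{k+1}/J_{k+1}$ be the unital completely positive maps determined by $\psi_k\circ q_k=q_{k+1}\circ\phi_k$, let $\phi_{k,\infty}:\mathcal{S}_k\to\varinjlim_{\mathbf{OS}}\mathcal{S}_k$ and $\psi_{k,\infty}:\mathcal{S}_k/J_k\to\varinjlim_{\mathbf{OS}}(\mathcal{S}_k/J_k)$ be the canonical maps into the inductive limits, let $\varinjlim J_k=\overline{\bigcup_{k\in\mathbb{N}}\phi_{k,\infty}(J_k)}$ (closure in $\varinjlim_{\mathbf{OS}}\mathcal{S}_k$), and let $\gamma:\varinjlim_{\mathbf{OS}}\mathcal{S}_k\to(\varinjlim_{\mathbf{OS}}\mathcal{S}_k)/(\varinjlim J_k)$ be the quotient map. Then there exists a unital complete order isomorphism $\rho:\varinjlim_{\mathbf{OS}}(\mathcal{S}_k/J_k)\to(\varinjlim_{\mathbf{OS}}\mathcal{S}_k)/(\varinjlim J_k)$ such that $\rho\circ\psi_{k,\infty}\circ q_k=\gamma\circ\phi_{k,\infty}$ for all $k\in\m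athbb{N}$.
   Context: An operator system (not assumed complete) is a matrix ordered $*$-vector space with an Archimedean matrix order unit; it carries a canonical operator space structure ($\|X\|\le 1$ iff $\begin{pmatrix} 1_n & X \\ X^* & 1_n \end{pmatrix}\ge 0$ for $X\in M_n(\mathcal{S})$). Inductive limits in $\mathbf{OS}$ (objects with compatible unital completely positive maps from the $\mathcal{S}_k$, universal with this property) exist and are unique up to unital complete order isomorphism. A subspace $J\subseteq\mathcal{S}$ is a kernel if $J=\ker\phi$ for some unital completely positive map $\phi:\mathcal{S}\to\mathcal{T}$ into an operator system. For a kernel $J$, the quotient operator system $\mathcal{S}/J$ is the vector space quotient with $(x+J)^*=x^*+J$, unit $e+J$ and matrix cones $C_n(\mathcal{S}/J)=\{(x_{i,j}+J):\forall r>0\ \exists k_{i,j}\in J\text{ with }re^{(n)}+(x_{i,j}+k_{i,j})\in M_n(\mathcal{S})^+\}$; it is an operator system, and any unital completely positive map on $\mathcal{S}$ vanishing on $J$ factors through a unital completely positive map on $\mathcal{S}/J$. The kernel $J$ is completely biproximinal if the operator space structure of the operator system $\mathcal{S}/J$ coincides (completely isometrically) with the operator space quotient structure, given by $\|(x_{i,j}+J)\|=\inf\{\|(x_{i,j}+y_{i,j})\|_{M_n(\mathcal{S})}:y_{i,j}\in J\}$. When each $J_k$ is a completely biproximinal kernel in $\mathcal{S}_k$ with $\phi_k(J_k)\subseteq J_{k+1}$, $\varinjlim J_k$ is a kernel in $\varinjlim_{\mathbf{OS}}\mathcal{S}_k$, so the quotient operator system $(\varinjlim_{\mathbf{OS}}\mathcal{S}_k)/(\varinjlim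 J_k)$ is defined. A unital complete order isomorphism is a unital linear bijection, completely positive with completely positive inverse. *)

theory Defs
  imports "Jordan_Normal_Form.VS_Connect" "HOL-Algebra.AbelCoset"
begin

text \<open>
  Operator systems are carrier-based complex vector spaces, so that sequences of different systems
  and quotients by subspaces live in a single type. The ring fields \<open>mult\<close> and \<open>one\<close>
  inherited from the record \<^type>\<open>module\<close> play no role. Matrices are those of
  \<^theory>\<open>Jordan_Normal_Form.Matrix\<close>; \<open>pos S n\<close> is the positive cone of \<open>M_n(S)\<close>.
\<close>

record 'a opsys = "(complex, 'a) module" +
  adj :: "'a \<Rightarrow> 'a"
  order_unit :: 'a
  pos :: "nat \<Rightarrow> 'a mat set"

definition mats :: "nat \<Rightarrow> 'a set \<Rightarrow> 'a mat set" where
  "mats n A = {X \<in> carrier_mat n n. elements_mat X \<subseteq> A}"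

definition add_mats :: "'a opsys \<Rightarrow> 'a mat \<Rightarrow> 'a mat \<Rightarrow> 'a mat" where
  "add_mats S X Y =
     mat (dim_row X) (dim_col X) (\<lambda>(i, j). X $$ (i, j) \<oplus>\<^bsub>S\<^esub> Y $$ (i, j))"

definition smult_mats :: "'a opsys \<Rightarrow> complex \<Rightarrow> 'a mat \<Rightarrow> 'a mat" where
  "smult_mats S c X = map_mat (\<lambda>x. c \<odot>\<^bsub>S\<^esub> x) X"

definition zero_mats :: "'a opsys \<Rightarrow> nat \<Rightarrow> 'a mat" where
  "zero_mats S n = mat n n (\<lambda>_. \<zero>\<^bsub>S\<^esub>)"

definition unit_mats :: "'a opsys \<Rightarrow> nat \<Rightarrow> 'a mat" where
  "unit_mats S n = mat n n (\<lambda>(i, j). if i = j then order_unit S else \<zero>\<^bsub>S\<^esub>)"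

definition adj_mats :: "'a opsys \<Rightarrow> 'a mat \<Rightarrow> 'a mat" where
  "adj_mats S X = map_mat (adj S) (transpose_mat X)"

text \<open>\<open>compress_mats S A X\<close> is \<open>A* X A\<close> for a rectangular scalar matrix \<open>A\<close>.\<close>

definition compress_mats :: "'a opsys \<Rightarrow> complex mat \<Rightarrow> 'a mat \<Rightarrow> 'a mat" where
  "compress_mats S A X = mat (dim_col A) (dim_col A) (\<lambda>(i, j).
     \<Oplus>\<^bsub>S\<^esub>k\<in>{..<dim_row A}. \<Oplus>\<^bsub>S\<^esub>l\<in>{..<dim_row A}.
       (cnj (A $$ (k, i)) * A $$ (l, j)) \<odot>\<^bsub>S\<^esub> X $$ (k, l))"

locale star_vector_space = vectorspace class_ring S for S :: "'a opsys" (structure) +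
  assumes adj_closed: "x \<in> carrier S \<Longrightarrow> adj S x \<in> carrier S"
    and adj_adj: "x \<in> carrier S \<Longrightarrow> adj S (adj S x) = x"
    and adj_add: "\<lbrakk>x \<in> carrier S; y \<in> carrier S\<rbrakk> \<Longrightarrow> adj S (x \<oplus> y) = adj S x \<oplus> adj S y"
    and adj_smult: "x \<in> carrier S \<Longrightarrow> adj S (c \<odot> x) = cnj c \<odot> adj S x"

text \<open>
  Size 0 is allowed throughout and harmless: \<open>M_0(S)\<close> has a single element, and the axioms below
  force it to be positive.
\<close>

locale matrix_ordered_space = star_vector_space S for S :: "'a opsys" (structure) +
  assumes pos_mats: "pos S n \<subseteq> mats n (carrier S)"
    and pos_hermitian: "X \<in> pos S n \<Longrightarrow> adj_mats S X = X"
    and pos_add: "\<lbrakk>X \<in> pos S n; Y \<in> pos S n\<rbrakk> \<Longrightarrow> add_mats S X Y \<in> pos S n"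
    and pos_smult: "\<lbrakk>X \<in> pos S n; 0 \<le> t\<rbrakk> \<Longrightarrow> smult_mats S (complex_of_real t) X \<in> pos S n"
    and pos_proper: "\<lbrakk>X \<in> pos S n; smult_mats S (- 1) X \<in> pos S n\<rbrakk> \<Longrightarrow> X = zero_mats S n"
    and pos_compress: "\<lbrakk>X \<in> pos S n; A \<in> carrier_mat n m\<rbrakk> \<Longrightarrow> compress_mats S A X \<in> pos S m"

locale operator_system = matrix_ordered_space S for S :: "'a opsys" (structure) +
  assumes order_unit_closed: "order_unit S \<in> carrier S"
    and adj_order_unit: "adj S (order_unit S) = order_unit S"
    and matrix_order_unit:
      "\<lbrakk>X \<in> mats n (carrier S); adj_mats S X = X\<rbrakk> \<Longrightarrow>
         \<exists>r>0. add_mats S (smult_mats S (complex_of_real r) (unit_mats S n)) X \<in> pos S n"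
    and archimedean:
      "\<lbrakk>X \<in> mats n (carrier S);
        \<And>r. 0 < r \<Longrightarrow> add_mats S (smult_mats S (complex_of_real r) (unit_mats S n)) X \<in> pos S n\<rbrakk>
       \<Longrightarrow> X \<in> pos S n"

text \<open>
  The canonical norm on \<open>M_n(S)\<close>: rescaling the condition for \<open>\<parallel>X\<parallel> \<le> 1\<close>, for \<open>t > 0\<close> one has
  \<open>\<parallel>X\<parallel> \<le> t\<close> iff the block matrix with diagonal \<open>t e\<^sub>n\<close> and off-diagonal \<open>X\<close>, \<open>X*\<close> is positive.
\<close>

definition os_norm :: "'a opsys \<Rightarrow> nat \<Rightarrow> 'a mat \<Rightarrow> real" where
  "os_norm S n X = Inf {t. 0 < t \<and>
     four_block_mat (smult_mats S (complex_of_real t) (unit_mats S n)) X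
       (adj_mats S X) (smult_mats S (complex_of_real t) (unit_mats S n)) \<in> pos S (n + n)}"

definition os_closure :: "'a opsys \<Rightarrow> 'a set \<Rightarrow> 'a set" where
  "os_closure S A = {x \<in> carrier S. \<forall>\<epsilon>>0. \<exists>y\<in>A. os_norm S 1 (mat 1 1 (\<lambda>_. x \<ominus>\<^bsub>S\<^esub> y)) < \<epsilon>}"

definition ucp_map :: "'a opsys \<Rightarrow> 'b opsys \<Rightarrow> ('a \<Rightarrow> 'b) \<Rightarrow> bool" where
  "ucp_map S T f \<longleftrightarrow>
     f \<in> carrier S \<rightarrow> carrier T \<and>
     (\<forall>x\<in>carrier S. \<forall>y\<in>carrier S. f (x \<oplus>\<^bsub>S\<^esub> y) = f x \<oplus>\<^bsub>T\<^esub> f y) \<and>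
     (\<forall>c. \<forall>x\<in>carrier S. f (c \<odot>\<^bsub>S\<^esub> x) = c \<odot>\<^bsub>T\<^esub> f x) \<and>
     f (order_unit S) = order_unit T \<and>
     (\<forall>n. \<forall>X\<in>pos S n. map_mat f X \<in> pos T n)"

definition unital_complete_order_iso :: "'a opsys \<Rightarrow> 'b opsys \<Rightarrow> ('a \<Rightarrow> 'b) \<Rightarrow> bool" where
  "unital_complete_order_iso S T f \<longleftrightarrow>
     bij_betw f (carrier S) (carrier T) \<and> ucp_map S T f \<and> ucp_map T S (inv_into (carrier S) f)"

text \<open>
  HOL cannot quantify over the type of the target \<open>T\<close> inside a definition. The type \<^typ>\<open>'a set\<close>
  loses nothing: if \<open>J\<close> is the kernel of a unital completely positive map into an operator system
  on any type, it is also the kernel of the quotient map onto \<open>S/J\<close>, whose elements are cosets.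
\<close>

definition os_kernel :: "'a opsys \<Rightarrow> 'a set \<Rightarrow> bool" where
  "os_kernel S J \<longleftrightarrow> (\<exists>(T :: 'a set opsys) f. operator_system T \<and> ucp_map S T f \<and>
     J = {x \<in> carrier S. f x = \<zero>\<^bsub>T\<^esub>})"

definition quot_map :: "'a opsys \<Rightarrow> 'a set \<Rightarrow> 'a \<Rightarrow> 'a set" where
  "quot_map S J x = J +>\<^bsub>S\<^esub> x"

text \<open>
  As for \<open>FactRing\<close> in HOL-Algebra, operations on cosets are unions over representatives; for a
  subspace \<open>J\<close> closed under \<open>adj\<close> (every kernel is) they are \<open>c (x + J) = c x + J\<close> and
  \<open>(x + J)* = x* + J\<close>.
\<close>

definition os_quotient :: "'a opsys \<Rightarrow> 'a set \<Rightarrow> 'a set opsys" where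
  "os_quotient S J = \<lparr>
     carrier = a_rcosets\<^bsub>S\<^esub> J,
     mult = undefined,
     one = undefined,
     zero = J,
     add = set_add S,
     smult = (\<lambda>c A. \<Union>x\<in>A. quot_map S J (c \<odot>\<^bsub>S\<^esub> x)),
     adj = (\<lambda>A. \<Union>x\<in>A. quot_map S J (adj S x)),
     order_unit = quot_map S J (order_unit S),
     pos = (\<lambda>n. {map_mat (quot_map S J) X | X. X \<in> mats n (carrier S) \<and>
       (\<forall>r>0. \<exists>K\<in>mats n J.
          add_mats S (smult_mats S (complex_of_real r) (unit_mats S n)) (add_mats S X K)
            \<in> pos S n)})\<rparr>"

definition completely_biproximinal_kernel :: "'a opsys \<Rightarrow> 'a set \<Rightarrow> bool" where
  "completely_biproximinal_kernel S J \<longleftrightarrow> os_kernel S J \<and>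
     (\<forall>n. \<forall>X\<in>mats n (carrier S).
        os_norm (os_quotient S J) n (map_mat (quot_map S J) X) =
          (INF Y\<in>mats n J. os_norm S n (add_mats S X Y)))"

definition os_inductive_system :: "(nat \<Rightarrow> 'a opsys) \<Rightarrow> (nat \<Rightarrow> 'a \<Rightarrow> 'a) \<Rightarrow> bool" where
  "os_inductive_system S \<phi> \<longleftrightarrow>
     (\<forall>k. operator_system (S k) \<and> ucp_map (S k) (S (Suc k)) (\<phi> k))"

definition os_cocone ::
  "(nat \<Rightarrow> 'a opsys) \<Rightarrow> (nat \<Rightarrow> 'a \<Rightarrow> 'a) \<Rightarrow> 'b opsys \<Rightarrow> (nat \<Rightarrow> 'a \<Rightarrow> 'b) \<Rightarrow> bool" where
  "os_cocone S \<phi> T \<theta> \<longleftrightarrow> operator_system T \<and>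
     (\<forall>k. ucp_map (S k) T (\<theta> k) \<and> (\<forall>x\<in>carrier (S k). \<theta> (Suc k) (\<phi> k x) = \<theta> k x))"

text \<open>
  The universal property. HOL cannot quantify over the type of the test object \<open>T\<close>, so it ranges
  over the operator systems on one fixed, sufficiently large type: it contains a copy of \<open>L\<close> (as
  singletons) and of the standard construction \<open>L\<^sub>0\<close> of the limit as a quotient of the disjoint
  union of the \<open>S k\<close>. Comparing \<open>L\<close> with these two shows that \<open>L\<close> is isomorphic to \<open>L\<^sub>0\<close> compatibly
  with the canonical maps, so \<open>L\<close> is universal for operator systems on every type.
  Uniqueness of \<open>u\<close> is on the carrier, as values elsewhere are pinned by \<open>extensional\<close>.
\<close>

definition os_inductive_limit ::
  "(nat \<Rightarrow> 'a opsys) \<Rightarrow> (nat \<Rightarrow> 'a \<Rightarrow> 'a) \<Rightarrow> 'b opsys \<Rightarrow> (nat \<Rightarrow> 'a \<Rightarrow> 'b) \<Rightarrow> bool" where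
  "os_inductive_limit S \<phi> L \<eta> \<longleftrightarrow> os_cocone S \<phi> L \<eta> \<and>
     (\<forall>(T :: (nat \<times> 'a + 'b) set opsys) \<theta>. os_cocone S \<phi> T \<theta> \<longrightarrow>
        (\<exists>!u. u \<in> extensional (carrier L) \<and> ucp_map L T u \<and>
              (\<forall>k. \<forall>x\<in>carrier (S k). u (\<eta> k x) = \<theta> k x)))"

end

theory Submission
  imports Defs
begin

text \<open>
  By the universal property the cocone \<open>S\<^sub>k \<rightarrow> S\<^sub>k/J\<^sub>k \<rightarrow> M\<close> induces \<open>u : L \<rightarrow> M\<close>. The kernel of
  \<open>u\<close> is \<open>lim J\<^sub>k\<close>: an element \<open>\<phi>\<^sub>k\<^sub>,\<^sub>\<infinity>(z)\<close> that \<open>u\<close> kills has a vanishing norm along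
  \<open>S\<^sub>m/J\<^sub>m\<close>, and since the norm of \<open>S\<^sub>m/J\<^sub>m\<close> is the quotient norm by
  biproximinality, it is approximated by elements of \<open>J\<^sub>m\<close>. Hence \<open>u\<close>
  factors through \<open>L/lim J\<^sub>k\<close>. Conversely \<open>S\<^sub>k \<rightarrow> L/lim J\<^sub>k\<close> kills \<open>J\<^sub>k\<close> and so induces
  \<open>M \<rightarrow> L/lim J\<^sub>k\<close>; both composites are the identity on the images of the \<open>S\<^sub>k\<close>, which exhaust
  the two limits.

  That an abstract limit is exhausted by these images, that it is universal for test objects on every
  type and that \<open>\<phi>\<^sub>k\<^sub>,\<^sub>\<infinity>(x) = 0\<close> forces the norms of the images of \<open>x\<close> to tend to 0 is read off the
  standard model, eventually coherent sequences modulo null sequences. An element \<open>x\<close> is null if the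
  block matrix with zero diagonal and corners \<open>x\<close>, \<open>x*\<close> is positive.
\<close>

section \<open>Matrices over a star vector space\<close>

text \<open>Norms are kept out of the constructions. For \<open>t > 0\<close>, positivity of
  \<open>block_mat S t x\<close> expresses that the norm of \<open>x\<close> is at most
  \<open>t\<close>; this is preserved by every unital completely positive map, and the Archimedean
  axiom lets \<open>t\<close> tend to 0. A matrix over a quotient is positive when each shift by
  \<open>r e\<close> has a positive lift, and the lift depends on \<open>r\<close>. The same
  difficulty arises for \<open>S/J\<close> and for sequences modulo null sequences, so it is
  resolved once, for surjections onto a space with such cones. Everything except properness descends
  along them; properness comes from a map into a genuine operator system with the same kernel, or
  from the fact that null entries do not affect positivity. The quotient map is contractive, so the
  norm of \<open>S/J\<close> is at most the quotient norm. Biproximinality supplies the reverse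
  bound, and it enters only where the kernel of \<open>u\<close> is shown to lie in the closure.
  That the closure is a kernel, and hence that \<open>L/lim J\<close> is an operator system, is a
  consequence. The remaining obstacle is one of types: the limits are tested on one fixed type each,
  while \<open>L/lim J\<close> lives on another.\<close>

lemma mats_iff:
  "X \<in> mats n A \<longleftrightarrow> dim_row X = n \<and> dim_col X = n \<and> (\<forall>i<n. \<forall>j<n. X $$ (i, j) \<in> A)"
proof
  assume "X \<in> mats n A"
  then show "dim_row X = n \<and> dim_col X = n \<and> (\<forall>i<n. \<forall>j<n. X $$ (i, j) \<in> A)"
    by (auto simp: mats_def intro: subsetD elements_matI)
next
  assume "dim_row X = n \<and> dim_col X = n \<and> (\<forall>i<n. \<forall>j<n. X $$ (i, j) \<in> A)"
  then show "X \<in> mats n A"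
    unfolding mats_def by (auto dest!: elements_matD)
qed

lemma matsI:
  "\<lbrakk>dim_row X = n; dim_col X = n; \<And>i j. \<lbrakk>i < n; j < n\<rbrakk> \<Longrightarrow> X $$ (i, j) \<in> A\<rbrakk> \<Longrightarrow> X \<in> mats n A"
  by (simp add: mats_iff)

lemma matsD:
  assumes "X \<in> mats n A"
  shows "dim_row X = n" "dim_col X = n" "\<And>i j. \<lbrakk>i < n; j < n\<rbrakk> \<Longrightarrow> X $$ (i, j) \<in> A"
  using assms by (auto simp: mats_iff)

lemma mats_eqI:
  "\<lbrakk>X \<in> mats n A; Y \<in> mats n B; \<And>i j. \<lbrakk>i < n; j < n\<rbrakk> \<Longrightarrow> X $$ (i, j) = Y $$ (i, j)\<rbrakk> \<Longrightarrow> X = Y"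
  by (rule eq_matI) (auto simp: mats_iff)

lemma mats_lift:
  assumes "X \<in> mats n (f ` A)"
  obtains Y where "Y \<in> mats n A" "map_mat f Y = X"
proof
  define Y where "Y = map_mat (inv_into A f) X"
  show "Y \<in> mats n A"
    using assms by (auto simp: mats_iff Y_def inv_into_into)
  show "map_mat f Y = X"
    using assms by (auto simp: mats_iff Y_def f_inv_into_f intro!: eq_matI)
qed

text \<open>The order unit axioms and the cones of a quotient speak of \<open>r e + X\<close> for
  \<open>r > 0\<close>. Positivity arguments carry this expression around in place of an
  approximation in norm.\<close>

abbreviation shift_mats :: "'a opsys \<Rightarrow> nat \<Rightarrow> real \<Rightarrow> 'a mat \<Rightarrow> 'a mat" where
  "shift_mats S n r X \<equiv> add_mats S (smult_mats S (complex_of_real r) (unit_mats S n)) X"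

text \<open>The matrix that decides whether the norm of \<open>x\<close> is at most
  \<open>t\<close>. Unlike the infimum in \<open>os_norm\<close> it also makes sense at
  \<open>t = 0\<close>, where its positivity expresses that \<open>x\<close> has norm 0.\<close>

definition block_mat :: "'a opsys \<Rightarrow> real \<Rightarrow> 'a \<Rightarrow> 'a mat" where
  "block_mat S t x = mat 2 2 (\<lambda>(i, j).
     if i = j then complex_of_real t \<odot>\<^bsub>S\<^esub> order_unit S else if i = 0 then x else adj S x)"

lemma dim_mats [simp]:
  "dim_row (add_mats S X Y) = dim_row X" "dim_col (add_mats S X Y) = dim_col X"
  "dim_row (smult_mats S c X) = dim_row X" "dim_col (smult_mats S c X) = dim_col X"
  "dim_row (zero_mats S n) = n" "dim_col (zero_mats S n) = n"
  "dim_row (unit_mats S n) = n" "dim_col (unit_mats S n) = n"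
  "dim_row (adj_mats S X) = dim_col X" "dim_col (adj_mats S X) = dim_row X"
  "dim_row (compress_mats S A X) = dim_col A" "dim_col (compress_mats S A X) = dim_col A"
  "dim_row (block_mat S t x) = 2" "dim_col (block_mat S t x) = 2"
  by (simp_all add: add_mats_def smult_mats_def zero_mats_def unit_mats_def adj_mats_def
      compress_mats_def block_mat_def)

lemma index_mats [simp]:
  "\<lbrakk>i < dim_row X; j < dim_col X\<rbrakk> \<Longrightarrow>
     add_mats S X Y $$ (i, j) = X $$ (i, j) \<oplus>\<^bsub>S\<^esub> Y $$ (i, j)"
  "\<lbrakk>i < dim_row X; j < dim_col X\<rbrakk> \<Longrightarrow> smult_mats S c X $$ (i, j) = c \<odot>\<^bsub>S\<^esub> X $$ (i, j)"
  "\<lbrakk>i < n; j < n\<rbrakk> \<Longrightarrow> zero_mats S n $$ (i, j) = \<zero>\<^bsub>S\<^esub>"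
  "\<lbrakk>i < n; j < n\<rbrakk> \<Longrightarrow> unit_mats S n $$ (i, j) = (if i = j then order_unit S else \<zero>\<^bsub>S\<^esub>)"
  "\<lbrakk>i < dim_col X; j < dim_row X\<rbrakk> \<Longrightarrow> adj_mats S X $$ (i, j) = adj S (X $$ (j, i))"
  "\<lbrakk>i < 2; j < 2\<rbrakk> \<Longrightarrow> block_mat S t x $$ (i, j) =
     (if i = j then complex_of_real t \<odot>\<^bsub>S\<^esub> order_unit S else if i = 0 then x else adj S x)"
  by (simp_all add: add_mats_def smult_mats_def zero_mats_def unit_mats_def adj_mats_def
      block_mat_def)

context star_vector_space
begin

lemma scale_closed: "x \<in> carrier S \<Longrightarrow> c \<odot> x \<in> carrier S"
  by simp

lemma scale_zero [simp]: "c \<odot> \<zero> = \<zero>"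
  by simp

lemma zero_scale [simp]: "x \<in> carrier S \<Longrightarrow> 0 \<odot> x = \<zero>"
  using smult_l_null[of x] by simp

lemma one_scale [simp]: "x \<in> carrier S \<Longrightarrow> 1 \<odot> x = x"
  using smult_one[of x] by simp

lemma scale_add_left: "x \<in> carrier S \<Longrightarrow> (a + b) \<odot> x = a \<odot> x \<oplus> b \<odot> x"
  using smult_l_distr[of a b x] by simp

lemma scale_add_right:
  "\<lbrakk>x \<in> carrier S; y \<in> carrier S\<rbrakk> \<Longrightarrow> a \<odot> (x \<oplus> y) = a \<odot> x \<oplus> a \<odot> y"
  using smult_r_distr[of a x y] by simp

lemma scale_scale: "x \<in> carrier S \<Longrightarrow> a \<odot> (b \<odot> x) = (a * b) \<odot> x"
  using smult_assoc1[of a b x] by simp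

lemma scale_minus_one: "x \<in> carrier S \<Longrightarrow> (- 1) \<odot> x = \<ominus> x"
proof -
  assume x: "x \<in> carrier S"
  have "(- 1) \<odot> x \<oplus> x = ((- 1) + 1) \<odot> x"
    using x scale_add_left[of x "- 1" 1] by simp
  then have "(- 1) \<odot> x \<oplus> x = \<zero>"
    using x by simp
  then show ?thesis
    using x by (metis M.minus_equality scale_closed)
qed

lemma neg_zero [simp]: "\<ominus> \<zero> = \<zero>"
  using scale_minus_one[of "\<zero>"] by simp

lemma adj_zero [simp]: "adj S \<zero> = \<zero>"
  using adj_smult[of "\<zero>" 0] adj_closed by simp

lemma add_mats_closed:
  "\<lbrakk>X \<in> mats n (carrier S); Y \<in> mats n (carrier S)\<rbrakk> \<Longrightarrow> add_mats S X Y \<in> mats n (carrier S)"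
  by (simp add: mats_iff)

lemma smult_mats_closed: "X \<in> mats n (carrier S) \<Longrightarrow> smult_mats S c X \<in> mats n (carrier S)"
  by (simp add: mats_iff)

lemma zero_mats_closed: "zero_mats S n \<in> mats n (carrier S)"
  by (simp add: mats_iff)

lemma adj_mats_closed: "X \<in> mats n (carrier S) \<Longrightarrow> adj_mats S X \<in> mats n (carrier S)"
  by (simp add: mats_iff adj_closed)

lemma compress_mats_closed:
  "\<lbrakk>X \<in> mats n (carrier S); A \<in> carrier_mat n m\<rbrakk> \<Longrightarrow> compress_mats S A X \<in> mats m (carrier S)"
  by (auto simp: mats_iff compress_mats_def intro!: M.finsum_closed)

lemmas mats_closed = add_mats_closed smult_mats_closed zero_mats_closed adj_mats_closed
  compress_mats_closed

lemma compress_index: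
  "\<lbrakk>A \<in> carrier_mat n m; i < m; j < m\<rbrakk> \<Longrightarrow> compress_mats S A X $$ (i, j) =
     (\<Oplus>k\<in>{..<n}. \<Oplus>l\<in>{..<n}. (cnj (A $$ (k, i)) * A $$ (l, j)) \<odot> X $$ (k, l))"
  by (auto simp: compress_mats_def)

lemma compress_add:
  assumes X: "X \<in> mats n (carrier S)" and Y: "Y \<in> mats n (carrier S)" and A: "A \<in> carrier_mat n m"
  shows "compress_mats S A (add_mats S X Y) = add_mats S (compress_mats S A X) (compress_mats S A Y)"
proof (rule mats_eqI)
  show "compress_mats S A (add_mats S X Y) \<in> mats m (carrier S)"
    "add_mats S (compress_mats S A X) (compress_mats S A Y) \<in> mats m (carrier S)"
    using assms by (blast intro: mats_closed)+
next
  fix i j assume ij: "i < m" "j < m"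
  let ?c = "\<lambda>k l. cnj (A $$ (k, i)) * A $$ (l, j)"
  note D = matsD[OF X] matsD[OF Y]
  have inner: "(\<Oplus>l\<in>{..<n}. ?c k l \<odot> add_mats S X Y $$ (k, l))
      = (\<Oplus>l\<in>{..<n}. ?c k l \<odot> X $$ (k, l)) \<oplus> (\<Oplus>l\<in>{..<n}. ?c k l \<odot> Y $$ (k, l))"
    if "k < n" for k
  proof -
    have "(\<Oplus>l\<in>{..<n}. ?c k l \<odot> add_mats S X Y $$ (k, l))
        = (\<Oplus>l\<in>{..<n}. ?c k l \<odot> X $$ (k, l) \<oplus> ?c k l \<odot> Y $$ (k, l))"
      by (rule M.finsum_cong') (use that D in \<open>auto simp: scale_add_right\<close>)
    also have "\<dots> = (\<Oplus>l\<in>{..<n}. ?c k l \<odot> X $$ (k, l)) \<oplus> (\<Oplus>l\<in>{..<n}. ?c k l \<odot> Y $$ (k, l))"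
      by (rule M.finsum_addf) (use that D in auto)
    finally show ?thesis .
  qed
  have "compress_mats S A (add_mats S X Y) $$ (i, j)
      = (\<Oplus>k\<in>{..<n}. (\<Oplus>l\<in>{..<n}. ?c k l \<odot> X $$ (k, l)) \<oplus> (\<Oplus>l\<in>{..<n}. ?c k l \<odot> Y $$ (k, l)))"
    unfolding compress_index[OF A ij]
    by (rule M.finsum_cong') (use inner D in \<open>auto intro!: M.finsum_closed\<close>)
  also have "\<dots> = (\<Oplus>k\<in>{..<n}. \<Oplus>l\<in>{..<n}. ?c k l \<odot> X $$ (k, l))
      \<oplus> (\<Oplus>k\<in>{..<n}. \<Oplus>l\<in>{..<n}. ?c k l \<odot> Y $$ (k, l))"
    by (rule M.finsum_addf) (use D in \<open>auto intro!: M.finsum_closed\<close>)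
  also have "\<dots> = add_mats S (compress_mats S A X) (compress_mats S A Y) $$ (i, j)"
    using ij A by (simp add: compress_index[OF A ij])
  finally show "compress_mats S A (add_mats S X Y) $$ (i, j)
      = add_mats S (compress_mats S A X) (compress_mats S A Y) $$ (i, j)" .
qed

text \<open>Column \<open>a\<close> of the scalar matrix has the single entry \<open>c a\<close>, in
  row \<open>p a\<close>, so both sums collapse. Suitable \<open>p\<close> and \<open>c\<close>
  extract, permute and rescale rows and columns.\<close>

lemma compress_select:
  assumes X: "X \<in> mats n (carrier S)" and p: "\<And>a. a < m \<Longrightarrow> p a < n"
  shows "compress_mats S (mat n m (\<lambda>(k, a). if k = p a then c a else 0)) X
    = mat m m (\<lambda>(a, b). (cnj (c a) * c b) \<odot> X $$ (p a, p b))" (is "compress_mats S ?A X = ?R")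
proof (rule mats_eqI)
  show "compress_mats S ?A X \<in> mats m (carrier S)"
    using X by (blast intro: mats_closed mat_carrier)
  show "?R \<in> mats m (carrier S)"
    using X p by (auto simp: mats_iff)
next
  fix a b assume ab: "a < m" "b < m"
  note D = matsD[OF X]
  have A: "?A \<in> carrier_mat n m"
    by simp
  have inner: "(\<Oplus>l\<in>{..<n}. (cnj (?A $$ (k, a)) * ?A $$ (l, b)) \<odot> X $$ (k, l))
      = (if p a = k then (cnj (c a) * c b) \<odot> X $$ (k, p b) else \<zero>)" if "k < n" for k
  proof -
    have "(\<Oplus>l\<in>{..<n}. (cnj (?A $$ (k, a)) * ?A $$ (l, b)) \<odot> X $$ (k, l))
      = (\<Oplus>l\<in>{..<n}. if p b = l then (if p a = k then (cnj (c a) * c b) \<odot> X $$ (k, l) else \<zero>) else \<zero>)"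
      by (rule M.finsum_cong') (use ab p D that in auto)
    also have "\<dots> = (if p a = k then (cnj (c a) * c b) \<odot> X $$ (k, p b) else \<zero>)"
      by (rule M.finsum_singleton) (use ab p D that in auto)
    finally show ?thesis .
  qed
  have "compress_mats S ?A X $$ (a, b)
      = (\<Oplus>k\<in>{..<n}. if p a = k then (cnj (c a) * c b) \<odot> X $$ (k, p b) else \<zero>)"
    unfolding compress_index[OF A ab]
    by (rule M.finsum_cong') (use inner ab p D in auto)
  also have "\<dots> = (cnj (c a) * c b) \<odot> X $$ (p a, p b)"
    by (rule M.finsum_singleton) (use ab p D in auto)
  finally show "compress_mats S ?A X $$ (a, b) = ?R $$ (a, b)"
    using ab by simp
qed

lemma block_closed:
  "\<lbrakk>x \<in> carrier S; order_unit S \<in> carrier S\<rbrakk> \<Longrightarrow> block_mat S t x \<in> mats 2 (carrier S)"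
  by (auto simp: mats_iff adj_closed)

text \<open>The diagonal of the block matrix vanishes, so only the two mixed terms of the double sum
  survive. The columns of \<open>A\<close> are arbitrary, in contrast to
  \<open>compress_select\<close>.\<close>

lemma compress_block:
  assumes x: "x \<in> carrier S" and e: "order_unit S \<in> carrier S" and A: "A \<in> carrier_mat 2 m"
  shows "compress_mats S A (block_mat S 0 x) = mat m m (\<lambda>(a, b).
     (cnj (A $$ (0, a)) * A $$ (1, b)) \<odot> x \<oplus> (cnj (A $$ (1, a)) * A $$ (0, b)) \<odot> adj S x)"
proof (rule eq_matI)
  fix a b assume "a < dim_row (mat m m (\<lambda>(a, b).
     (cnj (A $$ (0, a)) * A $$ (1, b)) \<odot> x \<oplus> (cnj (A $$ (1, a)) * A $$ (0, b)) \<odot> adj S x))"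
    "b < dim_col (mat m m (\<lambda>(a, b).
     (cnj (A $$ (0, a)) * A $$ (1, b)) \<odot> x \<oplus> (cnj (A $$ (1, a)) * A $$ (0, b)) \<odot> adj S x))"
  then have ab: "a < m" "b < m" by simp_all
  have two: "{..<2::nat} = {0, 1}" by auto
  show "compress_mats S A (block_mat S 0 x) $$ (a, b) = mat m m (\<lambda>(a, b).
     (cnj (A $$ (0, a)) * A $$ (1, b)) \<odot> x \<oplus> (cnj (A $$ (1, a)) * A $$ (0, b)) \<odot> adj S x) $$ (a, b)"
    using ab x e by (simp add: compress_index[OF A ab] two adj_closed Pi_iff scale_scale)
qed (use A in auto)

end

section \<open>Linear maps applied entrywise to matrices\<close>

definition linear_on :: "'a opsys \<Rightarrow> 'b opsys \<Rightarrow> ('a \<Rightarrow> 'b) \<Rightarrow> bool" where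
  "linear_on S T f \<longleftrightarrow> f \<in> carrier S \<rightarrow> carrier T \<and>
     (\<forall>x\<in>carrier S. \<forall>y\<in>carrier S. f (x \<oplus>\<^bsub>S\<^esub> y) = f x \<oplus>\<^bsub>T\<^esub> f y) \<and>
     (\<forall>c. \<forall>x\<in>carrier S. f (c \<odot>\<^bsub>S\<^esub> x) = c \<odot>\<^bsub>T\<^esub> f x)"

locale star_space_linear = S: star_vector_space S + T: star_vector_space T
  for S :: "'a opsys" and T :: "'b opsys" +
  fixes f :: "'a \<Rightarrow> 'b"
  assumes linear: "linear_on S T f"
begin

lemma closed [simp]: "x \<in> carrier S \<Longrightarrow> f x \<in> carrier T"
  and add [simp]: "\<lbrakk>x \<in> carrier S; y \<in> carrier S\<rbrakk> \<Longrightarrow> f (x \<oplus>\<^bsub>S\<^esub> y) = f x \<oplus>\<^bsub>T\<^esub> f y"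
  and scale [simp]: "x \<in> carrier S \<Longrightarrow> f (c \<odot>\<^bsub>S\<^esub> x) = c \<odot>\<^bsub>T\<^esub> f x"
  using linear by (auto simp: linear_on_def)

lemma zero [simp]: "f \<zero>\<^bsub>S\<^esub> = \<zero>\<^bsub>T\<^esub>"
  using scale[of "\<zero>\<^bsub>S\<^esub>" 0] closed[of "\<zero>\<^bsub>S\<^esub>"] by (simp del: scale)

lemma minus [simp]: "x \<in> carrier S \<Longrightarrow> f (\<ominus>\<^bsub>S\<^esub> x) = \<ominus>\<^bsub>T\<^esub> f x"
  using scale[of x "- 1"] by (simp add: S.scale_minus_one T.scale_minus_one del: scale)

lemma finsum:
  "g \<in> A \<rightarrow> carrier S \<Longrightarrow> f (finsum S g A) = finsum T (\<lambda>i. f (g i)) A"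
proof (induction A rule: infinite_finite_induct)
  case (insert a A)
  then show ?case
    by (auto simp: Pi_iff)
qed (auto simp: S.M.finsum_infinite T.M.finsum_infinite)

lemma map_closed: "X \<in> mats n (carrier S) \<Longrightarrow> map_mat f X \<in> mats n (carrier T)"
  by (auto simp: mats_iff)

lemma map_add:
  "\<lbrakk>X \<in> mats n (carrier S); Y \<in> mats n (carrier S)\<rbrakk> \<Longrightarrow>
     map_mat f (add_mats S X Y) = add_mats T (map_mat f X) (map_mat f Y)"
  by (rule eq_matI) (auto simp: mats_iff)

lemma map_smult:
  "X \<in> mats n (carrier S) \<Longrightarrow> map_mat f (smult_mats S c X) = smult_mats T c (map_mat f X)"
  by (rule eq_matI) (auto simp: mats_iff)

lemma map_compress:
  assumes X: "X \<in> mats n (carrier S)" and A: "A \<in> carrier_mat n m"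
  shows "map_mat f (compress_mats S A X) = compress_mats T A (map_mat f X)"
proof (rule mats_eqI)
  show "map_mat f (compress_mats S A X) \<in> mats m (carrier T)"
    using assms by (blast intro: map_closed S.mats_closed)
  show "compress_mats T A (map_mat f X) \<in> mats m (carrier T)"
    using assms by (blast intro: map_closed T.mats_closed)
next
  fix i j assume ij: "i < m" "j < m"
  note D = matsD[OF X]
  let ?c = "\<lambda>k l. cnj (A $$ (k, i)) * A $$ (l, j)"
  have inner: "f (\<Oplus>\<^bsub>S\<^esub>l\<in>{..<n}. ?c k l \<odot>\<^bsub>S\<^esub> X $$ (k, l))
      = (\<Oplus>\<^bsub>T\<^esub>l\<in>{..<n}. ?c k l \<odot>\<^bsub>T\<^esub> map_mat f X $$ (k, l))" if "k < n" for k
    by (subst finsum) (use that D in \<open>auto intro!: T.M.finsum_cong'\<close>)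
  show "map_mat f (compress_mats S A X) $$ (i, j) = compress_mats T A (map_mat f X) $$ (i, j)"
    using ij A unfolding T.compress_index[OF A ij]
    apply (simp add: S.compress_index[OF A ij])
    apply (subst finsum)
    using D inner by (auto intro!: T.M.finsum_cong' S.M.finsum_closed T.M.finsum_closed)
qed

end

text \<open>Scaling by \<open>c\<close> is a linear endomorphism of \<open>S\<close>, and linear
  maps commute with compression.\<close>

lemma (in star_vector_space) compress_smult:
  assumes "X \<in> mats n (carrier S)" "A \<in> carrier_mat n m"
  shows "compress_mats S A (smult_mats S c X) = smult_mats S c (compress_mats S A X)"
proof -
  interpret c: star_space_linear S S "\<lambda>x. c \<odot> x"
    by unfold_locales (auto simp: linear_on_def scale_add_right scale_scale mult.commute)
  show ?thesis
    using c.map_compress[OF assms] by (simp add: smult_mats_def)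
qed

section \<open>Operator systems and null elements\<close>

locale unital_star_space = star_vector_space S for S :: "'a opsys" (structure) +
  assumes order_unit_closed: "order_unit S \<in> carrier S"
    and adj_order_unit: "adj S (order_unit S) = order_unit S"
begin

declare order_unit_closed [simp] adj_order_unit [simp] adj_closed [simp] adj_adj [simp]

lemma unit_mats_closed: "unit_mats S n \<in> mats n (carrier S)"
  by (auto simp: mats_iff)

lemma shift_mats_closed: "X \<in> mats n (carrier S) \<Longrightarrow> shift_mats S n r X \<in> mats n (carrier S)"
  by (blast intro: mats_closed unit_mats_closed)

lemma hermitianD:
  "\<lbrakk>adj_mats S X = X; X \<in> mats n (carrier S); i < n; j < n\<rbrakk> \<Longrightarrow> adj S (X $$ (i, j)) = X $$ (j, i)"
  by (metis index_mats(5) matsD(1,2))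

lemma hermitianI:
  "\<lbrakk>X \<in> mats n (carrier S); \<And>i j. \<lbrakk>i < n; j < n\<rbrakk> \<Longrightarrow> adj S (X $$ (i, j)) = X $$ (j, i)\<rbrakk> \<Longrightarrow>
     adj_mats S X = X"
  by (rule mats_eqI) (auto intro: mats_closed simp: mats_iff)

lemma shift_shift:
  "X \<in> mats n (carrier S) \<Longrightarrow> shift_mats S n r (shift_mats S n s X) = shift_mats S n (r + s) X"
  by (rule mats_eqI) (auto simp: mats_iff scale_add_left M.a_assoc)

lemma shift_zero: "X \<in> mats n (carrier S) \<Longrightarrow> add_mats S (smult_mats S 0 (unit_mats S n)) X = X"
  by (rule mats_eqI) (auto simp: mats_iff)

lemma add_shift:
  "\<lbrakk>X \<in> mats n (carrier S); Y \<in> mats n (carrier S)\<rbrakk> \<Longrightarrow>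
     add_mats S (shift_mats S n r X) (shift_mats S n s Y) = shift_mats S n (r + s) (add_mats S X Y)"
  by (rule mats_eqI) (auto simp: mats_iff scale_add_left M.a_ac)

lemma smult_shift:
  "X \<in> mats n (carrier S) \<Longrightarrow>
     smult_mats S (complex_of_real t) (shift_mats S n r X)
       = shift_mats S n (t * r) (smult_mats S (complex_of_real t) X)"
  by (rule mats_eqI) (auto simp: mats_iff scale_add_right scale_scale)

lemma hermitian_add:
  "\<lbrakk>X \<in> mats n (carrier S); Y \<in> mats n (carrier S); adj_mats S X = X; adj_mats S Y = Y\<rbrakk> \<Longrightarrow>
     adj_mats S (add_mats S X Y) = add_mats S X Y"
  by (rule hermitianI[of _ n]) (auto simp: mats_iff adj_add hermitianD)

lemma hermitian_smult:
  "\<lbrakk>X \<in> mats n (carrier S); adj_mats S X = X\<rbrakk> \<Longrightarrow>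
     adj_mats S (smult_mats S (complex_of_real t) X) = smult_mats S (complex_of_real t) X"
  by (rule hermitianI[of _ n]) (auto simp: mats_iff adj_smult hermitianD)

lemma hermitian_unit: "adj_mats S (unit_mats S n) = unit_mats S n"
  by (rule hermitianI[of _ n]) (auto simp: mats_iff)

lemma hermitian_shift:
  "\<lbrakk>X \<in> mats n (carrier S); adj_mats S X = X\<rbrakk> \<Longrightarrow> adj_mats S (shift_mats S n r X) = shift_mats S n r X"
  by (blast intro: hermitian_add hermitian_smult hermitian_unit mats_closed unit_mats_closed)

text \<open>Shifting back by \<open>- r\<close> is again a shift by a real multiple of the unit,
  which preserves hermitian matrices.\<close>

lemma hermitian_shift_cancel:
  assumes X: "X \<in> mats n (carrier S)" and "adj_mats S (shift_mats S n r X) = shift_mats S n r X"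
  shows "adj_mats S X = X"
proof -
  have "X = shift_mats S n (- r) (shift_mats S n r X)"
    using X by (simp add: shift_shift[of X n "- r" r] shift_zero del: of_real_minus)
  then show ?thesis
    using hermitian_shift[OF shift_mats_closed[OF X] assms(2), of "- r"] by simp
qed

lemma compress_shift:
  "\<lbrakk>X \<in> mats n (carrier S); A \<in> carrier_mat n m\<rbrakk> \<Longrightarrow>
     compress_mats S A (shift_mats S n r X) = add_mats S
       (smult_mats S (complex_of_real r) (compress_mats S A (unit_mats S n))) (compress_mats S A X)"
  by (simp add: compress_add[where n = n and m = m] smult_mats_closed unit_mats_closed
      compress_smult[where n = n and m = m])

text \<open>Compressing \<open>r e + X\<close> does not give a shift of the compression, since the
  unit compresses to some \<open>C\<close> and not to \<open>e\<close>. The identity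
  \<open>(r/s)(s e - C) + A*((r/s) e + X)A = r e + A* X A\<close> repairs this: if
  \<open>s e - C\<close> is positive, the left side is a sum of two positive matrices whenever
  \<open>(r/s) e + X\<close> is positive.\<close>

lemma shift_compress:
  assumes X: "X \<in> mats n (carrier S)" and A: "A \<in> carrier_mat n m" and s: "s \<noteq> 0"
  defines "C \<equiv> compress_mats S A (unit_mats S n)"
  shows "add_mats S (smult_mats S (complex_of_real (r / s)) (shift_mats S m s (smult_mats S (- 1) C)))
      (compress_mats S A (shift_mats S n (r / s) X)) = shift_mats S m r (compress_mats S A X)"
  unfolding compress_shift[OF X A] C_def[symmetric]
proof (rule mats_eqI)
  have C: "C \<in> mats m (carrier S)" and cX: "compress_mats S A X \<in> mats m (carrier S)"
    using X A unfolding C_def by (blast intro: mats_closed unit_mats_closed)+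
  then show "add_mats S (smult_mats S (complex_of_real (r / s)) (shift_mats S m s (smult_mats S (- 1) C)))
      (add_mats S (smult_mats S (complex_of_real (r / s)) C) (compress_mats S A X)) \<in> mats m (carrier S)"
    "shift_mats S m r (compress_mats S A X) \<in> mats m (carrier S)"
    by (blast intro: mats_closed shift_mats_closed)+
  fix i j assume ij: "i < m" "j < m"
  define x where "x = compress_mats S A X $$ (i, j)"
  define c where "c = (complex_of_real (r / s)) \<odot> C $$ (i, j)"
  define u where "u = complex_of_real r \<odot> unit_mats S m $$ (i, j)"
  have car: "x \<in> carrier S" "C $$ (i, j) \<in> carrier S" "unit_mats S m $$ (i, j) \<in> carrier S"
    using matsD(3)[OF cX ij] matsD(3)[OF C ij] by (simp_all add: x_def ij)
  then have car': "c \<in> carrier S" "u \<in> carrier S"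
    by (simp_all add: c_def u_def)
  have "complex_of_real (r / s) \<odot> ((- 1) \<odot> C $$ (i, j)) = \<ominus> c"
    using car unfolding c_def by (simp add: scale_scale flip: scale_minus_one)
  moreover have "complex_of_real (r / s) \<odot> (complex_of_real s \<odot> unit_mats S m $$ (i, j)) = u"
    using car s unfolding u_def by (simp add: scale_scale)
  moreover have "(u \<oplus> \<ominus> c) \<oplus> (c \<oplus> x) = u \<oplus> x"
    using car car' by (metis M.a_assoc M.a_closed M.a_inv_closed M.l_neg M.l_zero)
  ultimately show "add_mats S (smult_mats S (complex_of_real (r / s))
      (shift_mats S m s (smult_mats S (- 1) C)))
      (add_mats S (smult_mats S (complex_of_real (r / s)) C) (compress_mats S A X)) $$ (i, j)
      = shift_mats S m r (compress_mats S A X) $$ (i, j)"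
    using ij A car matsD(1,2)[OF C]
    by (simp add: scale_add_right x_def[symmetric] c_def[symmetric] u_def[symmetric]
        del: of_real_divide index_mats(4))
qed

lemma block_mat_closed: "x \<in> carrier S \<Longrightarrow> block_mat S t x \<in> mats 2 (carrier S)"
  by (simp add: block_closed)

lemma shift_block: "x \<in> carrier S \<Longrightarrow> shift_mats S 2 r (block_mat S t x) = block_mat S (r + t) x"
  by (rule eq_matI) (auto simp: mats_iff scale_add_left)

end

locale unital_star_linear = S: unital_star_space S + T: unital_star_space T + star_space_linear S T f
  for S :: "'a opsys" and T :: "'b opsys" and f :: "'a \<Rightarrow> 'b" +
  assumes unit [simp]: "f (order_unit S) = order_unit T"
begin

lemma map_unit: "map_mat f (unit_mats S n) = unit_mats T n"
  by (rule eq_matI) auto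

lemma map_shift:
  "X \<in> mats n (carrier S) \<Longrightarrow> map_mat f (shift_mats S n r X) = shift_mats T n r (map_mat f X)"
  by (simp add: map_add[of _ n] map_smult[of _ n] map_unit S.smult_mats_closed S.unit_mats_closed)

end

text \<open>
  The cones need not be proper: sequence spaces become operator systems only after dividing out
  their null elements.
\<close>

locale pre_operator_system = unital_star_space S for S :: "'a opsys" (structure) +
  assumes pos_mats: "pos S n \<subseteq> mats n (carrier S)"
    and pos_hermitian: "X \<in> pos S n \<Longrightarrow> adj_mats S X = X"
    and pos_add: "\<lbrakk>X \<in> pos S n; Y \<in> pos S n\<rbrakk> \<Longrightarrow> add_mats S X Y \<in> pos S n"
    and pos_smult: "\<lbrakk>X \<in> pos S n; 0 \<le> t\<rbrakk> \<Longrightarrow> smult_mats S (complex_of_real t) X \<in> pos S n"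
    and pos_compress: "\<lbrakk>X \<in> pos S n; A \<in> carrier_mat n m\<rbrakk> \<Longrightarrow> compress_mats S A X \<in> pos S m"
    and matrix_order_unit:
      "\<lbrakk>X \<in> mats n (carrier S); adj_mats S X = X\<rbrakk> \<Longrightarrow> \<exists>r>0. shift_mats S n r X \<in> pos S n"
    and archimedean:
      "\<lbrakk>X \<in> mats n (carrier S); \<And>r. 0 < r \<Longrightarrow> shift_mats S n r X \<in> pos S n\<rbrakk> \<Longrightarrow> X \<in> pos S n"

text \<open>Splits the axioms into those that descend along a surjection without further assumptions
  and properness, which needs control of the kernel.\<close>

lemma operator_system_iff:
  "operator_system S \<longleftrightarrow> pre_operator_system S \<and>
     (\<forall>n. \<forall>X\<in>pos S n. smult_mats S (- 1) X \<in> pos S n \<longrightarrow> X = zero_mats S n)"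
proof
  assume "operator_system S"
  then interpret operator_system S .
  show "pre_operator_system S \<and>
     (\<forall>n. \<forall>X\<in>pos S n. smult_mats S (- 1) X \<in> pos S n \<longrightarrow> X = zero_mats S n)"
    by (intro conjI pre_operator_system.intro pre_operator_system_axioms.intro
        unital_star_space.intro unital_star_space_axioms.intro star_vector_space_axioms)
      (blast intro: pos_mats[THEN subsetD] pos_hermitian pos_add pos_smult pos_compress order_unit_closed adj_order_unit
         matrix_order_unit archimedean pos_proper)+
next
  assume *: "pre_operator_system S \<and>
     (\<forall>n. \<forall>X\<in>pos S n. smult_mats S (- 1) X \<in> pos S n \<longrightarrow> X = zero_mats S n)"
  then interpret pre_operator_system S by blast
  show "operator_system S"
    by unfold_locales
      (use * in \<open>blast intro: pos_mats[THEN subsetD] pos_hermitian pos_add pos_smult pos_compress order_unit_closed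
         adj_order_unit matrix_order_unit archimedean\<close>)+
qed

lemma pre_operator_system: "operator_system S \<Longrightarrow> pre_operator_system S"
  by (simp add: operator_system_iff)

definition null_elem :: "'a opsys \<Rightarrow> 'a \<Rightarrow> bool" where
  "null_elem S x \<longleftrightarrow> x \<in> carrier S \<and> block_mat S 0 x \<in> pos S 2"

context pre_operator_system
begin

lemma pos_closed: "X \<in> pos S n \<Longrightarrow> X \<in> mats n (carrier S)"
  using pos_mats by blast

text \<open>The order unit property produces some positive matrix; scaling it by 0 gives the zero
  matrix.\<close>

lemma zero_pos: "zero_mats S n \<in> pos S n"
proof -
  have "adj_mats S (zero_mats S n) = zero_mats S n"
    by (rule hermitianI[of _ n]) (auto simp: mats_iff)
  then obtain r where "shift_mats S n r (zero_mats S n) \<in> pos S n"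
    using matrix_order_unit zero_mats_closed by blast
  from pos_smult[OF this, of 0] pos_closed[OF this]
  have "smult_mats S 0 (shift_mats S n r (zero_mats S n)) \<in> pos S n"
    by simp
  also have "smult_mats S 0 (shift_mats S n r (zero_mats S n)) = zero_mats S n"
    by (rule eq_matI) auto
  finally show ?thesis .
qed

text \<open>The order unit property for the zero matrix makes some \<open>r e\<close> with
  \<open>r > 0\<close> positive; divide by \<open>r\<close>.\<close>

lemma unit_pos: "unit_mats S n \<in> pos S n"
proof -
  have "adj_mats S (zero_mats S n) = zero_mats S n"
    by (rule hermitianI[of _ n]) (auto simp: mats_iff)
  then obtain r where r: "r > 0" "shift_mats S n r (zero_mats S n) \<in> pos S n"
    using matrix_order_unit zero_mats_closed by blast
  from pos_smult[OF this(2), of "1 / r"] r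
  have "smult_mats S (complex_of_real (1 / r)) (shift_mats S n r (zero_mats S n)) \<in> pos S n"
    by simp
  also have "smult_mats S (complex_of_real (1 / r)) (shift_mats S n r (zero_mats S n)) = unit_mats S n"
    using r by (intro eq_matI) (auto simp: scale_scale simp flip: of_real_mult)
  finally show ?thesis .
qed

lemma shift_mono:
  assumes X: "X \<in> mats n (carrier S)" "shift_mats S n r X \<in> pos S n" and "r \<le> s"
  shows "shift_mats S n s X \<in> pos S n"
proof -
  have "add_mats S (smult_mats S (complex_of_real (s - r)) (unit_mats S n)) (shift_mats S n r X) \<in> pos S n"
    using assms by (blast intro: pos_add pos_smult unit_pos diff_ge_0_iff_ge[THEN iffD2])
  then show ?thesis
    using shift_shift[OF X(1), of "s - r" r] by simp
qed

lemma shift_pos: "\<lbrakk>X \<in> pos S n; 0 \<le> r\<rbrakk> \<Longrightarrow> shift_mats S n r X \<in> pos S n"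
  using shift_mono[of X n 0 r] by (simp add: pos_closed shift_zero)

text \<open>The compressed unit is positive, hence hermitian, so the order unit property applies to
  its negative. The constant \<open>s\<close> plays the part of the squared norm of
  \<open>A\<close>.\<close>

lemma unit_dominates_compress:
  assumes A: "A \<in> carrier_mat n m"
  shows "\<exists>s>0. shift_mats S m s (smult_mats S (- 1) (compress_mats S A (unit_mats S n))) \<in> pos S m"
proof (rule matrix_order_unit)
  let ?C = "compress_mats S A (unit_mats S n)"
  have C: "?C \<in> pos S m"
    using A by (rule pos_compress[OF unit_pos])
  then show "smult_mats S (- 1) ?C \<in> mats m (carrier S)"
    by (blast intro: pos_closed mats_closed)
  show "adj_mats S (smult_mats S (- 1) ?C) = smult_mats S (- 1) ?C"
    using hermitian_smult[OF pos_closed[OF C] pos_hermitian[OF C], of "- 1"] by simp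
qed

text \<open>\<open>A* X A\<close> is the difference of \<open>A*(r e + X)A\<close> and
  \<open>r A* e A\<close>. For a suitable \<open>r\<close> both are compressions of positive
  matrices, up to the real factor, so they are hermitian; no adjoint of a double sum has to be
  computed.\<close>

lemma hermitian_compress:
  assumes X: "X \<in> mats n (carrier S)" "adj_mats S X = X" and A: "A \<in> carrier_mat n m"
  shows "adj_mats S (compress_mats S A X) = compress_mats S A X"
proof -
  obtain r where r: "shift_mats S n r X \<in> pos S n"
    using matrix_order_unit[OF X] by blast
  let ?C = "compress_mats S A (unit_mats S n)"
  have C: "?C \<in> pos S m" and D: "compress_mats S A (shift_mats S n r X) \<in> pos S m"
    using r A by (blast intro: pos_compress unit_pos)+
  have "compress_mats S A X = add_mats S (compress_mats S A (shift_mats S n r X))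
      (smult_mats S (complex_of_real (- r)) ?C)" (is "_ = ?R")
  proof (rule mats_eqI)
    show "compress_mats S A X \<in> mats m (carrier S)" "?R \<in> mats m (carrier S)"
      using X A C D by (blast intro: mats_closed pos_closed)+
    fix i j assume ij: "i < m" "j < m"
    have car: "compress_mats S A X $$ (i, j) \<in> carrier S" "?C $$ (i, j) \<in> carrier S"
      using matsD(3)[OF compress_mats_closed[OF X(1) A] ij] matsD(3)[OF pos_closed[OF C] ij] by auto
    have "(c \<oplus> x) \<oplus> \<ominus> c = x" if "x \<in> carrier S" "c \<in> carrier S" for x c
      using that by (metis M.a_assoc M.a_closed M.a_comm M.a_inv_closed M.r_neg M.r_zero)
    moreover have "(- complex_of_real r) \<odot> ?C $$ (i, j) = \<ominus> (complex_of_real r \<odot> ?C $$ (i, j))"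
      using car by (simp add: scale_scale flip: scale_minus_one)
    ultimately show "compress_mats S A X $$ (i, j) = ?R $$ (i, j)"
      unfolding compress_shift[OF X(1) A] using car ij A by simp
  qed
  then show ?thesis
    using hermitian_add[OF pos_closed[OF D] smult_mats_closed[OF pos_closed[OF C]]
        pos_hermitian[OF D] hermitian_smult[OF pos_closed[OF C] pos_hermitian[OF C]]]
    by (simp del: of_real_minus)
qed

lemma block_mono: "\<lbrakk>block_mat S r x \<in> pos S 2; x \<in> carrier S; r \<le> s\<rbrakk> \<Longrightarrow> block_mat S s x \<in> pos S 2"
  using shift_pos[of "block_mat S r x" 2 "s - r"] shift_block[of x "s - r" r] by simp

text \<open>The block matrix with diagonal \<open>t e\<close> is the shift by \<open>t\<close> of
  the one with zero diagonal, so this is the Archimedean axiom.\<close>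

lemma null_elemI:
  assumes "x \<in> carrier S" "\<And>t. t > 0 \<Longrightarrow> block_mat S t x \<in> pos S 2"
  shows "null_elem S x"
  unfolding null_elem_def using assms archimedean[of "block_mat S 0 x" 2]
  by (simp add: block_mat_closed shift_block)

lemma null_closed: "null_elem S x \<Longrightarrow> x \<in> carrier S"
  by (simp add: null_elem_def)

lemma null_add:
  assumes "null_elem S x" "null_elem S y"
  shows "null_elem S (x \<oplus> y)"
proof -
  have "add_mats S (block_mat S 0 x) (block_mat S 0 y) = block_mat S 0 (x \<oplus> y)"
    using assms by (intro eq_matI) (auto simp: mats_iff null_elem_def adj_add)
  then show ?thesis
    using pos_add[of "block_mat S 0 x" 2 "block_mat S 0 y"] assms by (simp add: null_elem_def)
qed

text \<open>Conjugation by the diagonal matrix with entries \<open>cnj c\<close> and 1 multiplies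
  the corner by \<open>c\<close> and keeps the diagonal zero.\<close>

lemma null_smult:
  assumes "null_elem S x"
  shows "null_elem S (c \<odot> x)"
proof -
  let ?A = "mat 2 2 (\<lambda>(k, a). if k = id a then (if a = 0 then cnj c else 1) else 0)"
  have "compress_mats S ?A (block_mat S 0 x) = block_mat S 0 (c \<odot> x)"
    using assms by (subst compress_select)
      (auto simp: null_elem_def block_mat_closed adj_smult intro!: eq_matI matsI)
  then show ?thesis
    using assms pos_compress[of "block_mat S 0 x" 2 ?A 2] by (simp add: null_elem_def)
qed

lemma null_minus: "null_elem S x \<Longrightarrow> null_elem S (\<ominus> x)"
  using null_smult[of x "- 1"] by (simp add: null_closed scale_minus_one)

lemma null_minus_trans:
  assumes "x \<in> carrier S" "y \<in> carrier S" "z \<in> carrier S" "null_elem S (x \<ominus> y)" "null_elem S (y \<ominus> z)"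
  shows "null_elem S (x \<ominus> z)"
proof -
  have "(x \<ominus> y) \<oplus> (y \<ominus> z) = x \<ominus> z"
    using assms(1-3) unfolding a_minus_def
    by (metis M.a_assoc M.a_closed M.a_inv_closed M.l_neg M.l_zero)
  then show ?thesis
    using null_add[OF assms(4,5)] by simp
qed

lemma null_minus_sym:
  assumes "x \<in> carrier S" "y \<in> carrier S" "null_elem S (x \<ominus> y)"
  shows "null_elem S (y \<ominus> x)"
proof -
  have "\<ominus> (x \<ominus> y) = y \<ominus> x"
    using assms(1,2) by (simp add: a_minus_def M.minus_add M.minus_minus M.a_comm)
  then show ?thesis
    using null_minus[OF assms(3)] by simp
qed

text \<open>Conjugation by the flip of the two coordinates exchanges the corners.\<close>

lemma null_adj:
  assumes "null_elem S x"
  shows "null_elem S (adj S x)"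
proof -
  let ?A = "mat 2 2 (\<lambda>(k, a). if k = 1 - a then 1 else (0::complex))"
  have "compress_mats S ?A (block_mat S 0 x) = block_mat S 0 (adj S x)"
    using assms by (subst compress_select[where c = "\<lambda>_. 1"])
      (auto simp: null_elem_def block_mat_closed intro!: eq_matI matsI)
  then show ?thesis
    using assms pos_compress[of "block_mat S 0 x" 2 ?A 2] by (simp add: null_elem_def)
qed

lemma null_zero: "null_elem S \<zero>"
proof -
  have "block_mat S 0 \<zero> = zero_mats S 2"
    by (rule eq_matI) auto
  then show ?thesis
    by (simp add: null_elem_def zero_pos)
qed

text \<open>
  Twice a hermitian matrix with entries \<open>z\<^sub>i\<^sub>j\<close> is the sum over all \<open>i, j\<close> of the compressions of
  the positive block matrices with corners \<open>z\<^sub>i\<^sub>j\<close>, which contribute \<open>z\<^sub>i\<^sub>j\<close> at \<open>(i, j)\<close> and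
  \<open>z\<^sub>i\<^sub>j*\<close> at \<open>(j, i)\<close>.
\<close>

lemma pos_if_null_entries:
  assumes Z: "Z \<in> mats n {x. null_elem S x}" and hermitian: "adj_mats S Z = Z"
  shows "Z \<in> pos S n"
proof -
  note null = matsD(3)[OF Z, simplified]
  note dims = matsD(1,2)[OF Z]
  have Zc: "Z \<in> mats n (carrier S)"
    using Z null_closed by (auto simp: mats_iff)
  \<comment> \<open>\<open>P F\<close> is the part of the sum that belongs to the index pairs in
    \<open>F\<close>, written entrywise so that enlarging \<open>F\<close> by one pair adds one
    compression.\<close>
  define P where "P F = mat n n (\<lambda>(a, b). (if (a, b) \<in> F then Z $$ (a, b) else \<zero>)
     \<oplus> (if (b, a) \<in> F then adj S (Z $$ (b, a)) else \<zero>))" for F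
  have "P F \<in> pos S n" if "finite F" "F \<subseteq> {..<n} \<times> {..<n}" for F
    using that
  proof (induction F)
    case empty
    have "P {} = zero_mats S n"
      by (rule eq_matI) (auto simp: P_def)
    then show ?case
      by (simp add: zero_pos)
  next
    case (insert p F)
    obtain i j where p: "p = (i, j)" and ij: "i < n" "j < n"
      using insert.prems by auto
    let ?z = "Z $$ (i, j)"
    \<comment> \<open>For \<open>i = j\<close> one column carries both entries 1, so
      \<open>compress_select\<close> does not apply and \<open>compress_block\<close> is
      used.\<close>
    let ?A = "mat 2 n (\<lambda>(k, a). if a = (if k = 0 then i else j) then 1 else (0::complex))"
    have z: "null_elem S ?z" "?z \<in> carrier S"
      using null[OF ij] null_closed by auto
    have "compress_mats S ?A (block_mat S 0 ?z) \<in> pos S n"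
      using z by (intro pos_compress) (auto simp: null_elem_def)
    moreover have "P (insert p F) = add_mats S (P F) (compress_mats S ?A (block_mat S 0 ?z))"
    proof (rule eq_matI)
      fix a b assume "a < dim_row (add_mats S (P F) (compress_mats S ?A (block_mat S 0 ?z)))"
        "b < dim_col (add_mats S (P F) (compress_mats S ?A (block_mat S 0 ?z)))"
      then have ab: "a < n" "b < n" by (auto simp: P_def)
      have c: "Z $$ (a, b) \<in> carrier S" "adj S (Z $$ (b, a)) \<in> carrier S"
        using matsD(3)[OF Zc] ab by auto
      let ?s = "if a = i \<and> b = j then ?z else \<zero>"
      let ?t = "if b = i \<and> a = j then adj S ?z else \<zero>"
      let ?u = "\<lambda>F. if (a, b) \<in> F then Z $$ (a, b) else \<zero>"
      let ?v = "\<lambda>F. if (b, a) \<in> F then adj S (Z $$ (b, a)) else \<zero>"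
      have "compress_mats S ?A (block_mat S 0 ?z) $$ (a, b) = ?s \<oplus> ?t"
      proof -
        have "?A $$ (0, a) = (if a = i then 1 else 0)" "?A $$ (0, b) = (if b = i then 1 else 0)"
          "?A $$ (1, a) = (if a = j then 1 else 0)" "?A $$ (1, b) = (if b = j then 1 else 0)"
          using ab by simp_all
        moreover have "compress_mats S ?A (block_mat S 0 ?z) $$ (a, b) =
            (cnj (?A $$ (0, a)) * ?A $$ (1, b)) \<odot> ?z
              \<oplus> (cnj (?A $$ (1, a)) * ?A $$ (0, b)) \<odot> adj S ?z"
          by (subst compress_block[OF z(2) order_unit_closed mat_carrier], subst index_mat(1)[OF ab])
            (rule split_conv)
        moreover have "(cnj (if P then 1 else 0) * (if Q then 1 else 0)) \<odot> x = (if P \<and> Q then x else \<zero>)"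
          if "x \<in> carrier S" for P Q x
          using that by (cases P; cases Q) simp_all
        moreover have "a = j \<and> b = i \<longleftrightarrow> b = i \<and> a = j"
          by blast
        ultimately show ?thesis
          using z(2) adj_closed[OF z(2)] by (simp only:)
      qed
      moreover have "?u (insert p F) = ?u F \<oplus> ?s" "?v (insert p F) = ?v F \<oplus> ?t"
        using insert.hyps(2) c z(2) by (auto simp: p)
      moreover have "(?u F \<oplus> ?s) \<oplus> (?v F \<oplus> ?t) = (?u F \<oplus> ?v F) \<oplus> (?s \<oplus> ?t)"
      proof -
        have "(x \<oplus> y) \<oplus> (x' \<oplus> y') = (x \<oplus> x') \<oplus> (y \<oplus> y')"
          if "x \<in> carrier S" "y \<in> carrier S" "x' \<in> carrier S" "y' \<in> carrier S" for x y x' y'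
          using that by (simp add: M.a_ac)
        then show ?thesis
          by this (use c z(2) in simp_all)
      qed
      ultimately show "P (insert p F) $$ (a, b)
          = add_mats S (P F) (compress_mats S ?A (block_mat S 0 ?z)) $$ (a, b)"
        using ab by (simp add: P_def del: insert_iff split del: if_split)
    qed (auto simp: P_def)
    ultimately show ?case
      using insert by (auto intro: pos_add)
  qed
  from this[of "{..<n} \<times> {..<n}"] have "P ({..<n} \<times> {..<n}) \<in> pos S n"
    by simp
  from pos_smult[OF this, of "1 / 2"]
  have "smult_mats S (complex_of_real (1 / 2)) (P ({..<n} \<times> {..<n})) \<in> pos S n"
    by simp
  also have "smult_mats S (complex_of_real (1 / 2)) (P ({..<n} \<times> {..<n})) = Z"
  proof (rule eq_matI)
    fix i j assume "i < dim_row Z" "j < dim_col Z"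
    then have ij: "i < n" "j < n" by (simp_all add: dims)
    have "adj S (Z $$ (j, i)) = Z $$ (i, j)"
      using hermitianD[OF hermitian Zc] ij by blast
    then show "smult_mats S (complex_of_real (1 / 2)) (P ({..<n} \<times> {..<n})) $$ (i, j) = Z $$ (i, j)"
      using ij matsD(3)[OF Zc ij]
      by (simp add: P_def scale_add_right flip: scale_add_left)
  qed (auto simp: P_def dims)
  finally show ?thesis .
qed

text \<open>Compress to the rows and columns \<open>i\<close>, \<open>j\<close>: \<open>X\<close> as
  it stands, and \<open>- X\<close> with the sign of the second coordinate reversed. In the sum the
  diagonals cancel and the corners double, so half of it is the block matrix of the entry.\<close>

lemma null_if_pos_neg:
  assumes X: "X \<in> pos S n" and Y: "smult_mats S (- 1) X \<in> pos S n" and ij: "i < n" "j < n"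
  shows "null_elem S (X $$ (i, j))"
proof -
  note Xc = pos_closed[OF X]
  note D = matsD[OF Xc] 
  have adj: "adj S (X $$ (i, j)) = X $$ (j, i)"
    using hermitianD[OF pos_hermitian[OF X] Xc] ij by blast
  let ?p = "\<lambda>a::nat. if a = 0 then i else j"
  let ?A = "\<lambda>t. mat n 2 (\<lambda>(k, a). if k = ?p a then (if a = 0 then 1 else t) else (0::complex))"
  have p: "?p a < n" for a
    using ij by simp
  let ?U = "compress_mats S (?A 1) X" and ?W = "compress_mats S (?A (- 1)) (smult_mats S (- 1) X)"
  have "?U \<in> pos S 2" "?W \<in> pos S 2"
    using X Y by (auto intro: pos_compress mat_carrier)
  then have "smult_mats S (complex_of_real (1 / 2)) (add_mats S ?U ?W) \<in> pos S 2"
    by (intro pos_smult pos_add) auto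
  also have "smult_mats S (complex_of_real (1 / 2)) (add_mats S ?U ?W) = block_mat S 0 (X $$ (i, j))"
  proof (rule eq_matI)
    fix a b assume "a < dim_row (block_mat S 0 (X $$ (i, j)))" "b < dim_col (block_mat S 0 (X $$ (i, j)))"
    then have ab: "a < 2" "b < 2" by simp_all
    have diag: "x \<oplus> (- 1) \<odot> x = \<zero>" if "x \<in> carrier S" for x
      using that by (simp add: scale_minus_one M.r_neg)
    have half: "(1 / 2) \<odot> (x \<oplus> x) = x" if "x \<in> carrier S" for x
      using that by (simp add: scale_add_right flip: scale_add_left)
    show "smult_mats S (complex_of_real (1 / 2)) (add_mats S ?U ?W) $$ (a, b)
        = block_mat S 0 (X $$ (i, j)) $$ (a, b)"
      using ab ij D adj p
      unfolding compress_select[OF Xc, of 2 ?p, OF p]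
        compress_select[OF smult_mats_closed[OF Xc], of 2 ?p, OF p]
      by (auto simp: scale_scale diag half)
  qed simp_all
  finally show ?thesis
    using D ij by (simp add: null_elem_def)
qed

end

text \<open>The negative of the block matrix of \<open>x\<close> is the block matrix of the negative
  of \<open>x\<close>, which is null as well. Properness then makes the block matrix zero, and
  \<open>x\<close> is its corner.\<close>

lemma operator_system_null:
  assumes "operator_system S" "null_elem S x"
  shows "x = \<zero>\<^bsub>S\<^esub>"
proof -
  interpret operator_system S by fact
  interpret pre: pre_operator_system S
    using assms(1) by (rule pre_operator_system)
  have x: "x \<in> carrier S"
    using assms(2) by (rule pre.null_closed)
  have "smult_mats S (- 1) (block_mat S 0 x) = block_mat S 0 (\<ominus>\<^bsub>S\<^esub> x)"
    using x by (intro eq_matI) (auto simp: mats_iff adj_smult scale_minus_one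
      simp flip: scale_minus_one)
  then have "block_mat S 0 x = zero_mats S 2"
    using assms(2) pre.null_minus[OF assms(2)] pos_proper[of "block_mat S 0 x" 2]
    by (simp add: null_elem_def)
  then have "block_mat S 0 x $$ (0, 1) = zero_mats S 2 $$ (0, 1)"
    by simp
  then show ?thesis
    by simp
qed

section \<open>Unital completely positive maps and surjections\<close>

locale ucp = S: pre_operator_system S + T: pre_operator_system T
  for S :: "'a opsys" and T :: "'b opsys" +
  fixes f :: "'a \<Rightarrow> 'b"
  assumes ucp: "ucp_map S T f"
begin

sublocale unital_star_linear S T f
  using ucp by unfold_locales (simp_all add: ucp_map_def linear_on_def)

lemma map_pos: "X \<in> pos S n \<Longrightarrow> map_mat f X \<in> pos T n"
  using ucp by (auto simp: ucp_map_def)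

text \<open>A multiple of the unit makes \<open>h\<close> positive. The image of the sum is
  positive, hence hermitian, and the multiple of the unit can be removed again.\<close>

lemma adj_of_self_adjoint:
  assumes h: "h \<in> carrier S" "adj S h = h"
  shows "adj T (f h) = f h"
proof -
  let ?H = "mat 1 1 (\<lambda>_. h)"
  have H: "?H \<in> mats 1 (carrier S)" "adj_mats S ?H = ?H"
    using h by (auto simp: mats_iff intro!: eq_matI)
  then obtain r where "shift_mats S 1 r ?H \<in> pos S 1"
    using S.matrix_order_unit by blast
  from map_pos[OF this] have "shift_mats T 1 r (map_mat f ?H) \<in> pos T 1"
    using H by (simp add: map_shift)
  then have "adj_mats T (map_mat f ?H) = map_mat f ?H"
    by (rule T.hermitian_shift_cancel[OF map_closed[OF H(1)] T.pos_hermitian])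
  then have "adj_mats T (map_mat f ?H) $$ (0, 0) = map_mat f ?H $$ (0, 0)"
    by simp
  then show ?thesis
    by simp
qed

text \<open>Compatibility with the involution is a consequence of positivity: split \<open>x\<close>
  into self-adjoint parts, which \<open>f\<close> keeps self-adjoint.\<close>

lemma adj [simp]:
  assumes x: "x \<in> carrier S"
  shows "f (adj S x) = adj T (f x)"
proof -
  \<comment> \<open>\<open>a\<close> is twice the real part of \<open>x\<close>, and
    \<open>b\<close> is minus twice its imaginary part.\<close>
  define a where "a = x \<oplus>\<^bsub>S\<^esub> adj S x"
  define b where "b = \<i> \<odot>\<^bsub>S\<^esub> x \<oplus>\<^bsub>S\<^esub> (- \<i>) \<odot>\<^bsub>S\<^esub> adj S x"
  have a: "a \<in> carrier S" "adj S a = a" and b: "b \<in> carrier S" "adj S b = b"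
    using x by (auto simp: a_def b_def S.adj_add S.adj_smult S.M.a_comm)
  have half: "(1 / 2) \<odot>\<^bsub>S\<^esub> y \<oplus>\<^bsub>S\<^esub> (1 / 2) \<odot>\<^bsub>S\<^esub> y = y" "(1 / 2) \<odot>\<^bsub>S\<^esub> y \<oplus>\<^bsub>S\<^esub> (- (1 / 2)) \<odot>\<^bsub>S\<^esub> y = \<zero>\<^bsub>S\<^esub>"
    if "y \<in> carrier S" for y
    using that by (simp_all flip: S.scale_add_left)
  have "(1 / 2) \<odot>\<^bsub>S\<^esub> a \<oplus>\<^bsub>S\<^esub> (- \<i> / 2) \<odot>\<^bsub>S\<^esub> b
      = ((1 / 2) \<odot>\<^bsub>S\<^esub> x \<oplus>\<^bsub>S\<^esub> (1 / 2) \<odot>\<^bsub>S\<^esub> adj S x)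
        \<oplus>\<^bsub>S\<^esub> ((1 / 2) \<odot>\<^bsub>S\<^esub> x \<oplus>\<^bsub>S\<^esub> (- (1 / 2)) \<odot>\<^bsub>S\<^esub> adj S x)"
    using x by (simp add: a_def b_def S.scale_add_right S.scale_scale)
  also have "\<dots> = ((1 / 2) \<odot>\<^bsub>S\<^esub> x \<oplus>\<^bsub>S\<^esub> (1 / 2) \<odot>\<^bsub>S\<^esub> x)
        \<oplus>\<^bsub>S\<^esub> ((1 / 2) \<odot>\<^bsub>S\<^esub> adj S x \<oplus>\<^bsub>S\<^esub> (- (1 / 2)) \<odot>\<^bsub>S\<^esub> adj S x)"
    using x by (simp add: S.M.a_ac)
  also have "\<dots> = x"
    using x half[of x] half[of "adj S x"] by simp
  finally have decomp: "x = (1 / 2) \<odot>\<^bsub>S\<^esub> a \<oplus>\<^bsub>S\<^esub> (- \<i> / 2) \<odot>\<^bsub>S\<^esub> b" ..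
  have "adj S x = (1 / 2) \<odot>\<^bsub>S\<^esub> a \<oplus>\<^bsub>S\<^esub> (\<i> / 2) \<odot>\<^bsub>S\<^esub> b"
    by (subst decomp) (simp add: a b S.adj_add S.adj_smult)
  moreover have "adj T (f x) = (1 / 2) \<odot>\<^bsub>T\<^esub> f a \<oplus>\<^bsub>T\<^esub> (\<i> / 2) \<odot>\<^bsub>T\<^esub> f b"
    by (subst decomp) (simp add: a b T.adj_add T.adj_smult adj_of_self_adjoint)
  ultimately show ?thesis
    by (simp add: a b)
qed

lemma map_block: "x \<in> carrier S \<Longrightarrow> map_mat f (block_mat S t x) = block_mat T t (f x)"
  by (rule eq_matI) auto

lemma block_pos: "\<lbrakk>x \<in> carrier S; block_mat S t x \<in> pos S 2\<rbrakk> \<Longrightarrow> block_mat T t (f x) \<in> pos T 2"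
  using map_pos[of "block_mat S t x" 2] by (simp add: map_block)

end

lemma ucpI: "\<lbrakk>operator_system S; operator_system T; ucp_map S T f\<rbrakk> \<Longrightarrow> ucp S T f"
  by (simp add: ucp_def ucp_axioms_def pre_operator_system)

lemma ucp_map_closed: "\<lbrakk>ucp_map S T f; x \<in> carrier S\<rbrakk> \<Longrightarrow> f x \<in> carrier T"
  by (auto simp: ucp_map_def)

lemma ucp_map_comp: "\<lbrakk>ucp_map S T f; ucp_map T U g\<rbrakk> \<Longrightarrow> ucp_map S U (\<lambda>x. g (f x))"
proof -
  assume *: "ucp_map S T f" "ucp_map T U g"
  have "map_mat (\<lambda>x. g (f x)) X = map_mat g (map_mat f X)" for X
    by (rule eq_matI) auto
  with * show ?thesis
    by (auto simp: ucp_map_def Pi_iff)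
qed

lemma ucp_map_id: "ucp_map S S (\<lambda>x. x)"
proof -
  have "map_mat (\<lambda>x. x) X = X" for X :: "'a mat"
    by (rule eq_matI) auto
  then show ?thesis
    by (auto simp: ucp_map_def)
qed

text \<open>Positive matrices have their entries in the carrier, so values elsewhere are irrelevant.
  This admits the \<open>restrict\<close> and \<open>inv_into\<close> forms of a map.\<close>

lemma ucp_map_cong:
  assumes "operator_system S" "ucp_map S T f" "\<And>x. x \<in> carrier S \<Longrightarrow> f x = g x"
  shows "ucp_map S T g"
proof -
  interpret pre_operator_system S
    using assms(1) by (rule pre_operator_system)
  have "map_mat g X = map_mat f X" if "X \<in> pos S n" for X n
    using pos_closed[OF that] assms(3) by (intro eq_matI) (auto simp: mats_iff)
  then show ?thesis
    using assms(2) by (auto simp: ucp_map_def Pi_iff assms(3)[symmetric])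
qed

text \<open>Common frame for \<open>S\<close> onto \<open>S/J\<close> and for sequences onto their
  classes. The cone of \<open>Q\<close> is the Archimedean closure of the image cone. Nothing else
  is asked of \<open>Q\<close>: its axioms are all derived from those of \<open>V\<close>.\<close>

locale os_surjection = V: pre_operator_system V
  for V :: "'a opsys" +
  fixes Q :: "'b opsys" and q :: "'a \<Rightarrow> 'b"
  assumes carrier_Q: "carrier Q = q ` carrier V"
    and q_zero: "q \<zero>\<^bsub>V\<^esub> = \<zero>\<^bsub>Q\<^esub>"
    and q_add: "\<lbrakk>x \<in> carrier V; y \<in> carrier V\<rbrakk> \<Longrightarrow> q (x \<oplus>\<^bsub>V\<^esub> y) = q x \<oplus>\<^bsub>Q\<^esub> q y"
    and q_smult: "x \<in> carrier V \<Longrightarrow> q (c \<odot>\<^bsub>V\<^esub> x) = c \<odot>\<^bsub>Q\<^esub> q x"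
    and q_adj: "x \<in> carrier V \<Longrightarrow> q (adj V x) = adj Q (q x)"
    and q_unit: "q (order_unit V) = order_unit Q"
    and pos_Q: "pos Q n = {map_mat q X | X. X \<in> mats n (carrier V) \<and>
      (\<forall>r>0. map_mat q (shift_mats V n r X) \<in> map_mat q ` pos V n)}"
begin

lemma star_vector_space_Q: "star_vector_space Q"
proof (intro star_vector_space.intro vectorspace.intro star_vector_space_axioms.intro)
  have "abelian_group Q"
  proof (rule abelian_groupI)
    fix x y z assume "x \<in> carrier Q" "y \<in> carrier Q" "z \<in> carrier Q"
    then obtain a b c where "a \<in> carrier V" "b \<in> carrier V" "c \<in> carrier V" "x = q a" "y = q b" "z = q c"
      by (auto simp: carrier_Q)
    then show "(x \<oplus>\<^bsub>Q\<^esub> y) \<oplus>\<^bsub>Q\<^esub> z = x \<oplus>\<^bsub>Q\<^esub> (y \<oplus>\<^bsub>Q\<^esub> z)"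
      by (simp add: V.M.a_assoc flip: q_add)
  next
    fix x y assume "x \<in> carrier Q" "y \<in> carrier Q"
    then obtain a b where "a \<in> carrier V" "b \<in> carrier V" "x = q a" "y = q b"
      by (auto simp: carrier_Q)
    then show "x \<oplus>\<^bsub>Q\<^esub> y \<in> carrier Q" "x \<oplus>\<^bsub>Q\<^esub> y = y \<oplus>\<^bsub>Q\<^esub> x"
      by (simp_all add: carrier_Q V.M.a_comm flip: q_add)
  next
    fix x assume "x \<in> carrier Q"
    then obtain a where a: "a \<in> carrier V" "x = q a"
      by (auto simp: carrier_Q)
    then show "\<zero>\<^bsub>Q\<^esub> \<oplus>\<^bsub>Q\<^esub> x = x"
      by (simp flip: q_add q_zero)
    have "q (\<ominus>\<^bsub>V\<^esub> a) \<oplus>\<^bsub>Q\<^esub> x = \<zero>\<^bsub>Q\<^esub>"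
      using a by (simp add: V.M.l_neg flip: q_add q_zero)
    then show "\<exists>y\<in>carrier Q. y \<oplus>\<^bsub>Q\<^esub> x = \<zero>\<^bsub>Q\<^esub>"
      using a by (auto simp: carrier_Q)
  qed (simp add: carrier_Q flip: q_zero)
  then show "module class_ring Q"
  proof (intro moduleI)
    show "cring (class_ring :: complex ring)"
      by (rule V.R.is_cring)
  next
    fix c d :: complex and x assume "x \<in> carrier Q"
    then obtain a where "a \<in> carrier V" "x = q a"
      by (auto simp: carrier_Q)
    then show "c \<odot>\<^bsub>Q\<^esub> x \<in> carrier Q"
      "(c \<oplus>\<^bsub>class_ring\<^esub> d) \<odot>\<^bsub>Q\<^esub> x = c \<odot>\<^bsub>Q\<^esub> x \<oplus>\<^bsub>Q\<^esub> d \<odot>\<^bsub>Q\<^esub> x"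
      "(c \<otimes>\<^bsub>class_ring\<^esub> d) \<odot>\<^bsub>Q\<^esub> x = c \<odot>\<^bsub>Q\<^esub> (d \<odot>\<^bsub>Q\<^esub> x)"
      "\<one>\<^bsub>class_ring\<^esub> \<odot>\<^bsub>Q\<^esub> x = x"
      by (simp_all add: carrier_Q V.scale_add_left V.scale_scale flip: q_add q_smult)
  next
    fix c :: complex and x y assume "x \<in> carrier Q" "y \<in> carrier Q"
    then obtain a b where "a \<in> carrier V" "b \<in> carrier V" "x = q a" "y = q b"
      by (auto simp: carrier_Q)
    then show "c \<odot>\<^bsub>Q\<^esub> (x \<oplus>\<^bsub>Q\<^esub> y) = c \<odot>\<^bsub>Q\<^esub> x \<oplus>\<^bsub>Q\<^esub> c \<odot>\<^bsub>Q\<^esub> y"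
      by (simp add: V.scale_add_right flip: q_add q_smult)
  qed simp_all
  show "field (class_ring :: complex ring)"
    by (rule V.field_axioms)
next
  fix x y c assume "x \<in> carrier Q"
  then obtain a where a: "a \<in> carrier V" "x = q a"
    by (auto simp: carrier_Q)
  then show "adj Q x \<in> carrier Q" "adj Q (adj Q x) = x" "adj Q (c \<odot>\<^bsub>Q\<^esub> x) = cnj c \<odot>\<^bsub>Q\<^esub> adj Q x"
    by (simp_all add: carrier_Q V.adj_smult flip: q_adj q_smult)
  assume "y \<in> carrier Q"
  then obtain b where "b \<in> carrier V" "y = q b"
    by (auto simp: carrier_Q)
  with a show "adj Q (x \<oplus>\<^bsub>Q\<^esub> y) = adj Q x \<oplus>\<^bsub>Q\<^esub> adj Q y"
    by (simp add: V.adj_add flip: q_adj q_add)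
qed

sublocale Q: unital_star_space Q
  by (intro unital_star_space.intro star_vector_space_Q unital_star_space_axioms.intro)
    (simp_all add: carrier_Q flip: q_unit q_adj)

sublocale unital_star_linear V Q q
  by unfold_locales (auto simp: linear_on_def carrier_Q q_add q_smult q_unit)

lemma map_adj: "X \<in> mats n (carrier V) \<Longrightarrow> map_mat q (adj_mats V X) = adj_mats Q (map_mat q X)"
  by (rule eq_matI) (auto simp: mats_iff q_adj)

lemma lift:
  assumes "X \<in> mats n (carrier Q)"
  obtains Y where "Y \<in> mats n (carrier V)" "map_mat q Y = X"
  using assms unfolding carrier_Q by (rule mats_lift)

lemma pos_Q_iff:
  "X \<in> pos Q n \<longleftrightarrow> X \<in> mats n (carrier Q) \<and> (\<forall>r>0. shift_mats Q n r X \<in> map_mat q ` pos V n)"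
  (is "?L \<longleftrightarrow> ?R")
proof
  show "?L \<Longrightarrow> ?R"
    by (auto simp: pos_Q map_closed map_shift)
  assume ?R
  then obtain Y where "Y \<in> mats n (carrier V)" "map_mat q Y = X"
    using lift by blast
  with \<open>?R\<close> show ?L
    by (auto simp: pos_Q map_shift)
qed

text \<open>Half the sum of any lift and its adjoint is hermitian and has the same image, because
  \<open>X\<close> equals its own adjoint.\<close>

lemma hermitian_lift:
  assumes X: "X \<in> mats n (carrier Q)" "adj_mats Q X = X"
  obtains Y where "Y \<in> mats n (carrier V)" "adj_mats V Y = Y" "map_mat q Y = X"
proof -
  obtain Z where Z: "Z \<in> mats n (carrier V)" "map_mat q Z = X"
    using lift X(1) .
  let ?Y = "smult_mats V (complex_of_real (1 / 2)) (add_mats V Z (adj_mats V Z))"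
  have "adj_mats V (add_mats V Z (adj_mats V Z)) = add_mats V Z (adj_mats V Z)"
    using Z by (intro V.hermitianI[of _ n] V.mats_closed) (auto simp: mats_iff V.adj_add V.M.a_comm)
  then have "?Y \<in> mats n (carrier V)" "adj_mats V ?Y = ?Y"
    using Z by (blast intro: V.mats_closed V.hermitian_smult)+
  moreover have "map_mat q ?Y = X"
  proof -
    have "map_mat q ?Y = smult_mats Q (complex_of_real (1 / 2)) (add_mats Q X X)"
      using Z X(2) by (simp add: map_smult[of _ n] map_add[of _ n] map_adj[of _ n] V.mats_closed)
    also have "\<dots> = X"
      using X(1) by (intro eq_matI)
        (auto simp: mats_iff Q.scale_add_right simp flip: Q.scale_add_left)
    finally show ?thesis .
  qed
  ultimately show ?thesis
    using that by blast
qed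

lemma map_pos:
  assumes "X \<in> pos V n"
  shows "map_mat q X \<in> pos Q n"
  unfolding pos_Q using assms by (blast intro: V.pos_closed V.shift_pos less_imp_le)

lemma pos_Q_closed: "X \<in> pos Q n \<Longrightarrow> X \<in> mats n (carrier Q)"
  by (simp add: pos_Q_iff)

lemma pos_Q_shiftD:
  assumes "X \<in> pos Q n" "r > 0"
  obtains Y where "Y \<in> pos V n" "map_mat q Y = shift_mats Q n r X"
  using assms by (auto simp: pos_Q_iff)

text \<open>Each axiom is checked on positive lifts of shifts, by distributing \<open>r\<close>:
  \<open>r / 2\<close> to each summand, \<open>r / t\<close> before scaling by \<open>t > 0\<close>,
  \<open>r / s\<close> before a compression with \<open>s\<close> from
  \<open>unit_dominates_compress\<close>, and \<open>r / 2\<close> twice for the Archimedean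
  axiom.\<close>

lemma pre_operator_system_Q: "pre_operator_system Q"
proof (intro pre_operator_system.intro Q.unital_star_space_axioms pre_operator_system_axioms.intro)
  show "pos Q n \<subseteq> mats n (carrier Q)" for n
    by (auto simp: pos_Q_iff)
next
  fix X n assume X: "X \<in> pos Q n"
  have "(0::real) < 1"
    by simp
  then obtain Y where "Y \<in> pos V n" and Y: "map_mat q Y = shift_mats Q n 1 X"
    by (rule pos_Q_shiftD[OF X])
  then have "adj_mats Q (map_mat q Y) = map_mat q Y"
    by (metis V.pos_hermitian V.pos_closed map_adj)
  then show "adj_mats Q X = X"
    unfolding Y by (rule Q.hermitian_shift_cancel[OF pos_Q_closed[OF X]])
next
  fix X Y n assume X: "X \<in> pos Q n" and Y: "Y \<in> pos Q n"
  have "shift_mats Q n r (add_mats Q X Y) \<in> map_mat q ` pos V n" if r: "r > 0" for r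
  proof -
    have r2: "r / 2 > 0"
      using r by simp
    obtain X' where X': "X' \<in> pos V n" "map_mat q X' = shift_mats Q n (r / 2) X"
      using pos_Q_shiftD[OF X r2] .
    obtain Y' where Y': "Y' \<in> pos V n" "map_mat q Y' = shift_mats Q n (r / 2) Y"
      using pos_Q_shiftD[OF Y r2] .
    have "map_mat q (add_mats V X' Y') = shift_mats Q n (r / 2 + r / 2) (add_mats Q X Y)"
      using X' Y' Q.add_shift[OF pos_Q_closed[OF X] pos_Q_closed[OF Y], of "r / 2" "r / 2"]
      by (simp add: map_add[of _ n] V.pos_closed del: of_real_add of_real_divide)
    then have "map_mat q (add_mats V X' Y') = shift_mats Q n r (add_mats Q X Y)"
      by simp
    then show ?thesis
      using V.pos_add[OF X'(1) Y'(1)] by (metis imageI)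
  qed
  then show "add_mats Q X Y \<in> pos Q n"
    using X Y by (auto simp: pos_Q_iff intro: Q.mats_closed)
next
  fix X n and t :: real assume X: "X \<in> pos Q n" and t: "0 \<le> t"
  note Xc = pos_Q_closed[OF X]
  show "smult_mats Q (complex_of_real t) X \<in> pos Q n"
  proof (cases "t = 0")
    case True
    then have "smult_mats Q (complex_of_real t) X = map_mat q (zero_mats V n)"
      using Xc by (intro eq_matI) (auto simp: mats_iff)
    then show ?thesis
      using map_pos[OF V.zero_pos] by simp
  next
    case False
    have "shift_mats Q n r (smult_mats Q (complex_of_real t) X) \<in> map_mat q ` pos V n" if r: "r > 0" for r
    proof -
      have rt: "r / t > 0"
        using r t False by simp
      obtain X' where X': "X' \<in> pos V n" "map_mat q X' = shift_mats Q n (r / t) X"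
        using pos_Q_shiftD[OF X rt] .
      have "map_mat q (smult_mats V (complex_of_real t) X')
          = shift_mats Q n (t * (r / t)) (smult_mats Q (complex_of_real t) X)"
        using X' Q.smult_shift[OF Xc, of t "r / t"]
        by (simp add: map_smult[of _ n] V.pos_closed del: of_real_mult of_real_divide)
      moreover have "t * (r / t) = r"
        using False by simp
      ultimately show ?thesis
        using V.pos_smult[OF X'(1) t] by (metis imageI)
    qed
    then show ?thesis
      using Xc by (auto simp: pos_Q_iff intro: Q.mats_closed)
  qed
next
  fix X n m and A :: "complex mat" assume X: "X \<in> pos Q n" and A: "A \<in> carrier_mat n m"
  note Xc = pos_Q_closed[OF X]
  let ?CV = "compress_mats V A (unit_mats V n)" and ?CQ = "compress_mats Q A (unit_mats Q n)"
  obtain s where s: "s > 0" "shift_mats V m s (smult_mats V (- 1) ?CV) \<in> pos V m"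
    using V.unit_dominates_compress[OF A] by blast
  have CV: "?CV \<in> mats m (carrier V)"
    using A by (blast intro: V.mats_closed V.unit_mats_closed)
  have CQ: "map_mat q ?CV = ?CQ" "?CQ \<in> mats m (carrier Q)"
    using A map_compress[OF V.unit_mats_closed A] map_closed[OF CV] by (simp_all add: map_unit)
  have cX: "compress_mats Q A X \<in> mats m (carrier Q)"
    using Xc A by (rule Q.compress_mats_closed)
  have "shift_mats Q m r (compress_mats Q A X) \<in> map_mat q ` pos V m" if r: "r > 0" for r
  proof -
    have rs: "r / s > 0"
      using r s by simp
    obtain X' where X': "X' \<in> pos V n" "map_mat q X' = shift_mats Q n (r / s) X"
      using pos_Q_shiftD[OF X rs] .
    let ?D = "shift_mats V m s (smult_mats V (- 1) ?CV)"
    let ?Y = "add_mats V (smult_mats V (complex_of_real (r / s)) ?D) (compress_mats V A X')"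
    have "?Y \<in> pos V m"
      by (rule V.pos_add[OF V.pos_smult[OF s(2) less_imp_le[OF rs]] V.pos_compress[OF X'(1) A]])
    moreover have "map_mat q ?Y = shift_mats Q m r (compress_mats Q A X)"
    proof -
      have D: "?D \<in> mats m (carrier V)"
        using CV by (blast intro: V.mats_closed V.shift_mats_closed)
      have "map_mat q ?Y = add_mats Q (smult_mats Q (complex_of_real (r / s))
          (shift_mats Q m s (smult_mats Q (- 1) ?CQ))) (compress_mats Q A (shift_mats Q n (r / s) X))"
        using D CV X' A by (simp add: map_add[of _ m] map_smult[of _ m] map_shift[of _ m]
            map_compress[of _ n _ m] CQ V.mats_closed V.compress_mats_closed[of _ n _ m] V.pos_closed
            del: of_real_divide)
      also have "\<dots> = shift_mats Q m r (compress_mats Q A X)"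
        using s by (intro Q.shift_compress[OF Xc A]) simp
      finally show ?thesis .
    qed
    ultimately show ?thesis
      by (metis imageI)
  qed
  then show "compress_mats Q A X \<in> pos Q m"
    using cX by (simp add: pos_Q_iff)
next
  fix X n assume X: "X \<in> mats n (carrier Q)" "adj_mats Q X = X"
  obtain Y where Y: "Y \<in> mats n (carrier V)" "adj_mats V Y = Y" "map_mat q Y = X"
    using hermitian_lift[OF X] .
  then obtain r where r: "r > 0" "shift_mats V n r Y \<in> pos V n"
    using V.matrix_order_unit by blast
  from map_pos[OF this(2)] have "shift_mats Q n r X \<in> pos Q n"
    using Y by (simp add: map_shift)
  with r show "\<exists>r>0. shift_mats Q n r X \<in> pos Q n"
    by blast
next
  fix X n assume X: "X \<in> mats n (carrier Q)" and pos: "\<And>r. 0 < r \<Longrightarrow> shift_mats Q n r X \<in> pos Q n"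
  have "shift_mats Q n r X \<in> map_mat q ` pos V n" if "r > 0" for r
  proof -
    have "shift_mats Q n (r / 2) (shift_mats Q n (r / 2) X) \<in> map_mat q ` pos V n"
      using pos[of "r / 2"] that unfolding pos_Q_iff by (meson half_gt_zero)
    then show ?thesis
      using Q.shift_shift[OF X, of "r / 2" "r / 2"] by (simp del: of_real_divide)
  qed
  with X show "X \<in> pos Q n"
    by (simp add: pos_Q_iff)
qed

lemma ucp_map_q: "ucp_map V Q q"
  using map_pos by (simp add: ucp_map_def carrier_Q q_add q_smult q_unit)

end

section \<open>Quotients\<close>

context os_surjection
begin

lemma kernel_eqD:
  assumes "star_space_linear V T f"
    and kill: "\<And>x. \<lbrakk>x \<in> carrier V; q x = \<zero>\<^bsub>Q\<^esub>\<rbrakk> \<Longrightarrow> f x = \<zero>\<^bsub>T\<^esub>"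
    and xy: "x \<in> carrier V" "y \<in> carrier V" "q x = q y"
  shows "f x = f y"
proof -
  interpret f: star_space_linear V T f by fact
  have "q (x \<oplus>\<^bsub>V\<^esub> \<ominus>\<^bsub>V\<^esub> y) = \<zero>\<^bsub>Q\<^esub>"
    using xy by (simp add: Q.M.r_neg)
  then have "f x \<oplus>\<^bsub>T\<^esub> \<ominus>\<^bsub>T\<^esub> f y = \<zero>\<^bsub>T\<^esub>"
    using kill[of "x \<oplus>\<^bsub>V\<^esub> \<ominus>\<^bsub>V\<^esub> y"] xy by simp
  then show ?thesis
    using xy f.T.M.minus_equality[of "f x" "\<ominus>\<^bsub>T\<^esub> f y"] by (simp add: f.T.M.minus_minus)
qed

text \<open>If \<open>X\<close> is positive in \<open>Q\<close> and \<open>Y\<close> lifts it, then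
  each \<open>r e + X\<close> has a positive lift, which \<open>f\<close> sends to
  \<open>r e + f(Y)\<close> since \<open>f\<close> depends only on the image under \<open>q\<close>.
  The Archimedean axiom in \<open>T\<close> removes \<open>r\<close>.\<close>

lemma factor:
  assumes T: "pre_operator_system T" and ucp: "ucp_map V T f"
    and kill: "\<And>x. \<lbrakk>x \<in> carrier V; q x = \<zero>\<^bsub>Q\<^esub>\<rbrakk> \<Longrightarrow> f x = \<zero>\<^bsub>T\<^esub>"
  obtains g where "ucp_map Q T g" "\<And>x. x \<in> carrier V \<Longrightarrow> g (q x) = f x"
proof -
  interpret f: ucp V T f
    by (intro ucp.intro V.pre_operator_system_axioms T ucp_axioms.intro ucp)
  define g where "g a = f (inv_into (carrier V) q a)" for a
  have g: "g (q x) = f x" if x: "x \<in> carrier V" for x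
    unfolding g_def using x
    by (intro kernel_eqD[OF f.star_space_linear_axioms kill])
      (auto intro: inv_into_into f_inv_into_f)
  have map_g: "map_mat g (map_mat q X) = map_mat f X" if "X \<in> mats n (carrier V)" for n X
    using that by (intro eq_matI) (auto simp: mats_iff g)
  have "map_mat g X \<in> pos T n" if X: "X \<in> pos Q n" for n X
  proof -
    obtain Y where Y: "Y \<in> mats n (carrier V)" "map_mat q Y = X"
      using lift[OF pos_Q_closed[OF X]] .
    have "map_mat f Y \<in> pos T n"
    proof (rule f.T.archimedean)
      show "map_mat f Y \<in> mats n (carrier T)"
        using Y by (rule_tac f.map_closed)
      fix r :: real assume "0 < r"
      then obtain Z where Z: "Z \<in> pos V n" "map_mat q Z = shift_mats Q n r X"
        by (rule pos_Q_shiftD[OF X])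
      have "map_mat f Z = map_mat g (map_mat q (shift_mats V n r Y))"
        using Z Y by (simp add: map_shift map_g[OF V.pos_closed, symmetric])
      also have "\<dots> = shift_mats T n r (map_mat f Y)"
        using Y by (simp add: map_g[of _ n] V.shift_mats_closed f.map_shift)
      finally show "shift_mats T n r (map_mat f Y) \<in> pos T n"
        using f.map_pos[OF Z(1)] by simp
    qed
    then show ?thesis
      using Y map_g by auto
  qed
  then have "ucp_map Q T g"
    unfolding ucp_map_def carrier_Q
    by (auto simp: g simp flip: q_add q_smult q_unit)
  then show ?thesis
    using g that by blast
qed

text \<open>Since the kernels agree, the map from \<open>Q\<close> to \<open>T\<close> induced by
  \<open>f\<close> is injective, and properness of \<open>T\<close> pulls back entrywise.\<close>

lemma operator_system_of_kernel:
  assumes T: "operator_system T" and ucp: "ucp_map V T f"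
    and ker: "\<And>x. x \<in> carrier V \<Longrightarrow> q x = \<zero>\<^bsub>Q\<^esub> \<longleftrightarrow> f x = \<zero>\<^bsub>T\<^esub>"
  shows "operator_system Q"
  unfolding operator_system_iff
proof (intro conjI allI ballI impI)
  show "pre_operator_system Q"
    by (rule pre_operator_system_Q)
  interpret T: operator_system T by fact
  obtain g where g: "ucp_map Q T g" "\<And>x. x \<in> carrier V \<Longrightarrow> g (q x) = f x"
    using factor[OF pre_operator_system[OF T] ucp] ker by blast
  interpret g: ucp Q T g
    by (intro ucp.intro pre_operator_system_Q pre_operator_system[OF T] ucp_axioms.intro g)
  fix n X assume X: "X \<in> pos Q n" "smult_mats Q (- 1) X \<in> pos Q n"
  note Xc = pos_Q_closed[OF X(1)]
  have "map_mat g X = zero_mats T n"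
    using T.pos_proper g.map_pos[OF X(1)] g.map_pos[OF X(2)] Xc by (simp add: g.map_smult)
  show "X = zero_mats Q n"
  proof (rule mats_eqI[OF Xc Q.zero_mats_closed])
    fix i j assume ij: "i < n" "j < n"
    then obtain x where x: "x \<in> carrier V" "X $$ (i, j) = q x"
      using matsD(3)[OF Xc] carrier_Q by blast
    have "map_mat g X $$ (i, j) = zero_mats T n $$ (i, j)"
      using \<open>map_mat g X = zero_mats T n\<close> by simp
    then have "f x = \<zero>\<^bsub>T\<^esub>"
      using ij x g(2) matsD(1,2)[OF Xc] by simp
    then show "X $$ (i, j) = zero_mats Q n $$ (i, j)"
      using x ij ker by simp
  qed
qed

text \<open>With no target to borrow properness from, one shows that \<open>q\<close> reflects
  positivity of hermitian matrices, because a hermitian matrix with null entries is positive. So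
  \<open>X\<close> and \<open>- X\<close> in the cone lift to \<open>Y\<close> and
  \<open>- Y\<close> in the cone, and the entries of \<open>Y\<close> are null.\<close>

lemma operator_system_of_null:
  assumes ker: "\<And>x. x \<in> carrier V \<Longrightarrow> q x = \<zero>\<^bsub>Q\<^esub> \<longleftrightarrow> null_elem V x"
  shows "operator_system Q"
  unfolding operator_system_iff
proof (intro conjI allI ballI impI)
  show "pre_operator_system Q"
    by (rule pre_operator_system_Q)
  have pos: "Y \<in> pos V n" if Y: "Y \<in> mats n (carrier V)" "adj_mats V Y = Y" "map_mat q Y \<in> pos Q n" for n Y
  proof (rule V.archimedean[OF Y(1)])
    fix r :: real assume "0 < r"
    then obtain Z where Z: "Z \<in> pos V n" "map_mat q Z = shift_mats Q n r (map_mat q Y)"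
      by (rule pos_Q_shiftD[OF Y(3)])
    \<comment> \<open>The defect \<open>r e + Y - Z\<close> is hermitian with entries in the kernel
      of \<open>q\<close>, hence positive; so \<open>r e + Y\<close> is a sum of two positive
      matrices.\<close>
    let ?D = "add_mats V (shift_mats V n r Y) (smult_mats V (complex_of_real (- 1)) Z)"
    have Zc: "Z \<in> mats n (carrier V)" "shift_mats V n r Y \<in> mats n (carrier V)"
      using Z(1) Y(1) by (blast intro: V.pos_closed V.shift_mats_closed)+
    have "null_elem V (?D $$ (i, j))" if ij: "i < n" "j < n" for i j
    proof -
      have "map_mat q Z $$ (i, j) = map_mat q (shift_mats V n r Y) $$ (i, j)"
        using Z Y by (simp add: map_shift)
      then have "q (?D $$ (i, j)) = \<zero>\<^bsub>Q\<^esub>"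
        using ij matsD[OF Zc(1)] matsD[OF Zc(2)] matsD[OF Y(1)]
        by (simp add: Q.M.r_neg V.scale_minus_one q_smult del: index_mats(1))
          (simp add: Q.M.r_neg V.scale_minus_one)
      moreover have "?D $$ (i, j) \<in> carrier V"
        using matsD(3)[OF V.add_mats_closed[OF Zc(2) V.smult_mats_closed[OF Zc(1)]] ij] .
      ultimately show ?thesis
        using ker by blast
    qed
    then have "?D \<in> mats n {x. null_elem V x}"
      using matsD(1,2)[OF Y(1)] by (auto simp: mats_iff)
    moreover have "adj_mats V ?D = ?D"
      using Y Zc V.pos_hermitian[OF Z(1)]
      by (blast intro: V.hermitian_add V.hermitian_smult V.hermitian_shift V.mats_closed)
    ultimately have "?D \<in> pos V n"
      by (rule V.pos_if_null_entries)
    then have "add_mats V ?D Z \<in> pos V n"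
      using Z(1) by (rule V.pos_add)
    moreover have "add_mats V ?D Z = shift_mats V n r Y"
    proof (rule mats_eqI[OF _ Zc(2)])
      fix i j assume ij: "i < n" "j < n"
      then show "add_mats V ?D Z $$ (i, j) = shift_mats V n r Y $$ (i, j)"
        using matsD[OF Zc(1)] matsD[OF Zc(2)] matsD(1,2)[OF Y(1)]
        by (simp add: V.scale_minus_one V.M.a_assoc V.M.l_neg del: index_mats(4))
    qed (use Zc in \<open>blast intro: V.mats_closed\<close>)
    ultimately show "shift_mats V n r Y \<in> pos V n"
      by simp
  qed
  fix n X assume X: "X \<in> pos Q n" "smult_mats Q (- 1) X \<in> pos Q n"
  note Xc = pos_Q_closed[OF X(1)]
  interpret Q': pre_operator_system Q
    by (rule pre_operator_system_Q)
  obtain Y where Y: "Y \<in> mats n (carrier V)" "adj_mats V Y = Y" "map_mat q Y = X"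
    using hermitian_lift[OF Xc Q'.pos_hermitian[OF X(1)]] .
  have "Y \<in> pos V n"
    using pos[of Y n] Y X by simp
  moreover have "smult_mats V (- 1) Y \<in> pos V n"
    using pos[of "smult_mats V (- 1) Y" n] Y X V.hermitian_smult[OF Y(1,2), of "- 1"]
    by (simp add: map_smult V.mats_closed)
  ultimately have null: "null_elem V (Y $$ (i, j))" if "i < n" "j < n" for i j
    using that by (rule V.null_if_pos_neg)
  show "X = zero_mats Q n"
    by (rule mats_eqI[OF Xc Q.zero_mats_closed])
      (use Y(3) null ker V.null_closed matsD[OF Y(1)] in auto)
qed

end

text \<open>The quotient by the fibres of \<open>q\<close>, computed on chosen representatives.
  Since \<open>q\<close> may take values in any type, classes can be encoded in whatever type a
  universal property prescribes.\<close>

definition image_opsys :: "'a opsys \<Rightarrow> ('a \<Rightarrow> 'b) \<Rightarrow> 'b opsys" where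
  "image_opsys V q = (let rep = inv_into (carrier V) q in \<lparr>
     carrier = q ` carrier V,
     mult = undefined,
     one = undefined,
     zero = q \<zero>\<^bsub>V\<^esub>,
     add = (\<lambda>a b. q (rep a \<oplus>\<^bsub>V\<^esub> rep b)),
     smult = (\<lambda>c a. q (c \<odot>\<^bsub>V\<^esub> rep a)),
     adj = (\<lambda>a. q (adj V (rep a))),
     order_unit = q (order_unit V),
     pos = (\<lambda>n. {map_mat q X | X. X \<in> mats n (carrier V) \<and>
       (\<forall>r>0. map_mat q (shift_mats V n r X) \<in> map_mat q ` pos V n)})\<rparr>)"

text \<open>Null elements form a subspace closed under \<open>adj\<close>, so the operations do not
  depend on the representatives.\<close>

lemma image_opsys:
  fixes V :: "'a opsys" and q :: "'a \<Rightarrow> 'b"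
  assumes "pre_operator_system V"
    and q_eq: "\<And>x y. \<lbrakk>x \<in> carrier V; y \<in> carrier V\<rbrakk> \<Longrightarrow> q x = q y \<longleftrightarrow> null_elem V (x \<ominus>\<^bsub>V\<^esub> y)"
  shows "os_surjection V (image_opsys V q) q" and "operator_system (image_opsys V q)"
proof -
  interpret V: pre_operator_system V by fact
  define rep where "rep = inv_into (carrier V) q"
  have rep: "rep (q x) \<in> carrier V" "q (rep (q x)) = q x" if "x \<in> carrier V" for x
    using that by (auto simp: rep_def inv_into_into f_inv_into_f)
  then have rep_null: "null_elem V (x \<ominus>\<^bsub>V\<^esub> rep (q x))" if "x \<in> carrier V" for x
    using that q_eq by metis
  have add: "q (x \<oplus>\<^bsub>V\<^esub> y) = q (rep (q x) \<oplus>\<^bsub>V\<^esub> rep (q y))"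
    if xy: "x \<in> carrier V" "y \<in> carrier V" for x y
  proof -
    have "(x \<ominus>\<^bsub>V\<^esub> rep (q x)) \<oplus>\<^bsub>V\<^esub> (y \<ominus>\<^bsub>V\<^esub> rep (q y)) = (x \<oplus>\<^bsub>V\<^esub> y) \<ominus>\<^bsub>V\<^esub> (rep (q x) \<oplus>\<^bsub>V\<^esub> rep (q y))"
      using xy rep by (simp add: a_minus_def V.M.minus_add V.M.a_ac)
    then show ?thesis
      using xy rep V.null_add[OF rep_null rep_null, of x y] q_eq by simp
  qed
  have smult: "q (c \<odot>\<^bsub>V\<^esub> x) = q (c \<odot>\<^bsub>V\<^esub> rep (q x))" if x: "x \<in> carrier V" for x c
  proof -
    have "c \<odot>\<^bsub>V\<^esub> (x \<ominus>\<^bsub>V\<^esub> rep (q x)) = c \<odot>\<^bsub>V\<^esub> x \<ominus>\<^bsub>V\<^esub> c \<odot>\<^bsub>V\<^esub> rep (q x)"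
      using x rep by (simp add: a_minus_def V.scale_add_right V.scale_scale flip: V.scale_minus_one)
    then show ?thesis
      using x rep V.null_smult[OF rep_null, of x c] q_eq by simp
  qed
  have adj: "q (adj V x) = q (adj V (rep (q x)))" if x: "x \<in> carrier V" for x
  proof -
    have "adj V (x \<ominus>\<^bsub>V\<^esub> rep (q x)) = adj V x \<ominus>\<^bsub>V\<^esub> adj V (rep (q x))"
      using x rep by (simp add: a_minus_def V.adj_add V.adj_smult flip: V.scale_minus_one)
    then show ?thesis
      using x rep V.null_adj[OF rep_null, of x] q_eq by simp
  qed
  show surj: "os_surjection V (image_opsys V q) q"
    by (intro os_surjection.intro os_surjection_axioms.intro assms(1))
      (simp_all add: image_opsys_def Let_def rep_def[symmetric] add smult adj)
  show "operator_system (image_opsys V q)"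
  proof (rule os_surjection.operator_system_of_null[OF surj])
    fix x assume "x \<in> carrier V"
    then show "q x = \<zero>\<^bsub>image_opsys V q\<^esub> \<longleftrightarrow> null_elem V x"
      using q_eq[of x "\<zero>\<^bsub>V\<^esub>"] by (simp add: image_opsys_def Let_def a_minus_def)
  qed
qed

text \<open>Cosets of a kernel are the fibres of the map, which turns identities between cosets into
  equations between values of \<open>f\<close>.\<close>

lemma quot_map_eq:
  assumes "star_space_linear S T f" and J: "J = {x \<in> carrier S. f x = \<zero>\<^bsub>T\<^esub>}"
    and x: "x \<in> carrier S"
  shows "quot_map S J x = {z \<in> carrier S. f z = f x}"
proof -
  interpret star_space_linear S T f by fact
  have "z \<in> (\<Union>h\<in>J. {h \<oplus>\<^bsub>S\<^esub> x}) \<longleftrightarrow> z \<in> carrier S \<and> f z = f x" for z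
  proof
    assume "z \<in> carrier S \<and> f z = f x"
    then have "z \<oplus>\<^bsub>S\<^esub> \<ominus>\<^bsub>S\<^esub> x \<in> J" "z = (z \<oplus>\<^bsub>S\<^esub> \<ominus>\<^bsub>S\<^esub> x) \<oplus>\<^bsub>S\<^esub> x"
      using x by (simp_all add: J T.M.r_neg S.M.a_assoc S.M.l_neg)
    then show "z \<in> (\<Union>h\<in>J. {h \<oplus>\<^bsub>S\<^esub> x})"
      by blast
  qed (use x J in auto)
  then show ?thesis
    by (auto simp: quot_map_def a_r_coset_def')
qed

text \<open>Over a fibre of \<open>f\<close> the unions in \<open>os_quotient\<close> collapse to a
  single coset. In the cone, correcting \<open>X\<close> by a matrix over \<open>J\<close> amounts
  to choosing another lift of the same image.\<close>

lemma os_surjection_quotient: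
  assumes "ucp S T f" and J: "J = {x \<in> carrier S. f x = \<zero>\<^bsub>T\<^esub>}"
  shows "os_surjection S (os_quotient S J) (quot_map S J)"
proof -
  interpret ucp S T f by fact
  note qeq = quot_map_eq[OF star_space_linear_axioms J]
  have q_iff: "quot_map S J x = quot_map S J y \<longleftrightarrow> f x = f y"
    if "x \<in> carrier S" "y \<in> carrier S" for x y
    using that by (auto simp: qeq)
  have fin: "\<Union> ((\<lambda>z. quot_map S J (h z)) ` quot_map S J x) = quot_map S J (h x)"
    if x: "x \<in> carrier S" and h: "\<And>z. z \<in> carrier S \<Longrightarrow> h z \<in> carrier S"
      and fh: "\<And>z. \<lbrakk>z \<in> carrier S; f z = f x\<rbrakk> \<Longrightarrow> f (h z) = f (h x)" for x h
  proof -
    have "quot_map S J (h z) = quot_map S J (h x)" if "z \<in> quot_map S J x" for z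
    proof -
      have "z \<in> carrier S" "f z = f x"
        using that unfolding qeq[OF x] by blast+
      then show ?thesis
        unfolding q_iff[OF h[OF \<open>z \<in> carrier S\<close>] h[OF x]] by (rule fh)
    qed
    moreover have "x \<in> quot_map S J x"
      unfolding qeq[OF x] using x by blast
    ultimately show ?thesis
      by blast
  qed
  show ?thesis
  proof (intro os_surjection.intro S.pre_operator_system_axioms os_surjection_axioms.intro)
    show "carrier (os_quotient S J) = quot_map S J ` carrier S"
      by (auto simp: os_quotient_def A_RCOSETS_def' quot_map_def)
    show "quot_map S J \<zero>\<^bsub>S\<^esub> = \<zero>\<^bsub>os_quotient S J\<^esub>"
      by (simp add: qeq) (simp add: os_quotient_def J)
    show "quot_map S J (order_unit S) = order_unit (os_quotient S J)"
      by (simp add: os_quotient_def)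
  next
    fix x assume x: "x \<in> carrier S"
    show "quot_map S J (c \<odot>\<^bsub>S\<^esub> x) = c \<odot>\<^bsub>os_quotient S J\<^esub> quot_map S J x" for c
      using fin[of x "\<lambda>z. c \<odot>\<^bsub>S\<^esub> z"] x by (simp add: os_quotient_def)
    show "quot_map S J (adj S x) = adj (os_quotient S J) (quot_map S J x)"
      using fin[of x "adj S"] x by (simp add: os_quotient_def)
    fix y assume y: "y \<in> carrier S"
    have "z \<in> quot_map S J (x \<oplus>\<^bsub>S\<^esub> y) \<longleftrightarrow> z \<in> quot_map S J x <+>\<^bsub>S\<^esub> quot_map S J y" for z
    proof
      assume "z \<in> quot_map S J (x \<oplus>\<^bsub>S\<^esub> y)"
      then have z: "z \<in> carrier S" "f z = f x \<oplus>\<^bsub>T\<^esub> f y"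
        using x y by (auto simp: qeq)
      then have "z = (z \<oplus>\<^bsub>S\<^esub> \<ominus>\<^bsub>S\<^esub> y) \<oplus>\<^bsub>S\<^esub> y" "f (z \<oplus>\<^bsub>S\<^esub> \<ominus>\<^bsub>S\<^esub> y) = f x"
        using x y by (simp_all add: S.M.a_assoc S.M.l_neg T.M.a_assoc T.M.r_neg)
      then show "z \<in> quot_map S J x <+>\<^bsub>S\<^esub> quot_map S J y"
        using x y z unfolding qeq[OF x] qeq[OF y] set_add_def'
        by (intro UN_I[of "z \<oplus>\<^bsub>S\<^esub> \<ominus>\<^bsub>S\<^esub> y"] UN_I[of y]) auto
    qed (use x y in \<open>auto simp: qeq set_add_def'\<close>)
    then show "quot_map S J (x \<oplus>\<^bsub>S\<^esub> y) = quot_map S J x \<oplus>\<^bsub>os_quotient S J\<^esub> quot_map S J y"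
      by (auto simp: os_quotient_def)
  next
    fix n
    have map_q_iff: "map_mat (quot_map S J) Y = map_mat (quot_map S J) X \<longleftrightarrow> map_mat f Y = map_mat f X"
      if "X \<in> mats n (carrier S)" "Y \<in> mats n (carrier S)" for X Y
      using that by (simp add: mat_eq_iff mats_iff q_iff)
    have "(\<exists>K\<in>mats n J. shift_mats S n r (add_mats S X K) \<in> pos S n) \<longleftrightarrow>
        map_mat (quot_map S J) (shift_mats S n r X) \<in> map_mat (quot_map S J) ` pos S n"
      if X: "X \<in> mats n (carrier S)" for X r
    proof
      assume "\<exists>K\<in>mats n J. shift_mats S n r (add_mats S X K) \<in> pos S n"
      then obtain K where K: "K \<in> mats n J" "shift_mats S n r (add_mats S X K) \<in> pos S n"
        by blast
      have Kc: "K \<in> mats n (carrier S)"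
        using K(1) by (auto simp: J mats_iff)
      have "map_mat f K = zero_mats T n"
        using K(1) by (auto simp: J mats_iff intro!: eq_matI)
      then have "map_mat f (shift_mats S n r (add_mats S X K)) = map_mat f (shift_mats S n r X)"
        using X Kc T.M.r_zero matsD[OF map_closed[OF X]]
        by (simp add: map_shift S.mats_closed map_add[of _ n]) (auto intro!: eq_matI)
      then show "map_mat (quot_map S J) (shift_mats S n r X) \<in> map_mat (quot_map S J) ` pos S n"
        using map_q_iff[of "shift_mats S n r X" "shift_mats S n r (add_mats S X K)"] X K(2)
          S.pos_closed[OF K(2)] S.shift_mats_closed[OF X] by (metis imageI)
    next
      assume "map_mat (quot_map S J) (shift_mats S n r X) \<in> map_mat (quot_map S J) ` pos S n"
      then obtain Y where Y: "Y \<in> pos S n"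
        "map_mat (quot_map S J) Y = map_mat (quot_map S J) (shift_mats S n r X)"
        by auto
      have Yc: "Y \<in> mats n (carrier S)" and Xs: "shift_mats S n r X \<in> mats n (carrier S)"
        using Y X by (auto intro: S.pos_closed S.shift_mats_closed)
      then have fY: "map_mat f Y = map_mat f (shift_mats S n r X)"
        using Y(2) map_q_iff by blast
      \<comment> \<open>The difference between the positive lift \<open>Y\<close> and
        \<open>r e + X\<close>: its entries lie in \<open>J\<close>, and adding it to
        \<open>X\<close> turns the shift of \<open>X\<close> into \<open>Y\<close>.\<close>
      let ?K = "add_mats S Y (smult_mats S (- 1) (shift_mats S n r X))"
      have Kc: "?K \<in> mats n (carrier S)"
        using Yc Xs by (blast intro: S.mats_closed)
      have "f (?K $$ (i, j)) = \<zero>\<^bsub>T\<^esub>" if ij: "i < n" "j < n" for i j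
      proof -
        have "map_mat f Y $$ (i, j) = map_mat f (shift_mats S n r X) $$ (i, j)"
          using fY by simp
        then have "f (Y $$ (i, j)) = f (shift_mats S n r X $$ (i, j))"
          using ij matsD[OF Yc] matsD[OF Xs] by simp
        moreover have "?K $$ (i, j) = Y $$ (i, j) \<oplus>\<^bsub>S\<^esub> \<ominus>\<^bsub>S\<^esub> (shift_mats S n r X $$ (i, j))"
          using ij matsD[OF Yc] matsD[OF Xs] by (simp add: S.scale_minus_one del: index_mats(4))
        ultimately show ?thesis
          using ij matsD(3)[OF Yc ij] matsD(3)[OF Xs ij]
          by (simp add: T.M.r_neg del: index_mats)
      qed
      then have "?K \<in> mats n J"
        unfolding J using matsD[OF Kc] by (intro matsI CollectI conjI)
      moreover have "shift_mats S n r (add_mats S X ?K) = Y"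
      proof (rule mats_eqI[OF _ Yc])
        show "shift_mats S n r (add_mats S X ?K) \<in> mats n (carrier S)"
          using X Kc by (blast intro: S.mats_closed S.shift_mats_closed)
        fix i j assume ij: "i < n" "j < n"
        define u where "u = complex_of_real r \<odot>\<^bsub>S\<^esub> unit_mats S n $$ (i, j)"
        define x where "x = X $$ (i, j)"
        define y where "y = Y $$ (i, j)"
        have car: "u \<in> carrier S" "x \<in> carrier S" "y \<in> carrier S"
          using matsD(3)[OF X ij] matsD(3)[OF Yc ij] ij by (simp_all add: u_def x_def y_def)
        have "shift_mats S n r (add_mats S X ?K) $$ (i, j) = u \<oplus>\<^bsub>S\<^esub> (x \<oplus>\<^bsub>S\<^esub> (y \<oplus>\<^bsub>S\<^esub> (- 1) \<odot>\<^bsub>S\<^esub> (u \<oplus>\<^bsub>S\<^esub> x)))"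
          using ij matsD(1,2)[OF X] matsD(1,2)[OF Yc] by (simp add: u_def x_def y_def del: index_mats(4))
        also have "\<dots> = y \<oplus>\<^bsub>S\<^esub> ((u \<oplus>\<^bsub>S\<^esub> x) \<oplus>\<^bsub>S\<^esub> \<ominus>\<^bsub>S\<^esub> (u \<oplus>\<^bsub>S\<^esub> x))"
          using car by (simp add: S.scale_minus_one S.M.a_ac del: S.M.minus_add)
        also have "\<dots> = y"
          using car by (simp add: S.M.r_neg del: S.M.minus_add)
        finally show "shift_mats S n r (add_mats S X ?K) $$ (i, j) = Y $$ (i, j)"
          by (simp add: y_def)
      qed
      ultimately show "\<exists>K\<in>mats n J. shift_mats S n r (add_mats S X K) \<in> pos S n"
        using Y(1) by metis
    qed
    then show "pos (os_quotient S J) n = {map_mat (quot_map S J) X | X. X \<in> mats n (carrier S) \<and>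
      (\<forall>r>0. map_mat (quot_map S J) (shift_mats S n r X) \<in> map_mat (quot_map S J) ` pos S n)}"
      unfolding os_quotient_def by auto
  qed
qed

text \<open>The target \<open>T\<close> may live on any type, whereas \<open>os_kernel\<close> fixes
  it. This allows the kernel of a map from one limit to the other to be divided out
  directly.\<close>

lemma operator_system_quotient:
  assumes S: "operator_system S" and T: "operator_system T" and f: "ucp_map S T f"
    and J: "J = {x \<in> carrier S. f x = \<zero>\<^bsub>T\<^esub>}"
  shows "os_surjection S (os_quotient S J) (quot_map S J)"
    and "operator_system (os_quotient S J)"
    and "ucp_map S (os_quotient S J) (quot_map S J)"
    and "\<And>x. x \<in> carrier S \<Longrightarrow> quot_map S J x = \<zero>\<^bsub>os_quotient S J\<^esub> \<longleftrightarrow> x \<in> J"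
proof -
  interpret f: ucp S T f
    using S T f by (rule ucpI)
  show surj: "os_surjection S (os_quotient S J) (quot_map S J)"
    using f.ucp_axioms J by (rule os_surjection_quotient)
  interpret os_surjection S "os_quotient S J" "quot_map S J"
    by (rule surj)
  show ker: "quot_map S J x = \<zero>\<^bsub>os_quotient S J\<^esub> \<longleftrightarrow> x \<in> J" if "x \<in> carrier S" for x
  proof -
    note qeq = quot_map_eq[OF f.star_space_linear_axioms J]
    have "\<zero>\<^bsub>os_quotient S J\<^esub> = {z \<in> carrier S. f z = \<zero>\<^bsub>T\<^esub>}"
      using qeq[of "\<zero>\<^bsub>S\<^esub>"] q_zero by simp
    moreover have "quot_map S J x = {z \<in> carrier S. f z = f x}"
      using that by (rule qeq)
    moreover have "x \<in> J \<longleftrightarrow> f x = \<zero>\<^bsub>T\<^esub>"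
      using that by (simp add: J)
    moreover have "{z \<in> carrier S. f z = f x} = {z \<in> carrier S. f z = \<zero>\<^bsub>T\<^esub>} \<longleftrightarrow> f x = \<zero>\<^bsub>T\<^esub>"
      using that by auto
    ultimately show ?thesis
      by (simp only:)
  qed
  show "operator_system (os_quotient S J)"
    using T f by (rule operator_system_of_kernel) (use ker J in auto)
  show "ucp_map S (os_quotient S J) (quot_map S J)"
    by (rule ucp_map_q)
qed

section \<open>Coherent sequences\<close>

text \<open>For \<open>k \<le> m\<close> the term at \<open>m\<close> is the image of
  \<open>x\<close> under the connecting maps from \<open>S k\<close> to \<open>S m\<close>. Below
  \<open>k\<close> the sequence is padded with zeros, which has no effect on its tail.\<close>

primrec germ :: "(nat \<Rightarrow> 'a opsys) \<Rightarrow> (nat \<Rightarrow> 'a \<Rightarrow> 'a) \<Rightarrow> nat \<Rightarrow> 'a \<Rightarrow> nat \<Rightarrow> 'a" where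
  "germ S \<phi> k x 0 = (if k = 0 then x else \<zero>\<^bsub>S 0\<^esub>)"
| "germ S \<phi> k x (Suc m) =
     (if k = Suc m then x else if k \<le> m then \<phi> m (germ S \<phi> k x m) else \<zero>\<^bsub>S (Suc m)\<^esub>)"

text \<open>Coherence is asked only eventually, because of the padding of germs. In the cone
  \<open>r\<close> is chosen before the index, which builds in the Archimedean axiom; hermitian
  symmetry is asked at all indices, since it is an equation between whole sequences.\<close>

definition seq_space :: "(nat \<Rightarrow> 'a opsys) \<Rightarrow> (nat \<Rightarrow> 'a \<Rightarrow> 'a) \<Rightarrow> (nat \<Rightarrow> 'a) opsys" where
  "seq_space S \<phi> = (let C = {f. (\<forall>m. f m \<in> carrier (S m)) \<and> (\<forall>\<^sub>F m in sequentially. f (Suc m) = \<phi> m (f m))}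
   in \<lparr>
     carrier = C,
     mult = undefined,
     one = undefined,
     zero = (\<lambda>m. \<zero>\<^bsub>S m\<^esub>),
     add = (\<lambda>f g m. f m \<oplus>\<^bsub>S m\<^esub> g m),
     smult = (\<lambda>c f m. c \<odot>\<^bsub>S m\<^esub> f m),
     adj = (\<lambda>f m. adj (S m) (f m)),
     order_unit = (\<lambda>m. order_unit (S m)),
     pos = (\<lambda>n. {X \<in> mats n C. (\<forall>m. adj_mats (S m) (map_mat (\<lambda>f. f m) X) = map_mat (\<lambda>f. f m) X) \<and>
       (\<forall>r>0. \<forall>\<^sub>F m in sequentially. shift_mats (S m) n r (map_mat (\<lambda>f. f m) X) \<in> pos (S m) n)})\<rparr>)"

locale inductive_system =
  fixes S :: "nat \<Rightarrow> 'a opsys" and \<phi> :: "nat \<Rightarrow> 'a \<Rightarrow> 'a"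
  assumes system: "os_inductive_system S \<phi>"
begin

abbreviation V :: "(nat \<Rightarrow> 'a) opsys" where
  "V \<equiv> seq_space S \<phi>"

abbreviation at_index :: "nat \<Rightarrow> (nat \<Rightarrow> 'a) mat \<Rightarrow> 'a mat" where
  "at_index m X \<equiv> map_mat (\<lambda>f. f m) X"

lemma seq_carrier: "f \<in> carrier V \<longleftrightarrow>
    (\<forall>m. f m \<in> carrier (S m)) \<and> (\<forall>\<^sub>F m in sequentially. f (Suc m) = \<phi> m (f m))"
  by (simp add: seq_space_def Let_def)

lemma seq_closed [simp]: "f \<in> carrier V \<Longrightarrow> f m \<in> carrier (S m)"
  by (simp add: seq_carrier)

lemma seq_coherent: "f \<in> carrier V \<Longrightarrow> \<forall>\<^sub>F m in sequentially. f (Suc m) = \<phi> m (f m)"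
  by (simp add: seq_carrier)

lemma seq_ops [simp]:
  "\<zero>\<^bsub>V\<^esub> = (\<lambda>m. \<zero>\<^bsub>S m\<^esub>)"
  "f \<oplus>\<^bsub>V\<^esub> g = (\<lambda>m. f m \<oplus>\<^bsub>S m\<^esub> g m)"
  "c \<odot>\<^bsub>V\<^esub> f = (\<lambda>m. c \<odot>\<^bsub>S m\<^esub> f m)"
  "adj V f = (\<lambda>m. adj (S m) (f m))"
  "order_unit V = (\<lambda>m. order_unit (S m))"
  by (simp_all only: seq_space_def Let_def opsys.simps module.simps ring.simps monoid.simps partial_object.simps)

sublocale S: pre_operator_system "S m" for m
  using system by (simp add: os_inductive_system_def pre_operator_system)

lemma ucp_step: "ucp (S m) (S (Suc m)) (\<phi> m)"
  using system by (intro ucpI) (simp_all add: os_inductive_system_def)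

lemma ucp_map_step: "ucp_map (S m) (S (Suc m)) (\<phi> m)"
  using system by (simp add: os_inductive_system_def)

sublocale step: ucp "S m" "S (Suc m)" "\<phi> m" for m
  by (rule ucp_step)

lemma seq_add_closed: "\<lbrakk>f \<in> carrier V; g \<in> carrier V\<rbrakk> \<Longrightarrow> (\<lambda>m. f m \<oplus>\<^bsub>S m\<^esub> g m) \<in> carrier V"
  by (auto simp: seq_carrier elim: eventually_elim2)

lemma seq_smult_closed: "f \<in> carrier V \<Longrightarrow> (\<lambda>m. c \<odot>\<^bsub>S m\<^esub> f m) \<in> carrier V"
  by (auto simp: seq_carrier elim: eventually_mono)

lemma seq_adj_closed: "f \<in> carrier V \<Longrightarrow> (\<lambda>m. adj (S m) (f m)) \<in> carrier V"
  by (auto simp: seq_carrier elim: eventually_mono)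

lemma seq_zero_closed: "(\<lambda>m. \<zero>\<^bsub>S m\<^esub>) \<in> carrier V"
  by (auto simp: seq_carrier)

lemma seq_unit_closed: "(\<lambda>m. order_unit (S m)) \<in> carrier V"
  by (auto simp: seq_carrier)

lemma star_vector_space_V: "star_vector_space V"
proof (intro star_vector_space.intro vectorspace.intro star_vector_space_axioms.intro moduleI)
  show "field (class_ring :: complex ring)"
    by (rule class_field)
  then show "cring (class_ring :: complex ring)"
    by (simp add: field_def domain_def)
  show "abelian_group V"
  proof (rule abelian_groupI)
    fix f assume f: "f \<in> carrier V"
    show "\<exists>g\<in>carrier V. g \<oplus>\<^bsub>V\<^esub> f = \<zero>\<^bsub>V\<^esub>"
    proof
      show "(\<lambda>m. (- 1) \<odot>\<^bsub>S m\<^esub> f m) \<in> carrier V"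
        using f by (rule seq_smult_closed)
      show "(\<lambda>m. (- 1) \<odot>\<^bsub>S m\<^esub> f m) \<oplus>\<^bsub>V\<^esub> f = \<zero>\<^bsub>V\<^esub>"
        using f by (simp add: S.scale_minus_one S.M.l_neg)
    qed
  qed (auto simp: seq_add_closed seq_zero_closed S.M.a_ac)
qed (auto simp: seq_add_closed seq_smult_closed seq_adj_closed S.scale_add_left S.scale_add_right
    S.scale_scale S.adj_add S.adj_smult)

sublocale V: unital_star_space V
  by (intro unital_star_space.intro star_vector_space_V unital_star_space_axioms.intro)
    (simp_all add: seq_unit_closed)

text \<open>Evaluation is treated as a unital linear map only: a positive matrix over
  \<open>V\<close> is positive at index \<open>m\<close> only up to a shift and for large
  \<open>m\<close>.\<close>

sublocale ev: unital_star_linear V "S m" "\<lambda>f. f m" for m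
  by unfold_locales (simp_all add: linear_on_def)

lemma seq_pos_iff: "X \<in> pos V n \<longleftrightarrow> X \<in> mats n (carrier V) \<and> adj_mats V X = X \<and>
    (\<forall>r>0. \<forall>\<^sub>F m in sequentially. shift_mats (S m) n r (at_index m X) \<in> pos (S m) n)"
proof -
  have "adj_mats V X = X \<longleftrightarrow> (\<forall>m. adj_mats (S m) (at_index m X) = at_index m X)"
    if "X \<in> mats n (carrier V)" for X
    using matsD[OF that] by (auto simp: mat_eq_iff fun_eq_iff)
  moreover have "X \<in> pos V n \<longleftrightarrow> X \<in> mats n (carrier V) \<and>
      (\<forall>m. adj_mats (S m) (at_index m X) = at_index m X) \<and>
      (\<forall>r>0. \<forall>\<^sub>F m in sequentially. shift_mats (S m) n r (at_index m X) \<in> pos (S m) n)"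
    by (simp only: seq_space_def Let_def opsys.simps module.simps ring.simps monoid.simps
        partial_object.simps mem_Collect_eq)
  ultimately show ?thesis
    by blast
qed

lemma seq_posD: "\<lbrakk>X \<in> pos V n; r > 0\<rbrakk> \<Longrightarrow>
    \<forall>\<^sub>F m in sequentially. shift_mats (S m) n r (at_index m X) \<in> pos (S m) n"
  by (simp add: seq_pos_iff)

lemma germ_self: "germ S \<phi> k x k = x"
  by (cases k) simp_all

lemma germ_before: "m < k \<Longrightarrow> germ S \<phi> k x m = \<zero>\<^bsub>S m\<^esub>"
  by (cases m) simp_all

lemma germ_step: "k \<le> m \<Longrightarrow> germ S \<phi> k x (Suc m) = \<phi> m (germ S \<phi> k x m)"
  by simp

declare germ.simps [simp del]

lemma ucp_map_germ: "k \<le> m \<Longrightarrow> ucp_map (S k) (S m) (\<lambda>x. germ S \<phi> k x m)"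
proof (induction m rule: dec_induct)
  case base
  show ?case
    by (simp add: germ_self ucp_map_id)
next
  case (step m)
  then show ?case
    using ucp_map_comp[OF step.IH ucp_map_step] by (simp add: germ_step)
qed

lemma ucp_germ: "k \<le> m \<Longrightarrow> ucp (S k) (S m) (\<lambda>x. germ S \<phi> k x m)"
  using ucp_map_germ system by (intro ucpI) (auto simp: os_inductive_system_def)

lemma germ_closed: "x \<in> carrier (S k) \<Longrightarrow> germ S \<phi> k x \<in> carrier V"
proof -
  assume x: "x \<in> carrier (S k)"
  have "germ S \<phi> k x m \<in> carrier (S m)" for m
    using ucp_map_closed[OF ucp_map_germ x, of m] by (cases "k \<le> m") (auto simp: germ_before)
  moreover have "\<forall>\<^sub>F m in sequentially. germ S \<phi> k x (Suc m) = \<phi> m (germ S \<phi> k x m)"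
    by (rule eventually_sequentiallyI[of k]) (rule germ_step)
  ultimately show ?thesis
    unfolding seq_carrier by blast
qed

lemma coherent_eq_germ:
  assumes "\<And>m. m \<ge> k \<Longrightarrow> f (Suc m) = \<phi> m (f m)" and "m \<ge> k"
  shows "f m = germ S \<phi> k (f k) m"
  using assms(2) by (induction m rule: dec_induct) (simp_all add: germ_self germ_step assms(1))

lemma eventually_germ:
  assumes "f \<in> carrier V"
  shows "\<forall>\<^sub>F k in sequentially. \<forall>m\<ge>k. f m = germ S \<phi> k (f k) m"
proof -
  obtain k where k: "\<And>m. m \<ge> k \<Longrightarrow> f (Suc m) = \<phi> m (f m)"
    using seq_coherent[OF assms] unfolding eventually_sequentially by blast
  have "\<forall>m\<ge>l. f m = germ S \<phi> l (f l) m" if "l \<ge> k" for l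
  proof (intro allI impI coherent_eq_germ)
    show "f (Suc m) = \<phi> m (f m)" if "m \<ge> l" for m
      using k[of m] that \<open>l \<ge> k\<close> by linarith
  qed
  then show ?thesis
    by (rule eventually_sequentiallyI)
qed

lemma mats_eventually:
  assumes X: "X \<in> mats n (carrier V)" and P: "\<And>f. f \<in> carrier V \<Longrightarrow> eventually (P f) F"
  shows "eventually (\<lambda>m. \<forall>i<n. \<forall>j<n. P (X $$ (i, j)) m) F"
proof -
  have "eventually (\<lambda>m. \<forall>i\<in>{..<n}. \<forall>j\<in>{..<n}. P (X $$ (i, j)) m) F"
    using matsD(3)[OF X] P by (auto intro!: eventually_ball_finite)
  then show ?thesis
    by (rule eventually_mono) blast
qed

lemma eventually_germ_mats:
  assumes X: "X \<in> mats n (carrier V)"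
  shows "\<forall>\<^sub>F k in sequentially. \<forall>m\<ge>k. at_index m X = map_mat (\<lambda>x. germ S \<phi> k x m) (at_index k X)"
proof -
  have "\<forall>\<^sub>F k in sequentially. \<forall>i<n. \<forall>j<n. \<forall>m\<ge>k. (X $$ (i, j)) m = germ S \<phi> k ((X $$ (i, j)) k) m"
    by (rule mats_eventually[OF X eventually_germ])
  then show ?thesis
  proof eventually_elim
    case (elim k)
    show ?case
    proof (intro allI impI)
      fix m assume m: "m \<ge> k"
      show "at_index m X = map_mat (\<lambda>x. germ S \<phi> k x m) (at_index k X)"
      proof (rule eq_matI)
        fix i j assume "i < dim_row (map_mat (\<lambda>x. germ S \<phi> k x m) (at_index k X))"
          "j < dim_col (map_mat (\<lambda>x. germ S \<phi> k x m) (at_index k X))"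
        then have ij: "i < n" "j < n"
          using matsD(1,2)[OF X] by simp_all
        then show "at_index m X $$ (i, j) = map_mat (\<lambda>x. germ S \<phi> k x m) (at_index k X) $$ (i, j)"
          using elim[rule_format, OF ij m] matsD(1,2)[OF X] by (simp only: index_map_mat)
      qed simp_all
    qed
  qed
qed

text \<open>Shifts are distributed as for a quotient, but at all large indices at once. Constants
  coming from the order unit must therefore not depend on the index; they are found at one index and
  pushed forward.\<close>

lemma pre_operator_system_V: "pre_operator_system V"
proof (intro pre_operator_system.intro V.unital_star_space_axioms pre_operator_system_axioms.intro)
  show "pos V n \<subseteq> mats n (carrier V)" for n
    by (auto simp: seq_pos_iff)
  show "adj_mats V X = X" if "X \<in> pos V n" for X n
    using that by (simp add: seq_pos_iff)
next
  fix X Y n assume X: "X \<in> pos V n" and Y: "Y \<in> pos V n"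
  have Xc: "X \<in> mats n (carrier V)" and Yc: "Y \<in> mats n (carrier V)"
    using X Y by (simp_all add: seq_pos_iff)
  have "\<forall>\<^sub>F m in sequentially. shift_mats (S m) n r (at_index m (add_mats V X Y)) \<in> pos (S m) n"
    if "r > 0" for r
    using seq_posD[OF X half_gt_zero[OF that]] seq_posD[OF Y half_gt_zero[OF that]]
  proof eventually_elim
    case (elim m)
    have "add_mats (S m) (shift_mats (S m) n (r / 2) (at_index m X)) (shift_mats (S m) n (r / 2) (at_index m Y))
        = shift_mats (S m) n r (at_index m (add_mats V X Y))"
      unfolding ev.map_add[OF Xc Yc]
      using S.add_shift[OF ev.map_closed[OF Xc] ev.map_closed[OF Yc], of m "r / 2" "r / 2"]
      by (simp del: of_real_divide)
    then show ?case
      using S.pos_add[OF elim] by simp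
  qed
  then show "add_mats V X Y \<in> pos V n"
    using X Y Xc Yc unfolding seq_pos_iff by (blast intro: V.mats_closed V.hermitian_add)
next
  fix X n and t :: real assume X: "X \<in> pos V n" and t: "0 \<le> t"
  have Xc: "X \<in> mats n (carrier V)"
    using X by (simp add: seq_pos_iff)
  have "\<forall>\<^sub>F m in sequentially. shift_mats (S m) n r (at_index m (smult_mats V (complex_of_real t) X)) \<in> pos (S m) n"
    if r: "r > 0" for r
  proof (cases "t = 0")
    case True
    have "at_index m (smult_mats V (complex_of_real t) X) = zero_mats (S m) n" for m
      using True matsD[OF Xc] by (intro eq_matI) auto
    then show ?thesis
      using r by (simp add: S.shift_pos S.zero_pos)
  next
    case False
    then have "r / t > 0"
      using r t by simp
    from seq_posD[OF X this] show ?thesis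
    proof eventually_elim
      case (elim m)
      have "smult_mats (S m) (complex_of_real t) (shift_mats (S m) n (r / t) (at_index m X))
          = shift_mats (S m) n r (at_index m (smult_mats V (complex_of_real t) X))"
        unfolding ev.map_smult[OF Xc] using S.smult_shift[OF ev.map_closed[OF Xc], of m t "r / t"] False
        by (simp del: of_real_divide)
      then show ?case
        using S.pos_smult[OF elim t] by simp
    qed
  qed
  then show "smult_mats V (complex_of_real t) X \<in> pos V n"
    using X Xc unfolding seq_pos_iff by (blast intro: V.mats_closed V.hermitian_smult)
next
  fix X n m and A :: "complex mat" assume X: "X \<in> pos V n" and A: "A \<in> carrier_mat n m"
  have Xc: "X \<in> mats n (carrier V)"
    using X by (simp add: seq_pos_iff)
  let ?C = "\<lambda>k. compress_mats (S k) A (unit_mats (S k) n)"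
  obtain s where s: "s > 0" "shift_mats (S 0) m s (smult_mats (S 0) (- 1) (?C 0)) \<in> pos (S 0) m"
    using S.unit_dominates_compress[OF A] by blast
  \<comment> \<open>The same \<open>s\<close> works for all \<open>S k\<close>, because the inequality is pushed forward from \<open>S 0\<close>.\<close>
  have dom: "shift_mats (S k) m s (smult_mats (S k) (- 1) (?C k)) \<in> pos (S k) m" for k
  proof -
    interpret g: ucp "S 0" "S k" "\<lambda>x. germ S \<phi> 0 x k"
      by (rule ucp_germ) simp
    have "?C 0 \<in> mats m (carrier (S 0))"
      using A by (blast intro: S.mats_closed S.unit_mats_closed)
    then show ?thesis
      using g.map_pos[OF s(2)] A by (simp add: g.map_shift g.map_smult S.mats_closed
          g.map_compress[OF S.unit_mats_closed] g.map_unit)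
  qed
  have "\<forall>\<^sub>F k in sequentially. shift_mats (S k) m r (at_index k (compress_mats V A X)) \<in> pos (S k) m"
    if r: "r > 0" for r
  proof -
    have rs: "r / s > 0"
      using r s by simp
    from seq_posD[OF X this] show ?thesis
    proof eventually_elim
      case (elim k)
      have "add_mats (S k) (smult_mats (S k) (complex_of_real (r / s)) (shift_mats (S k) m s (smult_mats (S k) (- 1) (?C k))))
          (compress_mats (S k) A (shift_mats (S k) n (r / s) (at_index k X))) \<in> pos (S k) m"
        by (rule S.pos_add[OF S.pos_smult[OF dom less_imp_le[OF rs]] S.pos_compress[OF elim A]])
      then show ?case
        unfolding ev.map_compress[OF Xc A]
        using s S.shift_compress[OF ev.map_closed[OF Xc] A, of s k r] by simp
    qed
  qed
  \<comment> \<open>This is needed at every index, also where no shift is known to be positive, so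
    it rests on \<open>hermitian_compress\<close> and not on \<open>pos_hermitian\<close>.\<close>
  moreover have "adj_mats V (compress_mats V A X) = compress_mats V A X"
  proof -
    have cX: "compress_mats V A X \<in> mats m (carrier V)"
      using Xc A by (rule V.compress_mats_closed)
    have "adj_mats (S k) (at_index k (compress_mats V A X)) = at_index k (compress_mats V A X)" for k
    proof -
      have "adj_mats (S k) (at_index k X) = at_index k X"
        using X matsD[OF Xc] unfolding seq_pos_iff by (auto simp: mat_eq_iff fun_eq_iff)
      then show ?thesis
        unfolding ev.map_compress[OF Xc A] by (rule S.hermitian_compress[OF ev.map_closed[OF Xc] _ A])
    qed
    then show ?thesis
      using matsD[OF cX] A by (auto simp: mat_eq_iff fun_eq_iff)
  qed
  ultimately show "compress_mats V A X \<in> pos V m"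
    using Xc A unfolding seq_pos_iff by (blast intro: V.mats_closed)
next
  fix X n assume X: "X \<in> mats n (carrier V)" "adj_mats V X = X"
  \<comment> \<open>From \<open>k\<close> on, \<open>X\<close> is the germ of its own term at
    \<open>k\<close>, so a bound \<open>r\<close> found in \<open>S k\<close> stays valid in every
    later \<open>S m\<close>.\<close>
  obtain k where k: "\<And>m. m \<ge> k \<Longrightarrow> at_index m X = map_mat (\<lambda>x. germ S \<phi> k x m) (at_index k X)"
    using eventually_germ_mats[OF X(1)] unfolding eventually_sequentially by blast
  have "adj_mats (S k) (at_index k X) = at_index k X"
    using X(2) matsD[OF X(1)] by (auto simp: mat_eq_iff fun_eq_iff)
  then obtain r where r: "r > 0" "shift_mats (S k) n r (at_index k X) \<in> pos (S k) n"
    using S.matrix_order_unit[OF ev.map_closed[OF X(1)]] by blast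
  have pos: "at_index m (shift_mats V n r X) \<in> pos (S m) n" if m: "m \<ge> k" for m
  proof -
    interpret g: ucp "S k" "S m" "\<lambda>x. germ S \<phi> k x m"
      using m by (rule ucp_germ)
    show ?thesis
      using g.map_pos[OF r(2)] ev.map_closed[OF X(1), of k] k[OF m]
      by (simp add: ev.map_shift[OF X(1)] g.map_shift)
  qed
  have "\<forall>\<^sub>F m in sequentially. shift_mats (S m) n t (at_index m (shift_mats V n r X)) \<in> pos (S m) n"
    if "t > 0" for t
    using that by (intro eventually_sequentiallyI[of k] S.shift_pos pos) auto
  then have "shift_mats V n r X \<in> pos V n"
    using X unfolding seq_pos_iff by (blast intro: V.shift_mats_closed V.hermitian_shift)
  with r(1) show "\<exists>r>0. shift_mats V n r X \<in> pos V n"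
    by blast
next
  fix X n assume X: "X \<in> mats n (carrier V)" and pos: "\<And>r. 0 < r \<Longrightarrow> shift_mats V n r X \<in> pos V n"
  have "adj_mats V (shift_mats V n 1 X) = shift_mats V n 1 X"
    using pos[of 1] unfolding seq_pos_iff by simp
  then have "adj_mats V X = X"
    by (rule V.hermitian_shift_cancel[OF X])
  moreover have "\<forall>\<^sub>F m in sequentially. shift_mats (S m) n r (at_index m X) \<in> pos (S m) n" if "r > 0" for r
    using seq_posD[OF pos[OF half_gt_zero[OF that]] half_gt_zero[OF that]]
  proof eventually_elim
    case (elim m)
    then show ?case
      unfolding ev.map_shift[OF X] S.shift_shift[OF ev.map_closed[OF X]] by simp
  qed
  ultimately show "X \<in> pos V n"
    using X unfolding seq_pos_iff by blast
qed

sublocale V: pre_operator_system V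
  by (rule pre_operator_system_V)

text \<open>The right side says that the norms of the terms \<open>f m\<close> tend to 0.\<close>

lemma null_seq_iff: "null_elem V f \<longleftrightarrow> f \<in> carrier V \<and>
    (\<forall>r>0. \<forall>\<^sub>F m in sequentially. block_mat (S m) r (f m) \<in> pos (S m) 2)"
proof (cases "f \<in> carrier V")
  case True
  have "at_index m (block_mat V 0 f) = block_mat (S m) 0 (f m)" for m
    by (rule eq_matI) auto
  moreover have "adj_mats V (block_mat V 0 f) = block_mat V 0 f"
    using True by (intro eq_matI) (auto simp: seq_unit_closed)
  ultimately show ?thesis
    using True V.block_mat_closed[OF True] by (simp add: null_elem_def seq_pos_iff S.shift_block)
qed (simp add: null_elem_def)

lemma seq_minus: "f \<in> carrier V \<Longrightarrow> g \<in> carrier V \<Longrightarrow> (f \<ominus>\<^bsub>V\<^esub> g) m = f m \<ominus>\<^bsub>S m\<^esub> g m"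
  using ev.minus[of g m] by (simp add: a_minus_def)

lemma null_minus_if_eventually_eq:
  assumes "f \<in> carrier V" "g \<in> carrier V" "\<forall>\<^sub>F m in sequentially. f m = g m"
  shows "null_elem V (f \<ominus>\<^bsub>V\<^esub> g)"
  unfolding null_seq_iff
proof (intro conjI allI impI)
  show "f \<ominus>\<^bsub>V\<^esub> g \<in> carrier V"
    using assms by (simp add: V.M.minus_closed del: seq_ops)
  fix r :: real assume r: "r > 0"
  show "\<forall>\<^sub>F m in sequentially. block_mat (S m) r ((f \<ominus>\<^bsub>V\<^esub> g) m) \<in> pos (S m) 2"
    using assms(3)
  proof eventually_elim
    case (elim m)
    have "(f \<ominus>\<^bsub>V\<^esub> g) m = \<zero>\<^bsub>S m\<^esub>"
      unfolding seq_minus[OF assms(1,2)] elim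
      using seq_closed[OF assms(2)] by (simp only: a_minus_def S.M.r_neg)
    moreover have "block_mat (S m) 0 \<zero>\<^bsub>S m\<^esub> \<in> pos (S m) 2"
      using S.null_zero unfolding null_elem_def by blast
    ultimately show ?case
      using S.block_mono[OF _ S.M.zero_closed less_imp_le[OF r]] by (simp only:)
  qed
qed

end

section \<open>Inductive limits\<close>

lemma cocone_germ:
  assumes "os_inductive_system S \<phi>" "os_cocone S \<phi> T \<theta>" "k \<le> m" "x \<in> carrier (S k)"
  shows "\<theta> m (germ S \<phi> k x m) = \<theta> k x"
proof -
  interpret inductive_system S \<phi>
    by unfold_locales fact
  show ?thesis
    using assms(3)
  proof (induction m rule: dec_induct)
    case (step m)
    then show ?case
      using assms(2) seq_closed[OF germ_closed[OF assms(4)], of m]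
      by (simp add: germ_step os_cocone_def)
  qed (simp add: germ_self)
qed

section \<open>Germs, classes of sequences and maps induced by cocones\<close>

context inductive_system
begin

lemma germ_add:
  assumes "x \<in> carrier (S k)" "y \<in> carrier (S k)"
  shows "germ S \<phi> k (x \<oplus>\<^bsub>S k\<^esub> y) = germ S \<phi> k x \<oplus>\<^bsub>V\<^esub> germ S \<phi> k y"
proof
  fix m
  show "germ S \<phi> k (x \<oplus>\<^bsub>S k\<^esub> y) m = (germ S \<phi> k x \<oplus>\<^bsub>V\<^esub> germ S \<phi> k y) m"
  proof (cases "k \<le> m")
    case True
    interpret ucp "S k" "S m" "\<lambda>x. germ S \<phi> k x m"
      using True by (rule ucp_germ)
    show ?thesis
      using assms add by simp
  qed (simp add: germ_before)
qed

lemma germ_smult: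
  assumes "x \<in> carrier (S k)"
  shows "germ S \<phi> k (c \<odot>\<^bsub>S k\<^esub> x) = c \<odot>\<^bsub>V\<^esub> germ S \<phi> k x"
proof
  fix m
  show "germ S \<phi> k (c \<odot>\<^bsub>S k\<^esub> x) m = (c \<odot>\<^bsub>V\<^esub> germ S \<phi> k x) m"
  proof (cases "k \<le> m")
    case True
    interpret ucp "S k" "S m" "\<lambda>x. germ S \<phi> k x m"
      using True by (rule ucp_germ)
    show ?thesis
      using assms scale by simp
  qed (simp add: germ_before)
qed

lemma germ_pos:
  assumes X: "X \<in> pos (S k) n"
  shows "map_mat (germ S \<phi> k) X \<in> pos V n"
  unfolding seq_pos_iff
proof (intro conjI allI impI)
  let ?Y = "map_mat (germ S \<phi> k) X"
  note Xc = S.pos_closed[OF X]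
  show Y: "?Y \<in> mats n (carrier V)"
    using Xc by (auto simp: mats_iff germ_closed)
  have pos: "at_index m ?Y \<in> pos (S m) n" for m
  proof (cases "k \<le> m")
    case True
    interpret ucp "S k" "S m" "\<lambda>x. germ S \<phi> k x m"
      using True by (rule ucp_germ)
    have "at_index m ?Y = map_mat (\<lambda>x. germ S \<phi> k x m) X"
      by (rule eq_matI) auto
    then show ?thesis
      using map_pos[OF X] by simp
  next
    case False
    then have "at_index m ?Y = zero_mats (S m) n"
      using matsD[OF Xc] by (intro eq_matI) (auto simp: germ_before)
    then show ?thesis
      by (simp add: S.zero_pos)
  qed
  show "adj_mats V ?Y = ?Y"
  proof (rule V.hermitianI[OF Y])
    fix i j assume ij: "i < n" "j < n"
    have "adj (S m) (at_index m ?Y $$ (i, j)) = at_index m ?Y $$ (j, i)" for m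
      using S.hermitianD[OF S.pos_hermitian[OF pos] S.pos_closed[OF pos] ij] .
    then show "adj V (?Y $$ (i, j)) = ?Y $$ (j, i)"
      using ij matsD(1,2)[OF Xc] by auto
  qed
  show "\<forall>\<^sub>F m in sequentially. shift_mats (S m) n r (at_index m ?Y) \<in> pos (S m) n" if "r > 0" for r
    using that by (intro always_eventually allI S.shift_pos pos) simp
qed

text \<open>
  The class of a sequence modulo null sequences is encoded by the pairs \<open>(k, x)\<close> whose germ
  represents it, so that the limit lives in the type over which the universal property quantifies.
\<close>

definition seq_class :: "(nat \<Rightarrow> 'a) \<Rightarrow> (nat \<times> 'a + 'b) set" where
  "seq_class f = Inl ` {(k, x). x \<in> carrier (S k) \<and> null_elem V (f \<ominus>\<^bsub>V\<^esub> germ S \<phi> k x)}"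

lemma eventually_eq_germ:
  assumes "f \<in> carrier V"
  shows "\<forall>\<^sub>F k in sequentially. \<forall>\<^sub>F m in sequentially. f m = germ S \<phi> k (f k) m"
  using eventually_germ[OF assms]
  by (rule eventually_mono) (blast intro: eventually_sequentiallyI)

text \<open>A sequence agrees from some index on with the germ of one of its own terms, so germs
  represent all classes.\<close>

lemma ex_germ:
  assumes "f \<in> carrier V"
  obtains k where "\<forall>\<^sub>F m in sequentially. f m = germ S \<phi> k (f k) m"
  using eventually_happens[OF eventually_eq_germ[OF assms]] by auto

text \<open>The encoding set is never empty, because some germ agrees with \<open>f\<close>
  eventually. Hence equal sets share a germ, which differs from both sequences by a null
  one.\<close>

lemma seq_class_eq_iff:
  assumes f: "f \<in> carrier V" and g: "g \<in> carrier V"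
  shows "(seq_class f :: (nat \<times> 'a + 'b) set) = seq_class g \<longleftrightarrow> null_elem V (f \<ominus>\<^bsub>V\<^esub> g)"
proof
  assume eq: "(seq_class f :: (nat \<times> 'a + 'b) set) = seq_class g"
  obtain k where k: "\<forall>\<^sub>F m in sequentially. f m = germ S \<phi> k (f k) m"
    using ex_germ[OF f] .
  have h: "germ S \<phi> k (f k) \<in> carrier V"
    using f by (simp add: germ_closed)
  have fh: "null_elem V (f \<ominus>\<^bsub>V\<^esub> germ S \<phi> k (f k))"
    using f h k by (rule null_minus_if_eventually_eq)
  then have "Inl (k, f k) \<in> (seq_class f :: (nat \<times> 'a + 'b) set)"
    using f by (simp add: seq_class_def image_iff)
  then have "Inl (k, f k) \<in> (seq_class g :: (nat \<times> 'a + 'b) set)"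
    unfolding eq .
  then have "null_elem V (g \<ominus>\<^bsub>V\<^esub> germ S \<phi> k (f k))"
    by (auto simp: seq_class_def)
  then show "null_elem V (f \<ominus>\<^bsub>V\<^esub> g)"
    using V.null_minus_trans[OF f h g fh] V.null_minus_sym[OF g h] by blast
next
  assume fg: "null_elem V (f \<ominus>\<^bsub>V\<^esub> g)"
  have "null_elem V (f \<ominus>\<^bsub>V\<^esub> h) \<longleftrightarrow> null_elem V (g \<ominus>\<^bsub>V\<^esub> h)" if h: "h \<in> carrier V" for h
    using V.null_minus_trans[OF f g h fg] V.null_minus_trans[OF g f h V.null_minus_sym[OF f g fg]]
    by blast
  then have "x \<in> carrier (S k) \<and> null_elem V (f \<ominus>\<^bsub>V\<^esub> germ S \<phi> k x) \<longleftrightarrow>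
      x \<in> carrier (S k) \<and> null_elem V (g \<ominus>\<^bsub>V\<^esub> germ S \<phi> k x)" for k x
    using germ_closed by blast
  then show "(seq_class f :: (nat \<times> 'a + 'b) set) = seq_class g"
    unfolding seq_class_def by (simp only:)
qed

text \<open>Along a coherent tail \<open>\<theta> m (f m)\<close> is constant, and
  \<open>w f\<close> is this value. Identities for \<open>w\<close> are read off at a late index;
  positivity holds there up to a shift, which the Archimedean axiom of \<open>T\<close> removes. A
  null sequence is sent to a null element of \<open>T\<close>, hence to 0.\<close>

lemma ucp_map_on_sequences:
  assumes cocone: "os_cocone S \<phi> T \<theta>"
  obtains w where "ucp_map V T w" "\<And>f. null_elem V f \<Longrightarrow> w f = \<zero>\<^bsub>T\<^esub>"
    "\<And>k x. x \<in> carrier (S k) \<Longrightarrow> w (germ S \<phi> k x) = \<theta> k x"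
proof -
  have T: "operator_system T" and \<theta>: "\<And>k. ucp_map (S k) T (\<theta> k)"
    using cocone by (auto simp: os_cocone_def)
  interpret T: pre_operator_system T
    using T by (rule pre_operator_system)
  interpret \<theta>: ucp "S k" T "\<theta> k" for k
    using \<theta> by (intro ucp.intro S.pre_operator_system_axioms T.pre_operator_system_axioms ucp_axioms.intro)
  \<comment> \<open>The chosen index is one from which \<open>f\<close> follows the connecting maps;
    the value does not depend on the choice.\<close>
  define w where "w f = (let k = SOME k. \<forall>m\<ge>k. f m = germ S \<phi> k (f k) m in \<theta> k (f k))" for f
  have w: "\<forall>\<^sub>F m in sequentially. w f = \<theta> m (f m)" if f: "f \<in> carrier V" for f
  proof -
    define k where "k = (SOME k. \<forall>m\<ge>k. f m = germ S \<phi> k (f k) m)"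
    have "\<exists>k. \<forall>m\<ge>k. f m = germ S \<phi> k (f k) m"
      using eventually_germ[OF f] unfolding eventually_sequentially by blast
    then have k: "\<forall>m\<ge>k. f m = germ S \<phi> k (f k) m"
      unfolding k_def by (rule someI_ex)
    have "w f = \<theta> m (f m)" if "m \<ge> k" for m
    proof -
      have "\<theta> m (germ S \<phi> k (f k) m) = \<theta> k (f k)"
        using f by (intro cocone_germ[OF system cocone that]) simp
      moreover have "germ S \<phi> k (f k) m = f m"
        using k that by metis
      moreover have "w f = \<theta> k (f k)"
        unfolding w_def Let_def k_def ..
      ultimately show ?thesis
        by metis
    qed
    then show ?thesis
      by (rule eventually_sequentiallyI)
  qed
  have w_germ: "w (germ S \<phi> k x) = \<theta> k x" if x: "x \<in> carrier (S k)" for k x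
  proof -
    have "\<forall>\<^sub>F m in sequentially. m \<ge> k"
      by (rule eventually_ge_at_top)
    with w[OF germ_closed[OF x]]
    have "\<forall>\<^sub>F m in sequentially. w (germ S \<phi> k x) = \<theta> k x"
      by eventually_elim (simp add: cocone_germ[OF system cocone _ x])
    then show ?thesis
      by simp
  qed
  have ucp: "ucp_map V T w"
    unfolding ucp_map_def
  proof (intro conjI allI ballI Pi_I)
    fix f assume f: "f \<in> carrier V"
    have "\<forall>\<^sub>F m in sequentially. w f \<in> carrier T"
      using w[OF f] by eventually_elim (simp add: f)
    then show "w f \<in> carrier T"
      by simp
    show "w (c \<odot>\<^bsub>V\<^esub> f) = c \<odot>\<^bsub>T\<^esub> w f" for c
    proof -
      have "\<forall>\<^sub>F m in sequentially. w (c \<odot>\<^bsub>V\<^esub> f) = c \<odot>\<^bsub>T\<^esub> w f"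
        using w[OF f] w[OF V.scale_closed[OF f]] by eventually_elim (simp add: f)
      then show ?thesis
        by simp
    qed
    fix g assume g: "g \<in> carrier V"
    have "\<forall>\<^sub>F m in sequentially. w (f \<oplus>\<^bsub>V\<^esub> g) = w f \<oplus>\<^bsub>T\<^esub> w g"
      using w[OF f] w[OF g] w[OF V.M.a_closed[OF f g]] by eventually_elim (simp add: f g)
    then show "w (f \<oplus>\<^bsub>V\<^esub> g) = w f \<oplus>\<^bsub>T\<^esub> w g"
      by simp
  next
    have "\<forall>\<^sub>F m in sequentially. w (order_unit V) = order_unit T"
      using w[OF V.order_unit_closed] by eventually_elim simp
    then show "w (order_unit V) = order_unit T"
      by simp
  next
    fix X n assume X: "X \<in> pos V n"
    note Xc = V.pos_closed[OF X]
    have wX: "\<forall>\<^sub>F m in sequentially. map_mat w X = map_mat (\<theta> m) (at_index m X)"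
    proof -
      have "\<forall>\<^sub>F m in sequentially. \<forall>i<n. \<forall>j<n. w (X $$ (i, j)) = \<theta> m ((X $$ (i, j)) m)"
        using Xc w by (rule mats_eventually)
      then show ?thesis
        by eventually_elim (use matsD(1,2)[OF Xc] in \<open>auto intro!: eq_matI\<close>)
    qed
    show "map_mat w X \<in> pos T n"
    proof (rule T.archimedean)
      have "\<forall>\<^sub>F m in sequentially. map_mat w X \<in> mats n (carrier T)"
        using wX by eventually_elim (simp add: \<theta>.map_closed[OF ev.map_closed[OF Xc]])
      then show "map_mat w X \<in> mats n (carrier T)"
        by simp
      fix r :: real assume "r > 0"
      from wX seq_posD[OF X this]
      have "\<forall>\<^sub>F m in sequentially. shift_mats T n r (map_mat w X) \<in> pos T n"
      proof eventually_elim
        case (elim m)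
        then show ?case
          using \<theta>.map_pos[OF elim(2)] by (simp only: \<theta>.map_shift[OF ev.map_closed[OF Xc]])
      qed
      then show "shift_mats T n r (map_mat w X) \<in> pos T n"
        by simp
    qed
  qed
  have "w f = \<zero>\<^bsub>T\<^esub>" if f: "null_elem V f" for f
  proof (rule operator_system_null[OF T T.null_elemI])
    have fc: "f \<in> carrier V"
      using f by (rule V.null_closed)
    then show "w f \<in> carrier T"
      by (rule ucp_map_closed[OF ucp])
    fix t :: real assume "t > 0"
    then have "\<forall>\<^sub>F m in sequentially. block_mat (S m) t (f m) \<in> pos (S m) 2"
      using f unfolding null_seq_iff by blast
    with w[OF fc] have "\<forall>\<^sub>F m in sequentially. block_mat T t (w f) \<in> pos T 2"
    proof eventually_elim
      case (elim m)
      then show ?case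
        using \<theta>.block_pos[OF seq_closed[OF fc] elim(2)] by (simp only:)
    qed
    then show "block_mat T t (w f) \<in> pos T 2"
      by simp
  qed
  then show ?thesis
    using that[OF ucp _ w_germ] by blast
qed

end

text \<open>Only the fibres of \<open>cls\<close> enter, so the limit can be built without looking
  at the encoding of classes.\<close>

locale sequence_quotient = inductive_system S \<phi>
  for S :: "nat \<Rightarrow> 'a opsys" and \<phi> +
  fixes cls :: "(nat \<Rightarrow> 'a) \<Rightarrow> 't"
  assumes cls_eq_iff: "\<lbrakk>f \<in> carrier V; g \<in> carrier V\<rbrakk> \<Longrightarrow> cls f = cls g \<longleftrightarrow> null_elem V (f \<ominus>\<^bsub>V\<^esub> g)"
begin

lemma cls_eqI:
  assumes "f \<in> carrier V" "g \<in> carrier V" "\<forall>\<^sub>F m in sequentially. f m = g m"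
  shows "cls f = cls g"
  using null_minus_if_eventually_eq[OF assms] assms by (simp add: cls_eq_iff)

abbreviation std_limit :: "'t opsys" where
  "std_limit \<equiv> image_opsys V cls"

lemma std_limit:
  shows os_surjection_std_limit: "os_surjection V std_limit cls"
    and operator_system_std_limit: "operator_system std_limit"
  by (rule image_opsys[OF pre_operator_system_V cls_eq_iff]; assumption)+

lemma cls_null_iff:
  assumes "f \<in> carrier V"
  shows "cls f = \<zero>\<^bsub>std_limit\<^esub> \<longleftrightarrow> null_elem V f"
proof -
  have "cls f = cls \<zero>\<^bsub>V\<^esub> \<longleftrightarrow> null_elem V (f \<ominus>\<^bsub>V\<^esub> \<zero>\<^bsub>V\<^esub>)"
    using assms V.M.zero_closed by (rule cls_eq_iff)
  moreover have "f \<ominus>\<^bsub>V\<^esub> \<zero>\<^bsub>V\<^esub> = f"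
    using assms by (simp only: a_minus_def V.neg_zero V.M.r_zero)
  ultimately show ?thesis
    by (simp only: os_surjection.q_zero[OF os_surjection_std_limit])
qed

lemma cocone_std_limit: "os_cocone S \<phi> std_limit (\<lambda>k x. cls (germ S \<phi> k x))"
  unfolding os_cocone_def
proof (intro conjI allI ballI)
  show "operator_system std_limit"
    by (rule operator_system_std_limit)
  interpret q: os_surjection V std_limit cls
    by (rule os_surjection_std_limit)
  fix k
  show "ucp_map (S k) std_limit (\<lambda>x. cls (germ S \<phi> k x))"
    unfolding ucp_map_def
  proof (intro conjI allI ballI Pi_I)
    fix x assume x: "x \<in> carrier (S k)"
    show "cls (germ S \<phi> k x) \<in> carrier std_limit"
      by (rule q.closed[OF germ_closed[OF x]])
    show "cls (germ S \<phi> k (c \<odot>\<^bsub>S k\<^esub> x)) = c \<odot>\<^bsub>std_limit\<^esub> cls (germ S \<phi> k x)" for c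
      unfolding germ_smult[OF x] by (rule q.q_smult[OF germ_closed[OF x]])
    fix y assume y: "y \<in> carrier (S k)"
    show "cls (germ S \<phi> k (x \<oplus>\<^bsub>S k\<^esub> y)) =
        cls (germ S \<phi> k x) \<oplus>\<^bsub>std_limit\<^esub> cls (germ S \<phi> k y)"
      unfolding germ_add[OF x y] by (rule q.q_add[OF germ_closed[OF x] germ_closed[OF y]])
  next
    \<comment> \<open>Below \<open>k\<close> the germ of the unit is 0, so \<open>germ\<close>
      itself is not unital for \<open>k > 0\<close>; it becomes unital after passing to
      classes.\<close>
    have "germ S \<phi> k (order_unit (S k)) m = order_unit V m" if "k \<le> m" for m
      using ucp_map_germ[OF that] by (simp add: ucp_map_def)
    then have "\<forall>\<^sub>F m in sequentially. germ S \<phi> k (order_unit (S k)) m = order_unit V m"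
      by (rule eventually_sequentiallyI)
    then show "cls (germ S \<phi> k (order_unit (S k))) = order_unit std_limit"
      unfolding q.q_unit[symmetric]
      by (intro cls_eqI germ_closed S.order_unit_closed V.order_unit_closed)
  next
    fix X n assume X: "X \<in> pos (S k) n"
    have "map_mat (\<lambda>x. cls (germ S \<phi> k x)) X = map_mat cls (map_mat (germ S \<phi> k) X)"
      by (rule eq_matI) auto
    then show "map_mat (\<lambda>x. cls (germ S \<phi> k x)) X \<in> pos std_limit n"
      using q.map_pos[OF germ_pos[OF X]] by (simp only:)
  qed
  fix x assume x: "x \<in> carrier (S k)"
  \<comment> \<open>Below index \<open>k\<close> both germs are padded with zeros; at
    \<open>k\<close> itself the left one has \<open>x\<close> and the right one 0.\<close>
  have "germ S \<phi> k x m = germ S \<phi> (Suc k) (\<phi> k x) m" if "m \<ge> Suc k" for m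
    using coherent_eq_germ[of "Suc k" "germ S \<phi> k x" m] that germ_step[of k k x]
    by (simp add: germ_step germ_self)
  then have "\<forall>\<^sub>F m in sequentially. germ S \<phi> (Suc k) (\<phi> k x) m = germ S \<phi> k x m"
    by (intro eventually_sequentiallyI[of "Suc k"]) metis
  then show "cls (germ S \<phi> (Suc k) (\<phi> k x)) = cls (germ S \<phi> k x)"
    using x by (intro cls_eqI germ_closed) auto
qed

text \<open>\<open>T\<close> may live on any type: the map that the cocone induces on sequences
  kills null sequences, so it factors through the classes.\<close>

lemma std_limit_universal:
  assumes "os_cocone S \<phi> T \<theta>"
  obtains g where "ucp_map std_limit T g"
    "\<And>k x. x \<in> carrier (S k) \<Longrightarrow> g (cls (germ S \<phi> k x)) = \<theta> k x"
proof -
  have T: "pre_operator_system T"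
    using assms by (simp add: os_cocone_def pre_operator_system)
  obtain w where w: "ucp_map V T w" "\<And>f. null_elem V f \<Longrightarrow> w f = \<zero>\<^bsub>T\<^esub>"
    "\<And>k x. x \<in> carrier (S k) \<Longrightarrow> w (germ S \<phi> k x) = \<theta> k x"
    using ucp_map_on_sequences[OF assms] by blast
  obtain g where g: "ucp_map std_limit T g"
    "\<And>f. f \<in> carrier V \<Longrightarrow> g (cls f) = w f"
    using os_surjection.factor[OF os_surjection_std_limit T w(1)] cls_null_iff w(2) by metis
  then show ?thesis
    using that[OF g(1)] w(3) germ_closed by metis
qed

lemma std_limit_elem:
  assumes "a \<in> carrier std_limit"
  obtains k x where "x \<in> carrier (S k)" "a = cls (germ S \<phi> k x)"
proof -
  obtain f where f: "f \<in> carrier V" "a = cls f"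
    using assms by (auto simp: os_surjection.carrier_Q[OF os_surjection_std_limit])
  obtain k where "\<forall>\<^sub>F m in sequentially. f m = germ S \<phi> k (f k) m"
    using ex_germ[OF f(1)] .
  then have "cls f = cls (germ S \<phi> k (f k))"
    using f(1) by (intro cls_eqI germ_closed) auto
  then show ?thesis
    using that[of "f k" k] f by simp
qed

end

section \<open>An abstract limit compared with the standard model\<close>

lemma os_cocone_comp:
  assumes "os_cocone S \<phi> T \<theta>" "operator_system U" "ucp_map T U g"
  shows "os_cocone S \<phi> U (\<lambda>k x. g (\<theta> k x))"
  using assms by (auto simp: os_cocone_def intro: ucp_map_comp)

locale os_limit = inductive_system S \<phi>
  for S :: "nat \<Rightarrow> 'a opsys" and \<phi> +
  fixes L :: "'b opsys" and \<eta> :: "nat \<Rightarrow> 'a \<Rightarrow> 'b"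
  assumes limit: "os_inductive_limit S \<phi> L \<eta>"
begin

sublocale sequence_quotient S \<phi> "seq_class :: (nat \<Rightarrow> 'a) \<Rightarrow> (nat \<times> 'a + 'b) set"
  by unfold_locales (rule seq_class_eq_iff)

lemma cocone: "os_cocone S \<phi> L \<eta>"
  using limit by (simp add: os_inductive_limit_def)

lemma operator_system_L: "operator_system L"
  using cocone by (simp add: os_cocone_def)

lemma ucp_map_to_limit: "ucp_map (S k) L (\<eta> k)"
  using cocone by (simp add: os_cocone_def)

lemma limit_closed: "x \<in> carrier (S k) \<Longrightarrow> \<eta> k x \<in> carrier L"
  by (rule ucp_map_closed[OF ucp_map_to_limit])

lemma limit_germ: "\<lbrakk>k \<le> m; x \<in> carrier (S k)\<rbrakk> \<Longrightarrow> \<eta> m (germ S \<phi> k x m) = \<eta> k x"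
  by (rule cocone_germ[OF system cocone])

text \<open>Uniqueness is applied to a copy of \<open>L\<close> whose elements are singletons.\<close>

lemma ucp_map_limit_eq_id:
  assumes h: "ucp_map L L h" and h_eta: "\<And>k x. x \<in> carrier (S k) \<Longrightarrow> h (\<eta> k x) = \<eta> k x"
    and x: "x \<in> carrier L"
  shows "h x = x"
proof -
  interpret L: pre_operator_system L
    by (rule pre_operator_system[OF operator_system_L])
  let ?c = "\<lambda>x. {Inr x} :: (nat \<times> 'a + 'b) set"
  let ?C = "image_opsys L ?c"
  have eq: "?c x = ?c y \<longleftrightarrow> null_elem L (x \<ominus>\<^bsub>L\<^esub> y)" if xy: "x \<in> carrier L" "y \<in> carrier L" for x y
  proof
    assume "?c x = ?c y"
    then show "null_elem L (x \<ominus>\<^bsub>L\<^esub> y)"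
      using xy by (simp add: a_minus_def L.M.r_neg L.null_zero)
  next
    assume "null_elem L (x \<ominus>\<^bsub>L\<^esub> y)"
    then have "x \<oplus>\<^bsub>L\<^esub> \<ominus>\<^bsub>L\<^esub> y = \<zero>\<^bsub>L\<^esub>"
      using operator_system_null[OF operator_system_L] by (simp add: a_minus_def)
    then show "?c x = ?c y"
      using xy L.M.minus_equality[of x "\<ominus>\<^bsub>L\<^esub> y"] by (simp add: L.M.minus_minus)
  qed
  have C: "operator_system ?C" and c: "ucp_map L ?C ?c"
    using image_opsys[OF L.pre_operator_system_axioms eq] os_surjection.ucp_map_q by blast+
  \<comment> \<open>Uniqueness is granted among extensional maps, so the two competitors, the
    copying map and its composite with \<open>h\<close>, are restricted to the carrier.\<close>
  let ?res = "\<lambda>f. restrict f (carrier L)"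
  have ucp_res: "ucp_map L ?C (?res f)" if "ucp_map L ?C f" for f
    by (rule ucp_map_cong[OF operator_system_L that]) simp
  have "\<exists>!u. u \<in> extensional (carrier L) \<and> ucp_map L ?C u \<and>
      (\<forall>k. \<forall>x\<in>carrier (S k). u (\<eta> k x) = ?c (\<eta> k x))"
    using limit os_cocone_comp[OF cocone C c] unfolding os_inductive_limit_def by blast
  moreover have "?res ?c \<in> extensional (carrier L) \<and> ucp_map L ?C (?res ?c) \<and>
      (\<forall>k. \<forall>x\<in>carrier (S k). ?res ?c (\<eta> k x) = ?c (\<eta> k x))"
    using ucp_res[OF c] limit_closed by simp
  moreover have "?res (\<lambda>x. ?c (h x)) \<in> extensional (carrier L) \<and> ucp_map L ?C (?res (\<lambda>x. ?c (h x))) \<and>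
      (\<forall>k. \<forall>x\<in>carrier (S k). ?res (\<lambda>x. ?c (h x)) (\<eta> k x) = ?c (\<eta> k x))"
    using ucp_res[OF ucp_map_comp[OF h c]] limit_closed h_eta by simp
  ultimately have "?res ?c = ?res (\<lambda>x. ?c (h x))"
    by blast
  then have "?res ?c x = ?res (\<lambda>x. ?c (h x)) x"
    by simp
  then show ?thesis
    using x by simp
qed

text \<open>\<open>u\<close> exists because the test type of the limit contains the classes of
  sequences, \<open>v\<close> because the standard model is universal on all types. The composite
  fixes every \<open>\<eta> k x\<close>, so uniqueness makes it the identity of
  \<open>L\<close>.\<close>

lemma limit_iso_std_limit:
  obtains u v where
    "ucp_map L std_limit u" "ucp_map std_limit L v"
    "\<And>k x. x \<in> carrier (S k) \<Longrightarrow> u (\<eta> k x) = seq_class (germ S \<phi> k x)"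
    "\<And>k x. x \<in> carrier (S k) \<Longrightarrow> v (seq_class (germ S \<phi> k x)) = \<eta> k x"
    "\<And>x. x \<in> carrier L \<Longrightarrow> v (u x) = x"
proof -
  obtain u where u: "ucp_map L std_limit u"
    "\<And>k x. x \<in> carrier (S k) \<Longrightarrow> u (\<eta> k x) = seq_class (germ S \<phi> k x)"
    using limit cocone_std_limit unfolding os_inductive_limit_def by blast
  obtain v where v: "ucp_map std_limit L v"
    "\<And>k x. x \<in> carrier (S k) \<Longrightarrow> v (seq_class (germ S \<phi> k x)) = \<eta> k x"
    using std_limit_universal[OF cocone] by blast
  have "v (u (\<eta> k x)) = \<eta> k x" if "x \<in> carrier (S k)" for k x
    using that by (simp only: u(2) v(2))
  then have "v (u x) = x" if "x \<in> carrier L" for x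
    using ucp_map_limit_eq_id[OF ucp_map_comp[OF u(1) v(1)]] that by blast
  then show ?thesis
    using that[OF u(1) v(1) u(2) v(2)] by blast
qed

text \<open>\<open>a\<close> equals \<open>v (u a)\<close>, and \<open>u a\<close> is the class of a
  germ.\<close>

lemma limit_elem:
  assumes "a \<in> carrier L"
  obtains k x where "x \<in> carrier (S k)" "a = \<eta> k x"
proof -
  obtain u v where uv:
    "ucp_map L std_limit u"
    "\<And>k x. x \<in> carrier (S k) \<Longrightarrow> v (seq_class (germ S \<phi> k x)) = \<eta> k x"
    "\<And>x. x \<in> carrier L \<Longrightarrow> v (u x) = x"
    using limit_iso_std_limit by metis
  obtain k x where "x \<in> carrier (S k)" "u a = seq_class (germ S \<phi> k x)"
    using std_limit_elem[OF ucp_map_closed[OF uv(1) assms]] .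
  then show ?thesis
    using that uv(2,3) assms by metis
qed

text \<open>Passing through the standard model trades the fixed test type for an arbitrary
  one.\<close>

lemma limit_universal:
  assumes "os_cocone S \<phi> T \<theta>"
  obtains g where "ucp_map L T g" "\<And>k x. x \<in> carrier (S k) \<Longrightarrow> g (\<eta> k x) = \<theta> k x"
proof -
  obtain u where u: "ucp_map L std_limit u"
    "\<And>k x. x \<in> carrier (S k) \<Longrightarrow> u (\<eta> k x) = seq_class (germ S \<phi> k x)"
    using limit_iso_std_limit by metis
  obtain g where g: "ucp_map std_limit T g"
    "\<And>k x. x \<in> carrier (S k) \<Longrightarrow> g (seq_class (germ S \<phi> k x)) = \<theta> k x"
    using std_limit_universal[OF assms] by blast
  show ?thesis
    by (rule that[OF ucp_map_comp[OF u(1) g(1)]]) (simp only: u(2) g(2))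
qed

text \<open>\<open>u\<close> sends \<open>\<eta> k x\<close> to the class of the germ of
  \<open>x\<close>, and a class vanishes only for null sequences.\<close>

lemma limit_zeroD:
  assumes x: "x \<in> carrier (S k)" and "\<eta> k x = \<zero>\<^bsub>L\<^esub>" and "r > 0"
  shows "\<forall>\<^sub>F m in sequentially. block_mat (S m) r (germ S \<phi> k x m) \<in> pos (S m) 2"
proof -
  obtain u where u: "ucp_map L std_limit u"
    "\<And>k x. x \<in> carrier (S k) \<Longrightarrow> u (\<eta> k x) = seq_class (germ S \<phi> k x)"
    using limit_iso_std_limit by metis
  interpret u: ucp L std_limit u
    by (rule ucpI[OF operator_system_L operator_system_std_limit u(1)])
  have "seq_class (germ S \<phi> k x) = \<zero>\<^bsub>std_limit\<^esub>"
    using u(2)[OF x] u.zero assms(2) by simp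
  then have "null_elem V (germ S \<phi> k x)"
    unfolding cls_null_iff[OF germ_closed[OF x]] .
  with \<open>r > 0\<close> show ?thesis
    unfolding null_seq_iff by blast
qed

end

section \<open>Kernels and quotients of inductive limits\<close>

context pre_operator_system
begin

lemma os_norm_single:
  assumes "x \<in> carrier S"
  shows "os_norm S 1 (mat 1 1 (\<lambda>_. x)) = Inf {t. 0 < t \<and> block_mat S t x \<in> pos S 2}"
proof -
  have "four_block_mat (smult_mats S (complex_of_real t) (unit_mats S 1)) (mat 1 1 (\<lambda>_. x))
      (adj_mats S (mat 1 1 (\<lambda>_. x))) (smult_mats S (complex_of_real t) (unit_mats S 1))
      = block_mat S t x" for t
    by (rule eq_matI) (auto simp: four_block_mat_def Let_def less_2_cases_iff)
  then show ?thesis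
    unfolding os_norm_def by (simp only: one_add_one)
qed

lemma os_norm_le:
  assumes "x \<in> carrier S" "0 < t" "block_mat S t x \<in> pos S 2"
  shows "os_norm S 1 (mat 1 1 (\<lambda>_. x)) \<le> t"
  unfolding os_norm_single[OF assms(1)]
  using assms(2,3) by (intro cInf_lower) (auto intro!: bdd_belowI[of _ 0])

text \<open>An infimum over an empty set of reals would carry no information; the order unit
  property for the block matrix with zero diagonal supplies an admissible \<open>t\<close>.\<close>

lemma os_norm_lessD:
  assumes x: "x \<in> carrier S" and less: "os_norm S 1 (mat 1 1 (\<lambda>_. x)) < \<epsilon>"
  obtains t where "0 < t" "t < \<epsilon>" "block_mat S t x \<in> pos S 2"
proof -
  have "adj_mats S (block_mat S 0 x) = block_mat S 0 x"
    using x by (intro eq_matI) auto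
  then obtain r where "0 < r" "block_mat S r x \<in> pos S 2"
    using matrix_order_unit[OF block_mat_closed[OF x]] shift_block[OF x] by fastforce
  then have nonempty: "{t. 0 < t \<and> block_mat S t x \<in> pos S 2} \<noteq> {}"
    by blast
  obtain t where "t \<in> {t. 0 < t \<and> block_mat S t x \<in> pos S 2}" "t < \<epsilon>"
    by (rule bexE[OF cInf_lessD[OF nonempty less[unfolded os_norm_single[OF x]]]])
  then show ?thesis
    using that[of t] by simp
qed

end

lemma kernel_quotient:
  assumes S: "operator_system S" and J: "os_kernel S J"
  shows "os_surjection S (os_quotient S J) (quot_map S J)"
    and "operator_system (os_quotient S J)"
    and "ucp_map S (os_quotient S J) (quot_map S J)"
    and "\<And>x. x \<in> carrier S \<Longrightarrow> quot_map S J x = \<zero>\<^bsub>os_quotient S J\<^esub> \<longleftrightarrow> x \<in> J"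
    and "J \<subseteq> carrier S"
    and "\<And>x. x \<in> J \<Longrightarrow> \<ominus>\<^bsub>S\<^esub> x \<in> J"
proof -
  obtain T :: "'a set opsys" and f where T: "operator_system T" "ucp_map S T f"
    and J_eq: "J = {x \<in> carrier S. f x = \<zero>\<^bsub>T\<^esub>}"
    using J unfolding os_kernel_def by blast
  note * = operator_system_quotient[OF S T J_eq]
  show "os_surjection S (os_quotient S J) (quot_map S J)" "operator_system (os_quotient S J)"
    "ucp_map S (os_quotient S J) (quot_map S J)"
    "\<And>x. x \<in> carrier S \<Longrightarrow> quot_map S J x = \<zero>\<^bsub>os_quotient S J\<^esub> \<longleftrightarrow> x \<in> J"
    by (rule *; assumption)+
  interpret f: ucp S T f
    by (rule ucpI[OF S T])
  show "J \<subseteq> carrier S" "\<And>x. x \<in> J \<Longrightarrow> \<ominus>\<^bsub>S\<^esub> x \<in> J"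
    by (auto simp: J_eq)
qed

theorem theorem4p28:
  fixes S :: "nat \<Rightarrow> 'a opsys" and \<phi> :: "nat \<Rightarrow> 'a \<Rightarrow> 'a"
    and J :: "nat \<Rightarrow> 'a set"
    and \<psi> :: "nat \<Rightarrow> 'a set \<Rightarrow> 'a set"
    and L :: "'b opsys" and \<phi>_inf :: "nat \<Rightarrow> 'a \<Rightarrow> 'b"
    and M :: "'c opsys" and \<psi>_inf :: "nat \<Rightarrow> 'a set \<Rightarrow> 'c"
    and limJ :: "'b set"
  assumes "os_inductive_system S \<phi>"
    and "\<And>k. completely_biproximinal_kernel (S k) (J k)"
    and "\<And>k. \<phi> k ` J k \<subseteq> J (Suc k)"
    and "\<And>k. ucp_map (os_quotient (S k) (J k)) (os_quotient (S (Suc k)) (J (Suc k))) (\<psi> k)"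
    and "\<And>k x. x \<in> carrier (S k) \<Longrightarrow>
           \<psi> k (quot_map (S k) (J k) x) = quot_map (S (Suc k)) (J (Suc k)) (\<phi> k x)"
    and "os_inductive_limit S \<phi> L \<phi>_inf"
    and "os_inductive_limit (\<lambda>k. os_quotient (S k) (J k)) \<psi> M \<psi>_inf"
    and "limJ = os_closure L (\<Union>k. \<phi>_inf k ` J k)"
  shows "\<exists>\<rho>. unital_complete_order_iso M (os_quotient L limJ) \<rho> \<and>
           (\<forall>k. \<forall>x\<in>carrier (S k).
              \<rho> (\<psi>_inf k (quot_map (S k) (J k) x)) = quot_map L limJ (\<phi>_inf k x))"
proof -
  define Q where "Q k = os_quotient (S k) (J k)" for k
  define q where "q k = quot_map (S k) (J k)" for k
  have S: "operator_system (S k)" for k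
    using assms(1) by (simp add: os_inductive_system_def)
  have "os_kernel (S k) (J k)" for k
    using assms(2) by (simp add: completely_biproximinal_kernel_def)
  note ker = kernel_quotient[OF S this, folded Q_def q_def]
  have \<psi>_q: "\<psi> k (q k x) = q (Suc k) (\<phi> k x)" if "x \<in> carrier (S k)" for k x
    using assms(5) that by (simp add: q_def)
  have Q_system: "os_inductive_system Q \<psi>"
    using assms(4) ker(2) by (simp add: os_inductive_system_def Q_def)
  interpret L: os_limit S \<phi> L \<phi>_inf
    by unfold_locales fact+
  interpret M: os_limit Q \<psi> M \<psi>_inf
    by unfold_locales (use Q_system assms(7) in \<open>simp_all add: Q_def[abs_def]\<close>)
  note L_op = L.operator_system_L and M_op = M.operator_system_L
  interpret Lp: pre_operator_system L
    by (rule pre_operator_system[OF L_op])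
  interpret Mp: pre_operator_system M
    by (rule pre_operator_system[OF M_op])
  have q_closed: "q k x \<in> carrier (Q k)" if "x \<in> carrier (S k)" for k x
    using ker(3) that by (rule ucp_map_closed)
  have Q_elem: "\<exists>x\<in>carrier (S k). a = q k x" if "a \<in> carrier (Q k)" for k a
    using that os_surjection.carrier_Q[OF ker(1)] by blast
  \<comment> \<open>The relation between \<open>\<psi>\<close> and the quotient maps, iterated. It
    identifies a far term of a germ in the quotients as the coset of a term in \<open>S m\<close>,
    where biproximinality can be applied.\<close>
  have q_germ: "q m (germ S \<phi> k x m) = germ Q \<psi> k (q k x) m" if "k \<le> m" "x \<in> carrier (S k)" for k m x
    using that(1)
  proof (induction m rule: dec_induct)
    case (step m)
    show ?case
      unfolding L.germ_step[OF step.hyps(1)] M.germ_step[OF step.hyps(1)] step.IH[symmetric]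
      by (rule \<psi>_q[OF L.seq_closed[OF L.germ_closed[OF that(2)]], symmetric])
  qed (simp only: L.germ_self M.germ_self)

  \<comment> \<open>The induced map from \<open>L\<close> to \<open>M\<close>\<close>
  have "os_cocone S \<phi> M (\<lambda>k x. \<psi>_inf k (q k x))"
    unfolding os_cocone_def
  proof (intro conjI allI ballI M_op)
    fix k
    show "ucp_map (S k) M (\<lambda>x. \<psi>_inf k (q k x))"
      using ker(3) M.ucp_map_to_limit by (rule ucp_map_comp)
    fix x assume x: "x \<in> carrier (S k)"
    show "\<psi>_inf (Suc k) (q (Suc k) (\<phi> k x)) = \<psi>_inf k (q k x)"
      using M.cocone q_closed[OF x] \<psi>_q[OF x] by (metis os_cocone_def)
  qed
  then obtain u where u: "ucp_map L M u"
    and u_eta: "\<And>k x. x \<in> carrier (S k) \<Longrightarrow> u (\<phi>_inf k x) = \<psi>_inf k (q k x)"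
    using L.limit_universal by blast
  interpret u: ucp L M u
    by (rule ucpI[OF L_op M_op u])

  have u_J: "u (\<phi>_inf k y) = \<zero>\<^bsub>M\<^esub>" if "y \<in> J k" for k y
  proof -
    interpret \<psi>: ucp "Q k" M "\<psi>_inf k"
      by (rule ucpI[OF ker(2) M_op M.ucp_map_to_limit])
    have y: "y \<in> carrier (S k)"
      using that ker(5) by blast
    then have "q k y = \<zero>\<^bsub>Q k\<^esub>"
      using that ker(4) by blast
    then show ?thesis
      using u_eta[OF y] \<psi>.zero by simp
  qed

  \<comment> \<open>The kernel of the induced map\<close>
  have limJ_eq: "limJ = {x \<in> carrier L. u x = \<zero>\<^bsub>M\<^esub>}"
  proof (intro equalityI subsetI CollectI conjI)
    fix x assume "x \<in> limJ"
    then have x: "x \<in> carrier L" and approx: "\<And>\<epsilon>. \<epsilon> > 0 \<Longrightarrow>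
        \<exists>k. \<exists>y\<in>J k. os_norm L 1 (mat 1 1 (\<lambda>_. x \<ominus>\<^bsub>L\<^esub> \<phi>_inf k y)) < \<epsilon>"
      by (auto simp: assms(8) os_closure_def)
    show "x \<in> carrier L"
      by (rule x)
    show "u x = \<zero>\<^bsub>M\<^esub>"
    proof (rule operator_system_null[OF M_op Mp.null_elemI])
      show ux: "u x \<in> carrier M"
        using x by (rule u.closed)
      fix \<epsilon> :: real assume "\<epsilon> > 0"
      then obtain k y where y: "y \<in> J k"
        and less: "os_norm L 1 (mat 1 1 (\<lambda>_. x \<ominus>\<^bsub>L\<^esub> \<phi>_inf k y)) < \<epsilon>"
        using approx by blast
      have yc: "\<phi>_inf k y \<in> carrier L"
        using y ker(5) by (blast intro: L.limit_closed)
      then have d: "x \<ominus>\<^bsub>L\<^esub> \<phi>_inf k y \<in> carrier L"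
        using x by simp
      obtain t where "t < \<epsilon>" and t: "block_mat L t (x \<ominus>\<^bsub>L\<^esub> \<phi>_inf k y) \<in> pos L 2"
        using Lp.os_norm_lessD[OF d less] .
      \<comment> \<open>\<open>u\<close> kills the approximating element, so the bound on the
        difference becomes the bound \<open>\<epsilon>\<close> on \<open>u x\<close> alone. As
        \<open>\<epsilon>\<close> is arbitrary, \<open>u x\<close> is null.\<close>
      have "u (x \<ominus>\<^bsub>L\<^esub> \<phi>_inf k y) = u x"
        using x yc u_J[OF y] by (simp add: a_minus_def)
      then show "block_mat M \<epsilon> (u x) \<in> pos M 2"
        using u.block_pos[OF d t] Mp.block_mono[OF _ ux less_imp_le[OF \<open>t < \<epsilon>\<close>]] by simp
    qed
  next
    fix x assume "x \<in> {x \<in> carrier L. u x = \<zero>\<^bsub>M\<^esub>}"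
    then have x: "x \<in> carrier L" "u x = \<zero>\<^bsub>M\<^esub>"
      by auto
    obtain k z where z: "z \<in> carrier (S k)" "x = \<phi>_inf k z"
      using L.limit_elem[OF x(1)] .
    have zero: "\<psi>_inf k (q k z) = \<zero>\<^bsub>M\<^esub>"
      using x z u_eta by simp
    have "\<exists>y\<in>(\<Union>k. \<phi>_inf k ` J k). os_norm L 1 (mat 1 1 (\<lambda>_. x \<ominus>\<^bsub>L\<^esub> y)) < \<epsilon>" if \<epsilon>: "\<epsilon> > 0" for \<epsilon>
    proof -
      \<comment> \<open>Halving \<open>\<epsilon>\<close> leaves room to pass from a bound on the
        norm to the strict inequality from which an element below the infimum is extracted.\<close>
      have "\<forall>\<^sub>F m in sequentially. block_mat (Q m) (\<epsilon> / 2) (germ Q \<psi> k (q k z) m) \<in> pos (Q m) 2"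
        using M.limit_zeroD[OF q_closed[OF z(1)] zero half_gt_zero[OF \<epsilon>]] .
      then have "\<forall>\<^sub>F m in sequentially. k \<le> m \<and>
          block_mat (Q m) (\<epsilon> / 2) (germ Q \<psi> k (q k z) m) \<in> pos (Q m) 2"
        using eventually_ge_at_top[of k] by eventually_elim blast
      then obtain m where m: "k \<le> m"
        and pos: "block_mat (Q m) (\<epsilon> / 2) (germ Q \<psi> k (q k z) m) \<in> pos (Q m) 2"
        unfolding eventually_sequentially by blast
      define w where "w = germ S \<phi> k z m"
      have w: "w \<in> carrier (S m)"
        using L.seq_closed[OF L.germ_closed[OF z(1)]] by (simp add: w_def)
      have xw: "x = \<phi>_inf m w"
        using L.limit_germ[OF m z(1)] z(2) by (simp add: w_def)
      let ?W = "mat 1 1 (\<lambda>_. w)"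
      have "block_mat (Q m) (\<epsilon> / 2) (q m w) \<in> pos (Q m) 2"
        using pos q_germ[OF m z(1)] by (simp add: w_def)
      then have "os_norm (Q m) 1 (mat 1 1 (\<lambda>_. q m w)) \<le> \<epsilon> / 2"
        using q_closed[OF w] \<epsilon> by (intro M.S.os_norm_le) auto
      also have "mat 1 1 (\<lambda>_. q m w) = map_mat (q m) ?W"
        by (rule eq_matI) auto
      also have "os_norm (Q m) 1 (map_mat (q m) ?W)
          = (INF Y\<in>mats 1 (J m). os_norm (S m) 1 (add_mats (S m) ?W Y))"
      proof -
        have "?W \<in> mats 1 (carrier (S m))"
          using w by (simp add: mats_iff)
        then show ?thesis
          using assms(2)[of m] unfolding completely_biproximinal_kernel_def Q_def q_def by blast
      qed
      finally have "(INF Y\<in>mats 1 (J m). os_norm (S m) 1 (add_mats (S m) ?W Y)) < \<epsilon>"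
        using \<epsilon> by simp
      moreover have "mats 1 (J m) \<noteq> {}"
      proof -
        have "\<zero>\<^bsub>S m\<^esub> \<in> J m"
          using ker(4)[of "\<zero>\<^bsub>S m\<^esub>" m] os_surjection.q_zero[OF ker(1)] by simp
        then have "mat 1 1 (\<lambda>_. \<zero>\<^bsub>S m\<^esub>) \<in> mats 1 (J m)"
          by (simp add: mats_iff)
        then show ?thesis
          by blast
      qed
      \<comment> \<open>The infimum need not be attained; an element of \<open>J m\<close> within
        \<open>\<epsilon>\<close> suffices for the closure.\<close>
      ultimately obtain Y where Y: "Y \<in> mats 1 (J m)"
        and less: "os_norm (S m) 1 (add_mats (S m) ?W Y) < \<epsilon>"
        using cInf_lessD[of "(\<lambda>Y. os_norm (S m) 1 (add_mats (S m) ?W Y)) ` mats 1 (J m)" \<epsilon>] by blast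
      define y where "y = Y $$ (0, 0)"
      have y: "y \<in> J m" "y \<in> carrier (S m)"
        using Y ker(5)[of m] by (auto simp: mats_iff y_def)
      have "add_mats (S m) ?W Y = mat 1 1 (\<lambda>_. w \<oplus>\<^bsub>S m\<^esub> y)"
        by (rule eq_matI) (auto simp: y_def)
      moreover have wy: "w \<oplus>\<^bsub>S m\<^esub> y \<in> carrier (S m)"
        using w y by simp
      ultimately obtain t where t: "0 < t" "t < \<epsilon>" "block_mat (S m) t (w \<oplus>\<^bsub>S m\<^esub> y) \<in> pos (S m) 2"
        using L.S.os_norm_lessD less by metis
      interpret \<phi>: ucp "S m" L "\<phi>_inf m"
        by (rule ucpI[OF S L_op L.ucp_map_to_limit])
      \<comment> \<open>The quotient norm adds elements of \<open>J m\<close>, the closure subtracts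
        them; this is where \<open>J m\<close> has to be closed under negation.\<close>
      have "\<phi>_inf m (w \<oplus>\<^bsub>S m\<^esub> y) = x \<ominus>\<^bsub>L\<^esub> \<phi>_inf m (\<ominus>\<^bsub>S m\<^esub> y)"
        using w y xw by (simp add: a_minus_def Lp.M.minus_minus)
      moreover have "os_norm L 1 (mat 1 1 (\<lambda>_. \<phi>_inf m (w \<oplus>\<^bsub>S m\<^esub> y))) \<le> t"
        by (rule Lp.os_norm_le[OF \<phi>.closed[OF wy] t(1) \<phi>.block_pos[OF wy t(3)]])
      ultimately show ?thesis
        using t(2) ker(6)[OF y(1)] by (intro bexI[of _ "\<phi>_inf m (\<ominus>\<^bsub>S m\<^esub> y)"]) auto
    qed
    then show "x \<in> limJ"
      using x(1) by (simp add: assms(8) os_closure_def)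
  qed

  \<comment> \<open>The quotient of \<open>L\<close> and the two mutually inverse maps\<close>
  define R where "R = os_quotient L limJ"
  define \<gamma> where "\<gamma> = quot_map L limJ"
  note R = operator_system_quotient[OF L_op M_op u limJ_eq, folded R_def \<gamma>_def]
  interpret \<gamma>: os_surjection L R \<gamma>
    by (rule R(1))
  obtain g where g: "ucp_map R M g" and g_\<gamma>: "\<And>x. x \<in> carrier L \<Longrightarrow> g (\<gamma> x) = u x"
  proof -
    have "u x = \<zero>\<^bsub>M\<^esub>" if "x \<in> carrier L" "\<gamma> x = \<zero>\<^bsub>R\<^esub>" for x
      using that R(4) by (simp add: limJ_eq)
    then show thesis
      using \<gamma>.factor[OF Mp.pre_operator_system_axioms u] that by blast
  qed

  \<comment> \<open>The composite from \<open>S k\<close> to \<open>R\<close> kills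
    \<open>J k\<close>: the image of \<open>J k\<close> in \<open>L\<close> lies in the kernel of
    \<open>u\<close>, which is also the kernel of \<open>\<gamma>\<close>.\<close>
  have "\<exists>\<tau>. ucp_map (Q k) R \<tau> \<and> (\<forall>x\<in>carrier (S k). \<tau> (q k x) = \<gamma> (\<phi>_inf k x))" for k
  proof -
    interpret qk: os_surjection "S k" "Q k" "q k"
      by (rule ker(1))
    have "\<gamma> (\<phi>_inf k x) = \<zero>\<^bsub>R\<^esub>" if "x \<in> carrier (S k)" "q k x = \<zero>\<^bsub>Q k\<^esub>" for x
    proof -
      have "x \<in> J k"
        using that ker(4) by blast
      then show ?thesis
        using R(4)[OF L.limit_closed[OF that(1)]] u_J L.limit_closed[OF that(1)]
        by (simp add: limJ_eq)
    qed
    then obtain \<tau> where "ucp_map (Q k) R \<tau>" "\<And>x. x \<in> carrier (S k) \<Longrightarrow> \<tau> (q k x) = \<gamma> (\<phi>_inf k x)"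
      using qk.factor[OF \<gamma>.pre_operator_system_Q ucp_map_comp[OF L.ucp_map_to_limit R(3)]] by blast
    then show ?thesis
      by blast
  qed
  then obtain \<tau> where \<tau>: "\<And>k. ucp_map (Q k) R (\<tau> k)"
    and \<tau>_q: "\<And>k x. x \<in> carrier (S k) \<Longrightarrow> \<tau> k (q k x) = \<gamma> (\<phi>_inf k x)"
    by metis
  have "os_cocone Q \<psi> R \<tau>"
    unfolding os_cocone_def
  proof (intro conjI allI ballI R(2) \<tau>)
    fix k a assume "a \<in> carrier (Q k)"
    then obtain x where x: "x \<in> carrier (S k)" "a = q k x"
      using Q_elem by blast
    have "\<phi> k x \<in> carrier (S (Suc k))" "\<phi>_inf (Suc k) (\<phi> k x) = \<phi>_inf k x"
      using L.step.closed[OF x(1)] L.cocone x(1) by (auto simp: os_cocone_def)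
    then show "\<tau> (Suc k) (\<psi> k a) = \<tau> k a"
      using x by (simp add: \<psi>_q \<tau>_q)
  qed
  then obtain \<rho> where \<rho>: "ucp_map M R \<rho>" and \<rho>_eta: "\<And>k a. a \<in> carrier (Q k) \<Longrightarrow> \<rho> (\<psi>_inf k a) = \<tau> k a"
    using M.limit_universal by blast
  have \<rho>_q: "\<rho> (\<psi>_inf k (q k x)) = \<gamma> (\<phi>_inf k x)" if "x \<in> carrier (S k)" for k x
    using that by (simp add: \<rho>_eta q_closed \<tau>_q)
  have g_\<rho>: "g (\<rho> a) = a" if a: "a \<in> carrier M" for a
  proof -
    obtain k b where b: "b \<in> carrier (Q k)" "a = \<psi>_inf k b"
      using M.limit_elem[OF a] .
    then obtain x where "x \<in> carrier (S k)" "b = q k x"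
      using Q_elem by blast
    then show ?thesis
      using b by (simp add: \<rho>_q g_\<gamma> u_eta L.limit_closed)
  qed
  have \<rho>_g: "\<rho> (g c) = c" if c: "c \<in> carrier R" for c
  proof -
    obtain a where a: "a \<in> carrier L" "c = \<gamma> a"
      using c unfolding \<gamma>.carrier_Q by auto
    obtain k x where "x \<in> carrier (S k)" "a = \<phi>_inf k x"
      using L.limit_elem[OF a(1)] .
    then show ?thesis
      using a by (simp add: \<rho>_q g_\<gamma> u_eta)
  qed
  have bij: "bij_betw \<rho> (carrier M) (carrier R)"
    using g_\<rho> \<rho>_g ucp_map_closed[OF \<rho>] ucp_map_closed[OF g]
    by (intro bij_betwI[where g = g]) auto
  \<comment> \<open>\<open>g\<close> is the inverse of \<open>\<rho>\<close> on the carrier of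
    \<open>R\<close>, and agreement there transfers complete positivity from \<open>g\<close> to
    \<open>inv_into\<close>.\<close>
  have "inv_into (carrier M) \<rho> c = g c" if "c \<in> carrier R" for c
    using that \<rho>_g ucp_map_closed[OF g] bij by (metis bij_betw_imp_inj_on inv_into_f_f)
  then have "ucp_map R M (inv_into (carrier M) \<rho>)"
    by (intro ucp_map_cong[OF R(2) g]) simp
  then show ?thesis
    using bij \<rho> \<rho>_q unfolding unital_complete_order_iso_def R_def \<gamma>_def q_def by blast
qed

end
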